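(* (Dynamic programming equation.) In the controlled homodyne model of the context, suppose $\mu^*=\{g_0^*,\ldots,g_{k-1}^*\}\in\mathfrak{K}_S$ is optimal in $\mathfrak{K}_S$, i.e. $J(\mu^* )\le J(\mu)$ for any $\mu\in\mathfrak{K}_S$, and define $V_l(\rho)=W_l(\mu^*,\rho)$. Then $$V_l(\rho)=\inf_{u\in\mathfrak{U}}\Bigl[\mathrm{Tr}[\rho Q(u)]\,\Delta t+\sum_{\Delta y=\pm\lambda}p(\Delta y;\rho,u)\,V_{l+1}(\Gamma(\rho,u,\Delta y))\Bigr],\quad l<k,\qquad V_k(\rho)=\mathrm{Tr}[\rho K],$$ for all $l$ and any $\rho$ that is reachable under $\mu^*$ in the sense that $\mathbf{P}^{\mu^*}(\rho_l^{\mu^*}=\rho)>0$. Moreover, the infimum is attained at $u=g_l^*(\rho)$.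
   Context: Let $\mathscr{M}=M_2(\mathbb{C})$, $\sigma_-=\begin{pmatrix}0&0\\1&0\end{pmatrix}$, $\sigma_+=\sigma_-^*$, $\Phi=(0,1)^T$, $\phi(X)=\langle\Phi,X\Phi\rangle$, $k\in\mathbb{N}$, $T>0$, $\lambda=\sqrt{T/k}$, $\Delta t=\lambda^2$, $\mathscr{W}_k=\mathscr{M}^{\otimes k}$, $\mathcal{S}$ the set of $2\times2$ density matrices (self-adjoint, nonnegative, unit trace), $\rho_0\in\mathcal{S}$, and $\mathbb{P}=\mathrm{Tr}[\rho_0\,\cdot\,]\otimes\phi^{\otimes k}$ on $\mathscr{M}\otimes\mathscr{W}_k$. $X\in\mathscr{M}$ is identified with $X\otimes I$; $X_i$ is $X$ in the $i$-th factor of $\mathscr{W}_k$. $\Delta A(i)=\lambda(\sigma_-)_i$, $\Delta A^*(i)=\lambda(\sigma_+)_i$, $\Delta\Lambda(i)=(\sigma_+\sigma_-)_i$, $\Delta t(i)=\lambda^2I$, $\Delta Z(i)=\Delta A(i)+\Delta A^*(i)$. Control set $\mathfrak{U}\subset\mathbb{R}$; for each $u\in\mathfrak{U}$ matrices $L_1(u),L_2(u),L_3(u)\in\mathscr{M}$ with $L_1(u),L_3(u)$ self-adjoint; $M_l(u)=\exp(-i\{L_1(u)\Delta\Lambda(l)+L_2(u)\Delta A^*(l)+L_2(u)^*\Delta A(l)+L_3(u)\Delta t(l)\})=I+M^\pm(u)\Delta\Lambda(l)+M^+(u)\Delta A^*(l)+M^-(u)\Delta A(l)+M^\circ(u)\Delta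 t(l)$ with unique $M^{\pm},M^+,M^-,M^\circ$ at $u$ in $\mathscr{M}$. Admissible strategies $\mathfrak{K}$: $\mu=\{f_1,\ldots,f_k\}$ with $f_l$ a $\mathfrak{U}$-valued function of the first $l-1$ observations. Put $\check{\mathfrak{u}}_l=f_l(\Delta Z(1),\ldots,\Delta Z(l-1))$ (joint functional calculus), and for an operator-valued function $F$ on $\mathfrak{U}$ set $F(\check{\mathfrak{u}}_l)=\sum_{u}F(u)P_{\check{\mathfrak{u}}_l}(u)$, with $P_{\check{\mathfrak u}_l}(u)$ the eigenprojector of $\check{\mathfrak{u}}_l$ for eigenvalue $u$. $U^\mu(0)=I$, $U^\mu(l)=M_l(\check{\mathfrak{u}}_l)\cdots M_1(\check{\mathfrak{u}}_1)$, $j_l^\mu(X)=U^\mu(l)^*XU^\mu(l)$, $\Delta Y^\mu(l)=U^\mu(l)^*\Delta Z(l)U^\mu(l)$. The observables $\Delta Y^\mu(1),\dots,\Delta Y^\mu(k)$ commute and correspond (by simultaneous diagonalization) to classical $\{\pm\lambda\}$-valued random variables $\Delta y^\mu_1,\ldots,\Delta y^\mu_k$ on a finite probability space with measure $\mathbf{P}^\mu$ and expectation $\mathbf{E}^\mu$. Cost: $Q:\mathfrak{U}\to\mathscr{M}$, $K\in\mathscr{M}$ with $Q(u),K$ self-adjoint and nonnegative, and $J(\mu)=\mathbb{P}\bigl[\sum_{l=1}^kj_{l-1}^\mu(Q(\check{\mathfrak{u}}_l))\Delta t(l)+j_k^\mu(K)\bigr]$. Filter: define $\overline{\mathcal{L}}(\rho,u)=M^+(u)\rho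 M^+(u)^*+\lambda^2M^\circ(u)\rho M^\circ(u)^*+M^\circ(u)\rho+\rho M^\circ(u)^*$, $\overline{\mathcal{J}}(\rho,u)=M^+(u)\rho+\rho M^+(u)^*+\lambda^2M^+(u)\rho M^\circ(u)^*+\lambda^2M^\circ(u)\rho M^+(u)^*$, $$\Gamma(\rho,u,\Delta y)=\rho+\lambda^2\overline{\mathcal{L}}(\rho,u)+\frac{\overline{\mathcal{J}}(\rho,u)-\mathrm{Tr}[\overline{\mathcal{J}}(\rho,u)](\rho+\lambda^2\overline{\mathcal{L}}(\rho,u))}{1-\lambda^2\mathrm{Tr}[\overline{\mathcal{J}}(\rho,u)]^2}\bigl(\Delta y-\lambda^2\mathrm{Tr}[\overline{\mathcal{J}}(\rho,u)]\bigr),$$ $p(\Delta y=\pm\lambda;\rho,u)=\frac12\pm\frac\lambda2\mathrm{Tr}[\overline{\mathcal{J}}(\rho,u)]$. The conditional density matrix is $\rho_0^\mu=\rho_0$, $\rho^\mu_l=\Gamma(\rho^\mu_{l-1},u^\mu_l,\Delta y^\mu_l)$ with $u^\mu_l=f_l(\Delta y_1^\mu,\ldots,\Delta y_{l-1}^\mu)$; the conditional probability of $\Delta y_l^\mu=\pm\lambda$ given $\Delta y_1^\mu,\ldots,\Delta y_{l-1}^\mu$ is $p(\Delta y=\pm\lambda;\rho_{l-1}^\mu,u_l^\mu)$. Separated strategies $\mathfrak{K}_S\subset\mathfrak{K}$: those given by functions $g_0,\ldots,g_{k-1}:\mathcal{S}\to\mathfrak{U}$ through $u_l^\mu=g_{l-1}(\rho_{l-1}^\mu)$.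 The cost-to-go of $\mu\in\mathfrak{K}_S$ is defined as the conditional expectation $$W_l(\mu,\rho)=\mathbf{E}^\mu\Bigl[\sum_{i=l+1}^k\mathrm{Tr}[\rho^\mu_{i-1}Q(u_i^\mu)]\,\Delta t+\mathrm{Tr}[\rho_k^\mu K]\,\Big|\,\rho_l^\mu=\rho\Bigr].$$ By the Markov property of the controlled filter it obeys $W_k(\mu,\rho)=\mathrm{Tr}[\rho K]$ and $W_l(\mu,\rho)=\mathrm{Tr}[\rho Q(g_l(\rho))]\Delta t+\sum_{\Delta y=\pm\lambda}p(\Delta y;\rho,g_l(\rho))\,W_{l+1}(\mu,\Gamma(\rho,g_l(\rho),\Delta y))$. (For non-reachable $\rho$ the cost-to-go is a conditional expectation on a set of measure zero and is thus not unique.) *)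

theory Defs
  imports
    "HOL-Analysis.Analysis"
    "Jordan_Normal_Form.Schur_Decomposition"
begin

unbundle no vec_syntax
hide_type (open) Finite_Cartesian_Product.vec
hide_const (open) Finite_Cartesian_Product.vec Finite_Cartesian_Product.mat
  Determinants.trace Determinants.det

section \<open>Finite-dimensional operators as complex matrices\<close>

definition tr :: "complex mat \<Rightarrow> complex" where
  "tr A = (\<Sum>i<dim_row A. A $$ (i, i))"

definition selfadjoint :: "complex mat \<Rightarrow> bool" where
  "selfadjoint A \<longleftrightarrow> mat_adjoint A = A"

definition nonnegative :: "complex mat \<Rightarrow> bool" where
  "nonnegative A \<longleftrightarrow> (\<forall>v \<in> carrier_vec (dim_row A). 0 \<le> Re ((A *\<^sub>v v) \<bullet>c v))"

definition density_matrices :: "complex mat set" where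
  "density_matrices = {\<rho> \<in> carrier_mat 2 2. selfadjoint \<rho> \<and> nonnegative \<rho> \<and> tr \<rho> = 1}"

definition kron :: "complex mat \<Rightarrow> complex mat \<Rightarrow> complex mat" where
  "kron A B = Matrix.mat (dim_row A * dim_row B) (dim_col A * dim_col B)
     (\<lambda>(i, j). A $$ (i div dim_row B, j div dim_col B) * B $$ (i mod dim_row B, j mod dim_col B))"

primrec kron_pow :: "complex mat \<Rightarrow> nat \<Rightarrow> complex mat" where
  "kron_pow X 0 = 1\<^sub>m 1"
| "kron_pow X (Suc n) = kron X (kron_pow X n)"

text \<open>The library type of matrices of varying dimension carries no class-based addition, so finite
  sums of \<open>n \<times> n\<close> matrices and the exponential series are formed entrywise.\<close>

definition msum :: "nat \<Rightarrow> ('a \<Rightarrow> complex mat) \<Rightarrow> 'a set \<Rightarrow> complex mat" where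
  "msum n F S = Matrix.mat n n (\<lambda>ij. \<Sum>x\<in>S. F x $$ ij)"

definition mexp :: "complex mat \<Rightarrow> complex mat" where
  "mexp A = Matrix.mat (dim_row A) (dim_row A) (\<lambda>ij. \<Sum>n. (A ^\<^sub>m n) $$ ij / fact n)"

text \<open>Orthogonal projector onto the eigenspace of a self-adjoint \<open>A\<close> at the real number \<open>a\<close>; it is
  \<open>0\<close> if \<open>a\<close> is not an eigenvalue.\<close>

definition eigenproj :: "complex mat \<Rightarrow> real \<Rightarrow> complex mat" where
  "eigenproj A a = (THE E. E \<in> carrier_mat (dim_row A) (dim_row A) \<and> E * E = E \<and> selfadjoint E \<and>
     (\<forall>v \<in> carrier_vec (dim_row A). E *\<^sub>v v = v \<longleftrightarrow> A *\<^sub>v v = complex_of_real a \<cdot>\<^sub>v v))"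

text \<open>For commuting self-adjoint \<open>A\<^sub>1, \<dots>, A\<^sub>n\<close>: the joint spectral projector at
  \<open>(a\<^sub>1, \<dots>, a\<^sub>n)\<close>, on a space of dimension \<open>d\<close>.\<close>

definition joint_eigenproj :: "nat \<Rightarrow> complex mat list \<Rightarrow> real list \<Rightarrow> complex mat" where
  "joint_eigenproj d As as = foldr (\<lambda>(A, a) E. eigenproj A a * E) (zip As as) (1\<^sub>m d)"

text \<open>The substitution \<open>F(\<check>u) = \<Sum>\<^sub>u F(u) P(u)\<close> over the spectrum of a self-adjoint \<open>A\<close>.\<close>

definition at_operator :: "(real \<Rightarrow> complex mat) \<Rightarrow> complex mat \<Rightarrow> complex mat" where
  "at_operator F A =
     msum (dim_row A) (\<lambda>u. F u * eigenproj A u) {u. eigenvalue A (complex_of_real u)}"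

definition sigma_minus :: "complex mat" where
  "sigma_minus = mat_of_rows_list 2 [[0, 0], [1, 0]]"

definition sigma_plus :: "complex mat" where
  "sigma_plus = mat_adjoint sigma_minus"

definition Phi :: "complex Matrix.vec" where
  "Phi = vec_of_list [0, 1]"

section \<open>The controlled homodyne model\<close>

record homodyne =
  slots :: nat                          \<comment> \<open>the number \<open>k\<close> of time steps\<close>
  horizon :: real                       \<comment> \<open>the final time \<open>T\<close>\<close>
  init :: "complex mat"                 \<comment> \<open>the initial density matrix \<open>\<rho>\<^sub>0\<close>\<close>
  controls :: "real set"
  L1 :: "real \<Rightarrow> complex mat"
  L2 :: "real \<Rightarrow> complex mat"
  L3 :: "real \<Rightarrow> complex mat"
  Qcost :: "real \<Rightarrow> complex mat"
  Kcost :: "complex mat"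

definition homodyne_model :: "homodyne \<Rightarrow> bool" where
  "homodyne_model m \<longleftrightarrow>
     0 < slots m \<and> 0 < horizon m \<and> init m \<in> density_matrices \<and>
     (\<forall>u \<in> controls m.
        L1 m u \<in> carrier_mat 2 2 \<and> selfadjoint (L1 m u) \<and>
        L2 m u \<in> carrier_mat 2 2 \<and>
        L3 m u \<in> carrier_mat 2 2 \<and> selfadjoint (L3 m u) \<and>
        Qcost m u \<in> carrier_mat 2 2 \<and> selfadjoint (Qcost m u) \<and> nonnegative (Qcost m u)) \<and>
     Kcost m \<in> carrier_mat 2 2 \<and> selfadjoint (Kcost m) \<and> nonnegative (Kcost m)"

definition lam :: "homodyne \<Rightarrow> real" where
  "lam m = sqrt (horizon m / real (slots m))"

definition dt :: "homodyne \<Rightarrow> real" where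
  "dt m = (lam m)\<^sup>2"

definition dimH :: "homodyne \<Rightarrow> nat" where
  "dimH m = 2 ^ Suc (slots m)"

text \<open>\<open>amp m i X\<close> is \<open>X\<close> acting on the \<open>i\<close>-th tensor factor; factor \<open>0\<close> is the system, factors
  \<open>1, \<dots>, k\<close> are the field.\<close>

definition amp :: "homodyne \<Rightarrow> nat \<Rightarrow> complex mat \<Rightarrow> complex mat" where
  "amp m i X = kron (kron (1\<^sub>m (2 ^ i)) X) (1\<^sub>m (2 ^ (slots m - i)))"

text \<open>The state \<open>Tr[\<rho>\<^sub>0 \<cdot>] \<otimes> \<phi>\<^sup>\<otimes>\<^sup>k\<close>, given by the product density matrix
  \<open>\<rho>\<^sub>0 \<otimes> |\<Phi>\<rangle>\<langle>\<Phi>|\<^sup>\<otimes>\<^sup>k\<close>.\<close>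

definition vacuum_proj :: "complex mat" where
  "vacuum_proj = Matrix.mat 2 2 (\<lambda>(i, j). Phi $ i * cnj (Phi $ j))"

definition qstate :: "homodyne \<Rightarrow> complex mat \<Rightarrow> complex" where
  "qstate m A = tr (kron (init m) (kron_pow vacuum_proj (slots m)) * A)"

definition DA :: "homodyne \<Rightarrow> nat \<Rightarrow> complex mat" where
  "DA m i = complex_of_real (lam m) \<cdot>\<^sub>m amp m i sigma_minus"

definition DAs :: "homodyne \<Rightarrow> nat \<Rightarrow> complex mat" where
  "DAs m i = complex_of_real (lam m) \<cdot>\<^sub>m amp m i sigma_plus"

definition DLambda :: "homodyne \<Rightarrow> nat \<Rightarrow> complex mat" where
  "DLambda m i = amp m i (sigma_plus * sigma_minus)"

definition Dt :: "homodyne \<Rightarrow> nat \<Rightarrow> complex mat" where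
  "Dt m i = complex_of_real ((lam m)\<^sup>2) \<cdot>\<^sub>m 1\<^sub>m (dimH m)"

definition DZ :: "homodyne \<Rightarrow> nat \<Rightarrow> complex mat" where
  "DZ m i = DA m i + DAs m i"

definition Mop :: "homodyne \<Rightarrow> nat \<Rightarrow> real \<Rightarrow> complex mat" where
  "Mop m l u = mexp ((- \<i>) \<cdot>\<^sub>m
     (amp m 0 (L1 m u) * DLambda m l + amp m 0 (L2 m u) * DAs m l +
      amp m 0 (mat_adjoint (L2 m u)) * DA m l + amp m 0 (L3 m u) * Dt m l))"

text \<open>The coefficients \<open>(M\<^sup>\<plusminus>, M\<^sup>+, M\<^sup>-, M\<^sup>\<circ>)\<close> at \<open>u\<close>, which do not depend on the time slot.\<close>

definition Mcoeffs ::
  "homodyne \<Rightarrow> real \<Rightarrow> complex mat \<times> complex mat \<times> complex mat \<times> complex mat" where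
  "Mcoeffs m u = (THE c. case c of (Mpm, Mp, Mm, Mo) \<Rightarrow>
     Mpm \<in> carrier_mat 2 2 \<and> Mp \<in> carrier_mat 2 2 \<and> Mm \<in> carrier_mat 2 2 \<and> Mo \<in> carrier_mat 2 2 \<and>
     (\<forall>l \<in> {1..slots m}. Mop m l u = 1\<^sub>m (dimH m) + amp m 0 Mpm * DLambda m l +
        amp m 0 Mp * DAs m l + amp m 0 Mm * DA m l + amp m 0 Mo * Dt m l))"

definition Mplus :: "homodyne \<Rightarrow> real \<Rightarrow> complex mat" where
  "Mplus m u = fst (snd (Mcoeffs m u))"

definition Mcirc :: "homodyne \<Rightarrow> real \<Rightarrow> complex mat" where
  "Mcirc m u = snd (snd (snd (Mcoeffs m u)))"

section \<open>Strategies, controlled dynamics and observations\<close>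

definition paths :: "homodyne \<Rightarrow> nat \<Rightarrow> real list set" where
  "paths m n = {ys. length ys = n \<and> set ys \<subseteq> {lam m, - lam m}}"

text \<open>In \<open>f l ys\<close>, \<open>ys\<close> is the list of the first \<open>l - 1\<close> observations, \<open>1 \<le> l \<le> k\<close>.\<close>

type_synonym strategy = "nat \<Rightarrow> real list \<Rightarrow> real"

definition admissible_strategies :: "homodyne \<Rightarrow> strategy set" where
  "admissible_strategies m = {f. \<forall>l \<in> {1..slots m}. \<forall>ys \<in> paths m (l - 1). f l ys \<in> controls m}"

text \<open>\<open>f\<^sub>l(\<Delta>Z(1), \<dots>, \<Delta>Z(l-1))\<close> by joint functional calculus.\<close>

definition control_op :: "homodyne \<Rightarrow> strategy \<Rightarrow> nat \<Rightarrow> complex mat" where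
  "control_op m f l = msum (dimH m)
     (\<lambda>ys. complex_of_real (f l ys) \<cdot>\<^sub>m joint_eigenproj (dimH m) (map (DZ m) [1..<l]) ys)
     (paths m (l - 1))"

primrec Uop :: "homodyne \<Rightarrow> strategy \<Rightarrow> nat \<Rightarrow> complex mat" where
  "Uop m f 0 = 1\<^sub>m (dimH m)"
| "Uop m f (Suc l) = at_operator (Mop m (Suc l)) (control_op m f (Suc l)) * Uop m f l"

definition heisenberg :: "homodyne \<Rightarrow> strategy \<Rightarrow> nat \<Rightarrow> complex mat \<Rightarrow> complex mat" where
  "heisenberg m f l X = mat_adjoint (Uop m f l) * X * Uop m f l"

definition DY :: "homodyne \<Rightarrow> strategy \<Rightarrow> nat \<Rightarrow> complex mat" where
  "DY m f l = heisenberg m f l (DZ m l)"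

text \<open>\<open>Re\<close> below, and in the other real-valued quantities, only converts the type: the numbers are
  real.\<close>

definition total_cost :: "homodyne \<Rightarrow> strategy \<Rightarrow> real" where
  "total_cost m f = Re (qstate m
     (msum (dimH m)
        (\<lambda>l. heisenberg m f (l - 1)
                (at_operator (\<lambda>u. amp m 0 (Qcost m u)) (control_op m f l)) * Dt m l)
        {1..slots m} +
      heisenberg m f (slots m) (amp m 0 (Kcost m))))"

text \<open>The joint law of the observations \<open>(\<Delta>Y(1), \<dots>, \<Delta>Y(k))\<close>, on the space of all
  \<open>\<plusminus>\<lambda>\<close>-valued sequences \<open>ys\<close>; the random variable \<open>\<Delta>y\<^sub>l\<close> is \<open>ys ! (l - 1)\<close>.\<close>

definition obs_law :: "homodyne \<Rightarrow> strategy \<Rightarrow> real list measure" where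
  "obs_law m f = point_measure (paths m (slots m))
     (\<lambda>ys. ennreal (Re (qstate m
        (joint_eigenproj (dimH m) (map (DY m f) [1..<Suc (slots m)]) ys))))"

section \<open>Filter\<close>

definition Lbar :: "homodyne \<Rightarrow> complex mat \<Rightarrow> real \<Rightarrow> complex mat" where
  "Lbar m \<rho> u =
     Mplus m u * \<rho> * mat_adjoint (Mplus m u) +
     complex_of_real ((lam m)\<^sup>2) \<cdot>\<^sub>m (Mcirc m u * \<rho> * mat_adjoint (Mcirc m u)) +
     Mcirc m u * \<rho> + \<rho> * mat_adjoint (Mcirc m u)"

definition Jbar :: "homodyne \<Rightarrow> complex mat \<Rightarrow> real \<Rightarrow> complex mat" where
  "Jbar m \<rho> u =
     Mplus m u * \<rho> + \<rho> * mat_adjoint (Mplus m u) +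
     complex_of_real ((lam m)\<^sup>2) \<cdot>\<^sub>m (Mplus m u * \<rho> * mat_adjoint (Mcirc m u)) +
     complex_of_real ((lam m)\<^sup>2) \<cdot>\<^sub>m (Mcirc m u * \<rho> * mat_adjoint (Mplus m u))"

text \<open>If \<open>1 - \<lambda>\<^sup>2 Tr[J]\<^sup>2 = 0\<close>, one outcome is certain, the matrix in the numerator vanishes, and
  division by zero in HOL yields the correct state \<open>\<rho> + \<lambda>\<^sup>2 L\<close>.\<close>

definition Gam :: "homodyne \<Rightarrow> complex mat \<Rightarrow> real \<Rightarrow> real \<Rightarrow> complex mat" where
  "Gam m \<rho> u y =
     (let l2 = complex_of_real ((lam m)\<^sup>2);
          A = \<rho> + l2 \<cdot>\<^sub>m Lbar m \<rho> u;
          t = tr (Jbar m \<rho> u)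
      in A + ((complex_of_real y - l2 * t) / (1 - l2 * t\<^sup>2)) \<cdot>\<^sub>m (Jbar m \<rho> u - t \<cdot>\<^sub>m A))"

text \<open>To be used for \<open>y = \<plusminus>\<lambda>\<close>.\<close>

definition pr :: "homodyne \<Rightarrow> real \<Rightarrow> complex mat \<Rightarrow> real \<Rightarrow> real" where
  "pr m y \<rho> u = 1 / 2 + y / 2 * Re (tr (Jbar m \<rho> u))"

primrec cond_state :: "homodyne \<Rightarrow> strategy \<Rightarrow> nat \<Rightarrow> real list \<Rightarrow> complex mat" where
  "cond_state m f 0 ys = init m"
| "cond_state m f (Suc l) ys = Gam m (cond_state m f l ys) (f (Suc l) (take l ys)) (ys ! l)"

section \<open>Separated strategies and cost-to-go\<close>

text \<open>\<open>separated_by m f g\<close>: the strategy \<open>f\<close> is in separated form, with feedback maps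
  \<open>g 0, \<dots>, g (k - 1)\<close> on density matrices.\<close>

definition separated_by :: "homodyne \<Rightarrow> strategy \<Rightarrow> (nat \<Rightarrow> complex mat \<Rightarrow> real) \<Rightarrow> bool" where
  "separated_by m f g \<longleftrightarrow>
     f \<in> admissible_strategies m \<and>
     (\<forall>l < slots m. \<forall>\<rho> \<in> density_matrices. g l \<rho> \<in> controls m) \<and>
     (\<forall>l \<in> {1..slots m}. \<forall>ys \<in> paths m (l - 1). f l ys = g (l - 1) (cond_state m f (l - 1) ys))"

definition separated_strategies :: "homodyne \<Rightarrow> strategy set" where
  "separated_strategies m = {f. \<exists>g. separated_by m f g}"

definition state_event :: "homodyne \<Rightarrow> strategy \<Rightarrow> nat \<Rightarrow> complex mat \<Rightarrow> real list set" where
  "state_event m f l \<rho> = {ys \<in> space (obs_law m f). cond_state m f l ys = \<rho>}"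

definition reachable :: "homodyne \<Rightarrow> strategy \<Rightarrow> nat \<Rightarrow> complex mat \<Rightarrow> bool" where
  "reachable m f l \<rho> \<longleftrightarrow> 0 < measure (obs_law m f) (state_event m f l \<rho>)"

definition remaining_cost :: "homodyne \<Rightarrow> strategy \<Rightarrow> nat \<Rightarrow> real list \<Rightarrow> real" where
  "remaining_cost m f l ys =
     (\<Sum>i = l + 1..slots m.
        Re (tr (cond_state m f (i - 1) ys * Qcost m (f i (take (i - 1) ys)))) * dt m) +
     Re (tr (cond_state m f (slots m) ys * Kcost m))"

text \<open>The conditional expectation of the remaining cost given \<open>\<rho>\<^sub>l = \<rho>\<close>. Where the
  conditioning event is null, the version is fixed by the backward recursion of the controlled
  filter; this matters because \<open>W\<close> is also evaluated at states which the strategy itself does not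
  reach.\<close>

function cost_to_go ::
  "homodyne \<Rightarrow> strategy \<Rightarrow> (nat \<Rightarrow> complex mat \<Rightarrow> real) \<Rightarrow> nat \<Rightarrow> complex mat \<Rightarrow> real" where
  "cost_to_go m f g l \<rho> =
     (if reachable m f l \<rho>
      then (LINT ys:state_event m f l \<rho>|obs_law m f. remaining_cost m f l ys)
             / measure (obs_law m f) (state_event m f l \<rho>)
      else if slots m \<le> l then Re (tr (\<rho> * Kcost m))
      else Re (tr (\<rho> * Qcost m (g l \<rho>))) * dt m +
           (\<Sum>y \<in> {lam m, - lam m}. pr m y \<rho> (g l \<rho>) *
              cost_to_go m f g (Suc l) (Gam m \<rho> (g l \<rho>) y)))"
  by pat_completeness auto
termination
  by (relation "Wellfounded.measure (\<lambda>(m, f, g, l, \<rho>). slots m - l)") auto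

declare cost_to_go.simps [simp del]

end

theory Submission
  imports Defs
begin

text \<open>
The interaction at time \<open>l\<close> involves only the system and the \<open>l\<close>-th field factor, which starts in the
  vacuum and is independent of everything that happened before. Projecting on the outcome \<open>y\<close> of
  the observation therefore acts on the system by the Kraus operator
  \<open>(1 + \<lambda>\<^sup>2 M\<^sup>\<circ> + y M\<^sup>+) / \<surd>2\<close>, and by induction on time every expectation in the model becomes a
  sum over outcome sequences of traces of unnormalised conditional states. Normalising them gives the filter \<open>\<Gamma>\<close>
  with transition probabilities \<open>p\<close>, so that the cost-to-go of a separated strategy
  satisfies the backward recursion at every state, reachable or not. If some control \<open>u\<close> were better than
  \<open>g\<^sub>l(\<rho>)\<close> at a reachable state \<open>\<rho>\<close>, then switching to \<open>u\<close> at \<open>(l, \<rho>)\<close> only would lower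
  the total cost by the advantage of \<open>u\<close> times the probability of reaching \<open>\<rho>\<close>.
\<close>

section \<open>Matrices, traces and Kronecker products\<close>

text \<open>The obstacle is that the model consists of concrete matrices of size 2^(k+1) and of
  definite descriptions, for spectral projectors and for the coefficients of \<open>Mop\<close>.
  Both are made explicit: every interaction is a copy of one 4 by 4 unitary, and each
  \<open>DZ\<close> and \<open>DY\<close> squares to \<lambda>^2 times the identity. The Kraus
  operator is the vacuum column of that unitary paired with an eigenvector of the observable; 1 /
  sqrt 2 normalises the eigenvector.

  The initial state absorbs the vacuum projector of any field factor, and the projector on factor l
  commutes with all that happened before time l. Inserting it on both sides separates the newest
  interaction from the past.

  A better control may lead to states that the optimal strategy never visits. There V must still be
  the value of going on with the same feedback maps, so \<open>dp_value\<close> is built from the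
  maps alone and identified with \<open>cost_to_go\<close> at all states. Since \<Gamma> gives
  density matrices even after impossible outcomes, feedback maps stay within their domain. A map
  altered at one state is again a feedback map, so controls can be compared one at a time, without
  any selection argument.\<close>

lemma mat_adjoint_dim [simp]:
  "dim_row (mat_adjoint A) = dim_col A" "dim_col (mat_adjoint A) = dim_row A"
  by (simp_all add: mat_adjoint_def)

lemma mat_adjoint_index [simp]:
  fixes A :: "complex mat"
  assumes "i < dim_col A" "j < dim_row A"
  shows "mat_adjoint A $$ (i, j) = cnj (A $$ (j, i))"
  using assms by (simp add: mat_adjoint_def mat_of_rows_index)

lemma mat_adjoint_carrier [simp]:
  "A \<in> carrier_mat n n' \<Longrightarrow> mat_adjoint A \<in> carrier_mat n' n"
  by (intro carrier_matI) auto

lemma index_mult_sum: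
  fixes A B :: "complex mat"
  assumes "i < dim_row A" "j < dim_col B" "dim_col A = dim_row B"
  shows "(A * B) $$ (i, j) = (\<Sum>k<dim_row B. A $$ (i, k) * B $$ (k, j))"
  using assms by (simp add: scalar_prod_def atLeast0LessThan)

lemma mult_assoc_dim:
  fixes A B C :: "complex mat"
  shows "dim_col A = dim_row B \<Longrightarrow> dim_col B = dim_row C \<Longrightarrow> A * B * C = A * (B * C)"
  by (rule assoc_mult_mat[of A "dim_row A" "dim_row B" B "dim_row C" C "dim_col C"]) auto

lemma mult_add_dim:
  fixes A B C :: "complex mat"
  shows "dim_col A = dim_row B \<Longrightarrow> dim_row B = dim_row C \<Longrightarrow> dim_col B = dim_col C \<Longrightarrow>
    A * (B + C) = A * B + A * C"
  by (rule mult_add_distrib_mat[of A "dim_row A" "dim_row B" B "dim_col B" C]) auto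

lemma add_mult_dim:
  fixes A B C :: "complex mat"
  shows "dim_col A = dim_row C \<Longrightarrow> dim_row B = dim_row A \<Longrightarrow> dim_col B = dim_col A \<Longrightarrow>
    (A + B) * C = A * C + B * C"
  by (rule add_mult_distrib_mat[of A "dim_row A" "dim_row C" B C "dim_col C"]) auto

lemma mult_smult_dim:
  fixes A B :: "complex mat"
  shows "dim_col A = dim_row B \<Longrightarrow> A * (c \<cdot>\<^sub>m B) = c \<cdot>\<^sub>m (A * B)"
  by (rule mult_smult_distrib[of A "dim_row A" "dim_row B" B "dim_col B"]) auto

lemma smult_mult_dim:
  fixes A B :: "complex mat"
  shows "dim_col A = dim_row B \<Longrightarrow> (c \<cdot>\<^sub>m A) * B = c \<cdot>\<^sub>m (A * B)"
  by (rule mult_smult_assoc_mat[of A "dim_row A" "dim_row B" B "dim_col B"]) auto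

lemma one_mult_dim:
  fixes A :: "complex mat"
  shows "dim_row A = n \<Longrightarrow> 1\<^sub>m n * A = A" "dim_col A = n \<Longrightarrow> A * 1\<^sub>m n = A"
  by (auto intro: left_mult_one_mat right_mult_one_mat)

lemma smult_smult_mat: "a \<cdot>\<^sub>m (b \<cdot>\<^sub>m A) = (a * b) \<cdot>\<^sub>m (A :: complex mat)"
  by (rule eq_matI) auto

lemma smult_add_dim:
  fixes A B :: "complex mat"
  shows "dim_row A = dim_row B \<Longrightarrow> dim_col A = dim_col B \<Longrightarrow>
    c \<cdot>\<^sub>m (A + B) = c \<cdot>\<^sub>m A + c \<cdot>\<^sub>m B"
  by (rule eq_matI) (auto simp: algebra_simps)

lemma one_smult_mat [simp]: "1 \<cdot>\<^sub>m A = (A :: complex mat)"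
  by (rule eq_matI) auto

lemma mat_adjoint_mult:
  fixes A B :: "complex mat"
  assumes "dim_col A = dim_row B"
  shows "mat_adjoint (A * B) = mat_adjoint B * mat_adjoint A"
  using assms
  by (intro eq_matI) (auto simp: index_mult_sum mult.commute simp del: index_mult_mat(1))

lemma mat_adjoint_add:
  fixes A B :: "complex mat"
  assumes "dim_row A = dim_row B" "dim_col A = dim_col B"
  shows "mat_adjoint (A + B) = mat_adjoint A + mat_adjoint B"
  using assms by (intro eq_matI) auto

lemma mat_adjoint_smult:
  fixes A :: "complex mat"
  shows "mat_adjoint (c \<cdot>\<^sub>m A) = cnj c \<cdot>\<^sub>m mat_adjoint A"
  by (intro eq_matI) auto

lemma mat_adjoint_adjoint [simp]: "mat_adjoint (mat_adjoint A) = (A :: complex mat)"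
  by (intro eq_matI) auto

lemma mat_adjoint_one [simp]: "mat_adjoint (1\<^sub>m n) = (1\<^sub>m n :: complex mat)"
  by (intro eq_matI) auto

lemma inner_mult_adjoint:
  fixes A :: "complex mat"
  assumes "v \<in> carrier_vec (dim_col A)" "w \<in> carrier_vec (dim_row A)"
  shows "(A *\<^sub>v v) \<bullet>c w = v \<bullet>c (mat_adjoint A *\<^sub>v w)"
proof -
  have "(A *\<^sub>v v) \<bullet>c w = (\<Sum>i<dim_row A. \<Sum>j<dim_col A. A $$ (i, j) * v $ j * cnj (w $ i))"
    using assms by (simp add: scalar_prod_def sum_distrib_right atLeast0LessThan)
  also have "\<dots> = (\<Sum>j<dim_col A. \<Sum>i<dim_row A. A $$ (i, j) * v $ j * cnj (w $ i))"
    by (rule sum.swap)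
  also have "\<dots> = v \<bullet>c (mat_adjoint A *\<^sub>v w)"
    using assms by (simp add: scalar_prod_def sum_distrib_left mult_ac atLeast0LessThan)
  finally show ?thesis .
qed

lemma tr_mult_commute:
  assumes "dim_row A = dim_col B" "dim_col A = dim_row B"
  shows "tr (A * B) = tr (B * A)"
  unfolding tr_def using assms
  by (simp add: index_mult_sum del: index_mult_mat(1)) (subst sum.swap, simp add: mult.commute)

lemma tr_add: "dim_row A = dim_row B \<Longrightarrow> dim_col A = dim_row B \<Longrightarrow> dim_col B = dim_row B \<Longrightarrow>
    tr (A + B) = tr A + tr B"
  unfolding tr_def by (simp add: sum.distrib)

lemma tr_smult: "dim_col A = dim_row A \<Longrightarrow> tr (c \<cdot>\<^sub>m A) = c * tr A"
  unfolding tr_def by (simp add: sum_distrib_left)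

lemma msum_carrier [simp]:
  "msum n F S \<in> carrier_mat n n" "dim_row (msum n F S) = n" "dim_col (msum n F S) = n"
  by (auto simp: msum_def)

lemma msum_index: "i < n \<Longrightarrow> j < n \<Longrightarrow> msum n F S $$ (i, j) = (\<Sum>x\<in>S. F x $$ (i, j))"
  by (simp add: msum_def)

lemma msum_cong:
  "S = T \<Longrightarrow> (\<And>x. x \<in> T \<Longrightarrow> F x = G x) \<Longrightarrow> msum n F S = msum n G T"
  by (simp add: msum_def)

lemma msum_mult_left:
  assumes "A \<in> carrier_mat n n" "\<And>x. x \<in> S \<Longrightarrow> F x \<in> carrier_mat n n"
  shows "A * msum n F S = msum n (\<lambda>x. A * F x) S"
proof (rule eq_matI)
  fix i j assume "i < dim_row (msum n (\<lambda>x. A * F x) S)" "j < dim_col (msum n (\<lambda>x. A * F x) S)"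
  then have ij: "i < n" "j < n" by auto
  have "(A * msum n F S) $$ (i, j) = (\<Sum>k<n. \<Sum>x\<in>S. A $$ (i, k) * F x $$ (k, j))"
    using ij assms(1) by (simp add: index_mult_sum msum_index sum_distrib_left del: index_mult_mat(1))
  also have "\<dots> = (\<Sum>x\<in>S. \<Sum>k<n. A $$ (i, k) * F x $$ (k, j))" by (rule sum.swap)
  also have "\<dots> = msum n (\<lambda>x. A * F x) S $$ (i, j)"
    unfolding msum_index[OF ij]
  proof (rule sum.cong[OF refl])
    fix x assume "x \<in> S"
    then show "(\<Sum>k<n. A $$ (i, k) * F x $$ (k, j)) = (A * F x) $$ (i, j)"
      using assms(1) assms(2)[of x] ij by (auto simp: index_mult_sum simp del: index_mult_mat(1))
  qed
  finally show "(A * msum n F S) $$ (i, j) = msum n (\<lambda>x. A * F x) S $$ (i, j)" .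
qed (use assms in auto)

lemma msum_adjoint:
  assumes "\<And>x. x \<in> S \<Longrightarrow> F x \<in> carrier_mat n n"
  shows "mat_adjoint (msum n F S) = msum n (\<lambda>x. mat_adjoint (F x)) S"
proof (rule eq_matI)
  fix i j assume "i < dim_row (msum n (\<lambda>x. mat_adjoint (F x)) S)"
    "j < dim_col (msum n (\<lambda>x. mat_adjoint (F x)) S)"
  then have ij: "i < n" "j < n" by auto
  have "mat_adjoint (F x) $$ (i, j) = cnj (F x $$ (j, i))" if "x \<in> S" for x
    using assms[OF that] ij by simp
  then show "mat_adjoint (msum n F S) $$ (i, j) = msum n (\<lambda>x. mat_adjoint (F x)) S $$ (i, j)"
    using ij by (simp add: msum_index)
qed auto

text \<open>Adjoints reverse products, so this is \<open>msum_mult_left\<close> for the adjoint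
  matrices.\<close>

lemma msum_mult_right:
  assumes "A \<in> carrier_mat n n" "\<And>x. x \<in> S \<Longrightarrow> F x \<in> carrier_mat n n"
  shows "msum n F S * A = msum n (\<lambda>x. F x * A) S"
proof -
  have dims: "dim_row (F x) = n" "dim_col (F x) = n" if "x \<in> S" for x using assms(2)[OF that] by auto
  have "mat_adjoint (msum n (\<lambda>x. F x * A) S) = msum n (\<lambda>x. mat_adjoint (F x * A)) S"
    by (rule msum_adjoint) (meson assms mult_carrier_mat)
  also have "\<dots> = mat_adjoint (msum n F S * A)"
    using assms dims
    by (auto simp: mat_adjoint_mult msum_adjoint msum_mult_left intro!: msum_cong)
  finally have "mat_adjoint (msum n F S * A) = mat_adjoint (msum n (\<lambda>x. F x * A) S)" ..
  then show ?thesis by (metis mat_adjoint_adjoint)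
qed

lemma msum_mult_vec_index:
  assumes "v \<in> carrier_vec n" "i < n" "\<And>x. x \<in> S \<Longrightarrow> F x \<in> carrier_mat n n"
  shows "(msum n F S *\<^sub>v v) $ i = (\<Sum>x\<in>S. (F x *\<^sub>v v) $ i)"
proof -
  have "(F x *\<^sub>v v) $ i = (\<Sum>j<n. F x $$ (i, j) * v $ j)" if "x \<in> S" for x
    using assms(1,2) assms(3)[OF that] by (auto simp: scalar_prod_def atLeast0LessThan)
  then have "(\<Sum>x\<in>S. (F x *\<^sub>v v) $ i) = (\<Sum>x\<in>S. \<Sum>j<n. F x $$ (i, j) * v $ j)" by simp
  also have "\<dots> = (\<Sum>j<n. \<Sum>x\<in>S. F x $$ (i, j) * v $ j)" by (rule sum.swap)
  finally show ?thesis
    using assms(1,2) by (simp add: scalar_prod_def atLeast0LessThan msum_index sum_distrib_right)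
qed

lemma tr_msum:
  assumes "\<And>x. x \<in> S \<Longrightarrow> F x \<in> carrier_mat n n"
  shows "tr (msum n F S) = (\<Sum>x\<in>S. tr (F x))"
proof -
  have "tr (msum n F S) = (\<Sum>i<n. \<Sum>x\<in>S. F x $$ (i, i))" by (simp add: tr_def msum_index)
  also have "\<dots> = (\<Sum>x\<in>S. \<Sum>i<n. F x $$ (i, i))" by (rule sum.swap)
  also have "\<dots> = (\<Sum>x\<in>S. tr (F x))"
    unfolding tr_def by (intro sum.cong refl) (use assms in auto)
  finally show ?thesis .
qed

section \<open>Kronecker products\<close>

lemma sum_div_mod:
  fixes F :: "nat \<Rightarrow> nat \<Rightarrow> complex"
  assumes "0 < n"
  shows "(\<Sum>k<m * n. F (k div n) (k mod n)) = (\<Sum>a<m. \<Sum>b<n. F a b)"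
proof -
  have "(\<Sum>a<m. \<Sum>b<n. F a b) = (\<Sum>(a, b)\<in>{..<m} \<times> {..<n}. F a b)"
    by (rule sum.cartesian_product)
  also have "\<dots> = (\<Sum>k<m * n. F (k div n) (k mod n))"
  proof (rule sum.reindex_bij_witness[of _ "\<lambda>k. (k div n, k mod n)" "\<lambda>(a, b). a * n + b"])
    fix ab assume "ab \<in> {..<m} \<times> {..<n}"
    then obtain a b where ab: "ab = (a, b)" "a < m" "b < n" by auto
    have "a * n + b < Suc a * n" using ab by simp
    also have "\<dots> \<le> m * n" using ab(2) by (intro mult_le_mono1) simp
    finally show "(case ab of (a, b) \<Rightarrow> a * n + b) \<in> {..<m * n}" using ab by simp
  qed (use assms in \<open>auto simp: less_mult_imp_div_less\<close>)
  finally show ?thesis by simp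
qed

lemma kron_dim [simp]:
  "dim_row (kron A B) = dim_row A * dim_row B" "dim_col (kron A B) = dim_col A * dim_col B"
  by (simp_all add: kron_def)

lemma kron_index:
  "i < dim_row A * dim_row B \<Longrightarrow> j < dim_col A * dim_col B \<Longrightarrow> kron A B $$ (i, j) =
    A $$ (i div dim_row B, j div dim_col B) * B $$ (i mod dim_row B, j mod dim_col B)"
  by (simp add: kron_def)

lemma less_mult_imp_pos: "i < a * b \<Longrightarrow> 0 < (b::nat)" by (cases b) auto

lemma kron_mult:
  assumes "dim_col A = dim_row C" "dim_col B = dim_row D"
  shows "kron A B * kron C D = kron (A * C) (B * D)"
proof (rule eq_matI)
  fix i j
  assume "i < dim_row (kron (A * C) (B * D))" "j < dim_col (kron (A * C) (B * D))"
  then have i: "i < dim_row A * dim_row B" and j: "j < dim_col C * dim_col D" by auto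
  have pos: "0 < dim_row B" "0 < dim_col D" using i j by (auto dest: less_mult_imp_pos)
  have dm: "i div dim_row B < dim_row A" "i mod dim_row B < dim_row B"
    "j div dim_col D < dim_col C" "j mod dim_col D < dim_col D"
    using i j pos by (auto simp: less_mult_imp_div_less)
  \<comment> \<open>\<open>sum_div_mod\<close> needs a positive block size; if
    \<open>dim_row D = 0\<close>, the inner sums are empty and both sides vanish.\<close>
  show "(kron A B * kron C D) $$ (i, j) = kron (A * C) (B * D) $$ (i, j)"
  proof (cases "dim_row D = 0")
    case True
    then show ?thesis
      using i j pos assms dm by (simp add: index_mult_sum kron_index del: index_mult_mat(1))
  next
    case False
    let ?F = "\<lambda>a b. A $$ (i div dim_row B, a) * B $$ (i mod dim_row B, b) *
       (C $$ (a, j div dim_col D) * D $$ (b, j mod dim_col D))"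
    have "(kron A B * kron C D) $$ (i, j) =
        (\<Sum>k<dim_row C * dim_row D. ?F (k div dim_row D) (k mod dim_row D))"
      using i j assms by (simp add: index_mult_sum kron_index del: index_mult_mat(1))
    also have "\<dots> = (\<Sum>a<dim_row C. \<Sum>b<dim_row D. ?F a b)"
      using False by (intro sum_div_mod) simp
    also have "\<dots> = (\<Sum>a<dim_row C. A $$ (i div dim_row B, a) * C $$ (a, j div dim_col D)) *
        (\<Sum>b<dim_row D. B $$ (i mod dim_row B, b) * D $$ (b, j mod dim_col D))"
      unfolding sum_product by (intro sum.cong refl) (simp only: mult_ac)
    also have "\<dots> = kron (A * C) (B * D) $$ (i, j)"
      using i j assms dm by (simp add: index_mult_sum kron_index del: index_mult_mat(1))
    finally show ?thesis .
  qed
qed (use assms in auto)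

text \<open>Both bracketings read off the same three mixed-radix digits of an index; the proof
  matches them by the arithmetic of iterated \<open>div\<close> and \<open>mod\<close>.\<close>

lemma kron_assoc: "kron (kron A B) C = kron A (kron B C)"
proof (rule eq_matI)
  fix i j assume "i < dim_row (kron A (kron B C))" "j < dim_col (kron A (kron B C))"
  then have ij: "i < dim_row A * dim_row B * dim_row C" "j < dim_col A * dim_col B * dim_col C"
    by (auto simp: mult_ac)
  then have pos: "0 < dim_row C" "0 < dim_col C" "0 < dim_row B" "0 < dim_col B"
    by (auto dest: less_mult_imp_pos intro!: Nat.gr0I)
  have "i div dim_row C < dim_row A * dim_row B" "j div dim_col C < dim_col A * dim_col B"
    using ij by (auto simp: less_mult_imp_div_less)
  moreover have "i mod (dim_row B * dim_row C) < dim_row B * dim_row C"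
    "j mod (dim_col B * dim_col C) < dim_col B * dim_col C"
    using pos by simp_all
  moreover have "i mod (dim_row B * dim_row C) div dim_row C = i div dim_row C mod dim_row B"
    "j mod (dim_col B * dim_col C) div dim_col C = j div dim_col C mod dim_col B"
    using pos by (simp_all add: mod_mult2_eq mult.commute[of _ "dim_row C"] mult.commute[of _ "dim_col C"])
  moreover have "i mod (dim_row B * dim_row C) mod dim_row C = i mod dim_row C"
    "j mod (dim_col B * dim_col C) mod dim_col C = j mod dim_col C"
    by (simp_all add: mod_mod_cancel)
  moreover have "i div (dim_row B * dim_row C) = i div dim_row C div dim_row B"
    "j div (dim_col B * dim_col C) = j div dim_col C div dim_col B"
    by (metis div_mult2_eq mult.commute)+
  ultimately show "kron (kron A B) C $$ (i, j) = kron A (kron B C) $$ (i, j)"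
    using ij by (simp add: kron_index mult.assoc)
qed (simp_all add: mult.assoc)

lemma kron_one_left [simp]: "kron (1\<^sub>m 1) A = A"
  by (rule eq_matI) (auto simp: kron_index)

lemma kron_one_one: "kron (1\<^sub>m a) (1\<^sub>m b) = 1\<^sub>m (a * b)"
proof (rule eq_matI)
  fix i j assume "i < dim_row (1\<^sub>m (a * b) :: complex mat)" "j < dim_col (1\<^sub>m (a * b) :: complex mat)"
  then have ij: "i < a * b" "j < a * b" by auto
  then have "0 < b" by (auto dest: less_mult_imp_pos)
  moreover have "i = j \<longleftrightarrow> i div b = j div b \<and> i mod b = j mod b" by (metis div_mult_mod_eq)
  ultimately show "kron (1\<^sub>m a) (1\<^sub>m b) $$ (i, j) = 1\<^sub>m (a * b) $$ (i, j)"
    using ij by (auto simp: kron_index less_mult_imp_div_less)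
qed auto

text \<open>Provides the digit bounds under which entries of a Kronecker product simplify, so that
  bilinearity and adjoints can be checked entrywise.\<close>

lemma kron_eqI:
  assumes "dim_row X = a * b" "dim_col X = c * d"
    and "\<And>i j. i < a * b \<Longrightarrow> j < c * d \<Longrightarrow> i div b < a \<Longrightarrow> j div d < c \<Longrightarrow> i mod b < b \<Longrightarrow> j mod d < d \<Longrightarrow>
      kron A B $$ (i, j) = X $$ (i, j)"
    and "dim_row A = a" "dim_col A = c" "dim_row B = b" "dim_col B = d"
  shows "kron A B = X"
proof (rule eq_matI)
  fix i j assume "i < dim_row X" "j < dim_col X"
  then have "i < a * b" "j < c * d" using assms(1,2) by simp_all
  then show "kron A B $$ (i, j) = X $$ (i, j)"
    using less_mult_imp_pos[of i a b] less_mult_imp_pos[of j c d]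
    by (intro assms(3)) (auto intro: less_mult_imp_div_less)
qed (use assms in auto)

lemma kron_adjoint: "mat_adjoint (kron A B) = kron (mat_adjoint A) (mat_adjoint B)"
  by (rule sym, rule kron_eqI) (auto simp: kron_index)

lemma kron_add_left:
  "dim_row A = dim_row A' \<Longrightarrow> dim_col A = dim_col A' \<Longrightarrow> kron (A + A') B = kron A B + kron A' B"
  by (rule kron_eqI) (auto simp: kron_index algebra_simps)

lemma kron_add_right:
  "dim_row B = dim_row B' \<Longrightarrow> dim_col B = dim_col B' \<Longrightarrow> kron A (B + B') = kron A B + kron A B'"
  by (rule kron_eqI) (auto simp: kron_index algebra_simps)

lemma kron_smult: "kron (c \<cdot>\<^sub>m A) B = c \<cdot>\<^sub>m kron A B" "kron A (c \<cdot>\<^sub>m B) = c \<cdot>\<^sub>m kron A B"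
  by (rule kron_eqI; auto simp: kron_index)+

lemma tr_kron:
  assumes "dim_col A = dim_row A" "dim_col B = dim_row B"
  shows "tr (kron A B) = tr A * tr B"
proof (cases "dim_row B = 0")
  case False
  have "tr (kron A B) = (\<Sum>k<dim_row A * dim_row B.
      (\<lambda>a b. A $$ (a, a) * B $$ (b, b)) (k div dim_row B) (k mod dim_row B))"
    using assms by (simp add: tr_def kron_index)
  also have "\<dots> = (\<Sum>a<dim_row A. \<Sum>b<dim_row B. A $$ (a, a) * B $$ (b, b))"
    using False by (intro sum_div_mod) simp
  finally show ?thesis by (simp add: tr_def sum_product)
qed (simp add: tr_def)

lemma kron_pow_dim [simp]:
  "dim_row (kron_pow X n) = dim_row X ^ n" "dim_col (kron_pow X n) = dim_col X ^ n"
  by (induction n) auto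

lemma kron_pow_add: "kron_pow X (a + b) = kron (kron_pow X a) (kron_pow X b)"
  by (induction a) (auto simp: kron_assoc simp flip: One_nat_def)

lemma tr_kron_pow: "dim_col X = dim_row X \<Longrightarrow> tr (kron_pow X n) = tr X ^ n"
proof (induction n)
  case (Suc n)
  then show ?case by (simp add: tr_kron)
qed (simp add: tr_def)

section \<open>Spectral projectors and the matrix exponential\<close>

lemma mat_eq_by_vec:
  fixes A B :: "complex mat"
  assumes "A \<in> carrier_mat n n" "B \<in> carrier_mat n n"
    and eq: "\<And>v. v \<in> carrier_vec n \<Longrightarrow> A *\<^sub>v v = B *\<^sub>v v"
  shows "A = B"
proof (rule eq_matI)
  fix i j assume "i < dim_row B" "j < dim_col B"
  then have ij: "i < n" "j < n" using assms by auto
  have "(A *\<^sub>v unit_vec n j) $ i = (B *\<^sub>v unit_vec n j) $ i" by (simp add: eq)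
  then show "A $$ (i, j) = B $$ (i, j)"
    using ij assms(1,2) by (auto simp: scalar_prod_right_unit)
qed (use assms in auto)

lemma mult_vec_assoc:
  fixes A B :: "complex mat"
  shows "A \<in> carrier_mat n n \<Longrightarrow> B \<in> carrier_mat n n \<Longrightarrow> v \<in> carrier_vec n \<Longrightarrow>
    A * B *\<^sub>v v = A *\<^sub>v (B *\<^sub>v v)"
  by (rule assoc_mult_mat_vec)

lemma smult_mult_vec: "(c \<cdot>\<^sub>m A) *\<^sub>v v = c \<cdot>\<^sub>v (A *\<^sub>v (v :: complex Matrix.vec))"
  if "dim_vec v = dim_col A"
  using that by (intro eq_vecI) (auto simp: scalar_prod_def sum_distrib_left mult.assoc)

lemma msum_delta:
  assumes "finite S" "A \<in> carrier_mat n n"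
  shows "msum n (\<lambda>y. if y = x then A else 0\<^sub>m n n) S = (if x \<in> S then A else 0\<^sub>m n n)"
proof (rule eq_matI)
  fix i j assume "i < dim_row (if x \<in> S then A else 0\<^sub>m n n)" "j < dim_col (if x \<in> S then A else 0\<^sub>m n n)"
  then have ij: "i < n" "j < n" using assms(2) by (auto split: if_splits)
  have "(\<Sum>y\<in>S. (if y = x then A else 0\<^sub>m n n) $$ (i, j)) = (\<Sum>y\<in>S. if y = x then A $$ (i, j) else 0)"
    using ij by (intro sum.cong) auto
  then show "msum n (\<lambda>y. if y = x then A else 0\<^sub>m n n) S $$ (i, j) = (if x \<in> S then A else 0\<^sub>m n n) $$ (i, j)"
    using ij assms(1) by (simp add: msum_index)
qed (use assms in auto)

text \<open>\<open>eigenproj\<close> is a definite description, so uniqueness has to be proved as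
  well. Two orthogonal projectors with the same fixed vectors satisfy \<open>E * F = F\<close> and
  \<open>F * E = E\<close>, and the adjoint of the first identity reads
  \<open>F = F * E\<close>.\<close>

lemma eigenproj_eqI:
  assumes E: "E \<in> carrier_mat n n" "E * E = E" "selfadjoint E" and A: "A \<in> carrier_mat n n"
    and fixp: "\<And>v. v \<in> carrier_vec n \<Longrightarrow> E *\<^sub>v v = v \<longleftrightarrow> A *\<^sub>v v = complex_of_real a \<cdot>\<^sub>v v"
  shows "eigenproj A a = E"
  unfolding eigenproj_def
proof (rule the_equality)
  show "E \<in> carrier_mat (dim_row A) (dim_row A) \<and> E * E = E \<and> selfadjoint E \<and>
     (\<forall>v \<in> carrier_vec (dim_row A). E *\<^sub>v v = v \<longleftrightarrow> A *\<^sub>v v = complex_of_real a \<cdot>\<^sub>v v)"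
    using assms by auto
next
  fix F assume "F \<in> carrier_mat (dim_row A) (dim_row A) \<and> F * F = F \<and> selfadjoint F \<and>
     (\<forall>v \<in> carrier_vec (dim_row A). F *\<^sub>v v = v \<longleftrightarrow> A *\<^sub>v v = complex_of_real a \<cdot>\<^sub>v v)"
  then have F: "F \<in> carrier_mat n n" "F * F = F" "selfadjoint F"
    and Ff: "\<And>v. v \<in> carrier_vec n \<Longrightarrow> F *\<^sub>v v = v \<longleftrightarrow> A *\<^sub>v v = complex_of_real a \<cdot>\<^sub>v v"
    using A by auto
  \<comment> \<open>The idempotent \<open>H\<close> maps every vector to one of its own fixed
    vectors, and \<open>G\<close> fixes these.\<close>
  have fix_eq: "G * H = H" if "G \<in> carrier_mat n n" "H \<in> carrier_mat n n" "H * H = H"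
    "\<And>v. v \<in> carrier_vec n \<Longrightarrow> H *\<^sub>v v = v \<Longrightarrow> G *\<^sub>v v = v" for G H :: "complex mat"
  proof (rule mat_eq_by_vec)
    fix v :: "complex Matrix.vec" assume v: "v \<in> carrier_vec n"
    then have Hv: "H *\<^sub>v v \<in> carrier_vec n" using that(2) by auto
    have "H *\<^sub>v (H *\<^sub>v v) = H *\<^sub>v v" using mult_vec_assoc[OF that(2) that(2) v] that(3) by simp
    then have "G *\<^sub>v (H *\<^sub>v v) = H *\<^sub>v v" using that(4) Hv by blast
    then show "G * H *\<^sub>v v = H *\<^sub>v v" using that v by (simp add: mult_vec_assoc)
  qed (use that in auto)
  have EF: "E * F = F" by (rule fix_eq[OF E(1) F(1,2)]) (use Ff fixp in blast)
  have FE: "F * E = E" by (rule fix_eq[OF F(1) E(1,2)]) (use Ff fixp in blast)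
  have "F = mat_adjoint (E * F)" using EF F(3) by (simp add: selfadjoint_def)
  also have "\<dots> = F * E" using E F by (subst mat_adjoint_mult) (auto simp: selfadjoint_def)
  finally show "F = E" using FE by simp
qed

text \<open>Divided by \<open>y\<close>, the matrix \<open>Z\<close> is a self-adjoint involution,
  and half the sum of the identity and an involution projects onto its fixed vectors. Only
  \<open>y\<^sup>2\<close> occurs in the hypothesis on \<open>Z\<close>, so both signs of an outcome
  are covered.\<close>

lemma eigenproj_reflection:
  assumes Z: "Z \<in> carrier_mat n n" "selfadjoint Z" "Z * Z = complex_of_real (y\<^sup>2) \<cdot>\<^sub>m 1\<^sub>m n" and y: "y \<noteq> 0"
  shows "eigenproj Z y = complex_of_real (1 / 2) \<cdot>\<^sub>m (1\<^sub>m n + complex_of_real (1 / y) \<cdot>\<^sub>m Z)" (is "_ = ?E")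
proof (rule eigenproj_eqI)
  have dims: "dim_row Z = n" "dim_col Z = n" using Z by auto
  show "?E \<in> carrier_mat n n" using Z by auto
  show "selfadjoint ?E" using Z(2) dims
    by (simp add: selfadjoint_def mat_adjoint_smult mat_adjoint_add)
  have "?E * ?E = complex_of_real (1 / 4) \<cdot>\<^sub>m (1\<^sub>m n + complex_of_real (1 / y) \<cdot>\<^sub>m Z +
      (complex_of_real (1 / y) \<cdot>\<^sub>m Z + complex_of_real (1 / y\<^sup>2) \<cdot>\<^sub>m (Z * Z)))"
    using dims
    by (simp add: mult_smult_dim smult_mult_dim mult_add_dim add_mult_dim one_mult_dim
        smult_smult_mat smult_add_dim power2_eq_square)
  also have "\<dots> = ?E"
    unfolding Z(3) using y dims
    by (intro eq_matI) (auto simp: field_simps)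
  finally show "?E * ?E = ?E" .
  fix v :: "complex Matrix.vec" assume v: "v \<in> carrier_vec n"
  have Ev: "?E *\<^sub>v v = complex_of_real (1 / 2) \<cdot>\<^sub>v (v + complex_of_real (1 / y) \<cdot>\<^sub>v (Z *\<^sub>v v))"
    using v Z(1)
    by (simp add: smult_mult_vec add_mult_distrib_mat_vec[of _ n n])
  have "?E *\<^sub>v v = v \<longleftrightarrow> (\<forall>i<n. (v $ i + (Z *\<^sub>v v) $ i / complex_of_real y) / 2 = v $ i)"
    unfolding Ev using v dims by (auto simp: vec_eq_iff)
  also have "\<dots> \<longleftrightarrow> (\<forall>i<n. (Z *\<^sub>v v) $ i = complex_of_real y * v $ i)"
    using y by (intro all_cong) (auto simp: field_simps)
  also have "\<dots> \<longleftrightarrow> Z *\<^sub>v v = complex_of_real y \<cdot>\<^sub>v v"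
    using v dims by (auto simp: vec_eq_iff)
  finally show "?E *\<^sub>v v = v \<longleftrightarrow> Z *\<^sub>v v = complex_of_real y \<cdot>\<^sub>v v" .
qed (use Z in auto)

text \<open>The map \<open>h\<close> is not assumed injective, since different observation paths may
  lead to the same control. An eigenprojector is therefore a sum over a level set of
  \<open>h\<close>, and the empty sum when \<open>u\<close> is not a value.\<close>

lemma eigenproj_resolution:
  fixes P :: "'a \<Rightarrow> complex mat" and h :: "'a \<Rightarrow> real"
  assumes S: "finite S" and P: "\<And>x. x \<in> S \<Longrightarrow> P x \<in> carrier_mat n n"
    and sa: "\<And>x. x \<in> S \<Longrightarrow> selfadjoint (P x)"
    and orth: "\<And>x y. x \<in> S \<Longrightarrow> y \<in> S \<Longrightarrow> P x * P y = (if x = y then P x else 0\<^sub>m n n)"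
    and one: "msum n P S = 1\<^sub>m n"
  defines "C \<equiv> msum n (\<lambda>x. complex_of_real (h x) \<cdot>\<^sub>m P x) S"
  shows "eigenproj C u = msum n P {x \<in> S. h x = u}"
    and "msum n P {x \<in> S. h x = u} * msum n P {x \<in> S. h x = u} = msum n P {x \<in> S. h x = u}"
    and "v \<in> carrier_vec n \<Longrightarrow>
      msum n P {x \<in> S. h x = u} *\<^sub>v v = v \<longleftrightarrow> C *\<^sub>v v = complex_of_real u \<cdot>\<^sub>v v"
proof -
  let ?E = "msum n P {x \<in> S. h x = u}"
  have PE: "P x * ?E = (if h x = u then P x else 0\<^sub>m n n)" if "x \<in> S" for x
  proof -
    have "P x * ?E = msum n (\<lambda>y. P x * P y) {x \<in> S. h x = u}"
      using P that by (intro msum_mult_left) auto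
    also have "\<dots> = msum n (\<lambda>y. if y = x then P x else 0\<^sub>m n n) {x \<in> S. h x = u}"
      using orth that by (intro msum_cong) auto
    also have "\<dots> = (if h x = u then P x else 0\<^sub>m n n)"
      using that S P[OF that] by (simp add: msum_delta)
    finally show ?thesis .
  qed
  have EE: "?E * ?E = msum n (\<lambda>x. P x * ?E) {x \<in> S. h x = u}"
    using P by (intro msum_mult_right) auto
  show idem: "?E * ?E = ?E" unfolding EE by (rule msum_cong) (auto simp: PE)
  have sE: "selfadjoint ?E" unfolding selfadjoint_def
    using P sa by (subst msum_adjoint) (auto simp: selfadjoint_def intro!: msum_cong)
  have PC: "P x * C = complex_of_real (h x) \<cdot>\<^sub>m P x" if "x \<in> S" for x
  proof -
    have "P x * C = msum n (\<lambda>y. P x * (complex_of_real (h y) \<cdot>\<^sub>m P y)) S"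
      unfolding C_def using P that by (intro msum_mult_left) auto
    also have "\<dots> = msum n (\<lambda>y. if y = x then complex_of_real (h x) \<cdot>\<^sub>m P x else 0\<^sub>m n n) S"
    proof (rule msum_cong[OF refl])
      fix y assume y: "y \<in> S"
      have "P x * (complex_of_real (h y) \<cdot>\<^sub>m P y) = complex_of_real (h y) \<cdot>\<^sub>m (P x * P y)"
        using P[OF y] P[OF that] by (intro mult_smult_dim) auto
      also have "\<dots> = (if y = x then complex_of_real (h x) \<cdot>\<^sub>m P x else 0\<^sub>m n n)"
        using orth[OF that y] by auto
      finally show "P x * (complex_of_real (h y) \<cdot>\<^sub>m P y) = (if y = x then complex_of_real (h x) \<cdot>\<^sub>m P x else 0\<^sub>m n n)" .
    qed
    also have "\<dots> = complex_of_real (h x) \<cdot>\<^sub>m P x"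
      using that S P[OF that] by (simp add: msum_delta)
    finally show ?thesis .
  qed
  have C: "C \<in> carrier_mat n n" by (simp add: C_def)
  show fixp: "?E *\<^sub>v v = v \<longleftrightarrow> C *\<^sub>v v = complex_of_real u \<cdot>\<^sub>v v" if v: "v \<in> carrier_vec n" for v
  proof -
    have Pv: "P x *\<^sub>v v \<in> carrier_vec n" if "x \<in> S" for x
      using P[OF that] by (intro carrier_vecI) auto
    show ?thesis
    proof
      assume Ev: "?E *\<^sub>v v = v"
      \<comment> \<open>Off the level set \<open>P x\<close> annihilates the range of
        \<open>?E\<close>, so a fixed vector only has components on which \<open>C\<close> acts as
        the scalar \<open>u\<close>.\<close>
      have "P x *\<^sub>v v = 0\<^sub>v n" if "x \<in> S" "h x \<noteq> u" for x
      proof -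
        have "P x *\<^sub>v v = P x * ?E *\<^sub>v v" using Ev P[OF that(1)] v by (simp add: mult_vec_assoc)
        then show ?thesis using PE[OF that(1)] that v by auto
      qed
      then have "(complex_of_real (h x) \<cdot>\<^sub>m P x *\<^sub>v v) $ i = complex_of_real u * (P x *\<^sub>v v) $ i"
        if "x \<in> S" "i < n" for x i
        using that P[OF that(1)] v by (cases "h x = u") (auto simp: smult_mult_vec)
      note scaled = this
      have "(C *\<^sub>v v) $ i = (complex_of_real u \<cdot>\<^sub>v (msum n P S *\<^sub>v v)) $ i" if i: "i < n" for i
      proof -
        have "(C *\<^sub>v v) $ i = (\<Sum>x\<in>S. (complex_of_real (h x) \<cdot>\<^sub>m P x *\<^sub>v v) $ i)"
          unfolding C_def using i v P by (intro msum_mult_vec_index) auto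
        also have "\<dots> = complex_of_real u * (\<Sum>x\<in>S. (P x *\<^sub>v v) $ i)"
          unfolding sum_distrib_left using scaled i by (intro sum.cong) auto
        also have "(\<Sum>x\<in>S. (P x *\<^sub>v v) $ i) = (msum n P S *\<^sub>v v) $ i"
          using i v P by (intro msum_mult_vec_index[symmetric]) auto
        finally show ?thesis using i by simp
      qed
      then show "C *\<^sub>v v = complex_of_real u \<cdot>\<^sub>v v" using v C by (intro eq_vecI) (auto simp: one)
    next
      assume Cv: "C *\<^sub>v v = complex_of_real u \<cdot>\<^sub>v v"
      \<comment> \<open>Applying \<open>P x\<close> to the eigenvalue equation yields the factor
        \<open>h x\<close> on one side and \<open>u\<close> on the other.\<close>
      have zero: "P x *\<^sub>v v = 0\<^sub>v n" if x: "x \<in> S" "h x \<noteq> u" for x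
      proof -
        have "complex_of_real (h x) \<cdot>\<^sub>v (P x *\<^sub>v v) = P x * C *\<^sub>v v"
          using PC[OF x(1)] P[OF x(1)] v by (simp add: smult_mult_vec)
        also have "\<dots> = complex_of_real u \<cdot>\<^sub>v (P x *\<^sub>v v)"
          using P[OF x(1)] C v Cv by (simp add: mult_vec_assoc mult_mat_vec[of _ n n])
        finally have scal: "(complex_of_real (h x) \<cdot>\<^sub>v (P x *\<^sub>v v)) $ i = (complex_of_real u \<cdot>\<^sub>v (P x *\<^sub>v v)) $ i" for i
          by simp
        then have "complex_of_real (h x) * (P x *\<^sub>v v) $ i = complex_of_real u * (P x *\<^sub>v v) $ i" if "i < n" for i
          using scal[of i] that Pv[OF x(1)] by (metis index_smult_vec(1) carrier_vecD)
        note scaled = this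
        have "(P x *\<^sub>v v) $ i = 0" if "i < n" for i
          using scaled[OF that] x(2) by auto
        then show ?thesis using P[OF x(1)] by (intro eq_vecI) (auto simp del: index_mult_mat_vec)
      qed
      show "?E *\<^sub>v v = v"
      proof (rule eq_vecI)
        fix i assume "i < dim_vec v"
        then have i: "i < n" using v by auto
        have "(?E *\<^sub>v v) $ i = (\<Sum>x | x \<in> S \<and> h x = u. (P x *\<^sub>v v) $ i)"
          using v i P by (intro msum_mult_vec_index) auto
        also have "\<dots> = (\<Sum>x\<in>S. (P x *\<^sub>v v) $ i)"
          using S zero i by (intro sum.mono_neutral_left) auto
        also have "\<dots> = (msum n P S *\<^sub>v v) $ i"
          using v i P by (intro msum_mult_vec_index[symmetric]) auto
        finally show "(?E *\<^sub>v v) $ i = v $ i" using v by (simp add: one)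
      qed (use v in auto)
    qed
  qed
  show "eigenproj C u = ?E"
    by (rule eigenproj_eqI[OF _ idem sE C fixp]) simp_all
qed

text \<open>\<open>at_operator\<close> sums over the spectrum, whereas later computations need a sum
  over the whole index set of the resolution. The two are linked through the values of
  \<open>h\<close>, each value being split into its level set at the end.\<close>

lemma at_operator_resolution:
  fixes P :: "'a \<Rightarrow> complex mat" and h :: "'a \<Rightarrow> real"
  assumes S: "finite S" and P: "\<And>x. x \<in> S \<Longrightarrow> P x \<in> carrier_mat n n"
    and sa: "\<And>x. x \<in> S \<Longrightarrow> selfadjoint (P x)"
    and orth: "\<And>x y. x \<in> S \<Longrightarrow> y \<in> S \<Longrightarrow> P x * P y = (if x = y then P x else 0\<^sub>m n n)"
    and one: "msum n P S = 1\<^sub>m n"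
    and F: "\<And>x. x \<in> S \<Longrightarrow> F (h x) \<in> carrier_mat n n"
  shows "at_operator F (msum n (\<lambda>x. complex_of_real (h x) \<cdot>\<^sub>m P x) S) = msum n (\<lambda>x. F (h x) * P x) S"
proof -
  define C where "C = msum n (\<lambda>x. complex_of_real (h x) \<cdot>\<^sub>m P x) S"
  define E where "E u = msum n P {x \<in> S. h x = u}" for u
  have C: "C \<in> carrier_mat n n" "dim_row C = n" by (auto simp: C_def)
  have ep: "eigenproj C u = E u" for u
    unfolding C_def E_def by (rule eigenproj_resolution[OF S P sa orth one])
  have EE: "E u * E u = E u" and fixp: "v \<in> carrier_vec n \<Longrightarrow> C *\<^sub>v v = complex_of_real u \<cdot>\<^sub>v v \<longleftrightarrow> E u *\<^sub>v v = v" for u v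
    unfolding C_def E_def
    by (rule eigenproj_resolution[OF S P sa orth one]; assumption)
      (rule eigenproj_resolution(3)[OF S P sa orth one, symmetric]; assumption)
  have sub: "{u. eigenvalue C (complex_of_real u)} \<subseteq> h ` S"
  proof
    fix u assume "u \<in> {u. eigenvalue C (complex_of_real u)}"
    then obtain v where v: "v \<in> carrier_vec n" "v \<noteq> 0\<^sub>v n" "C *\<^sub>v v = complex_of_real u \<cdot>\<^sub>v v"
      using C by (auto simp: eigenvalue_def eigenvector_def)
    have "E u *\<^sub>v v = v" using fixp v by blast
    moreover have "E u *\<^sub>v v = 0\<^sub>v n" if "{x \<in> S. h x = u} = {}"
      unfolding E_def that using v msum_mult_vec_index[of v n _ "{}" P]
      by (intro eq_vecI) (auto simp del: index_mult_mat_vec)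
    ultimately show "u \<in> h ` S" using v(2) by auto
  qed
  \<comment> \<open>A value of \<open>h\<close> can lie outside the spectrum when its projectors are
    zero; its term then vanishes.\<close>
  have nonev: "E u = 0\<^sub>m n n" if "\<not> eigenvalue C (complex_of_real u)" for u
  proof (rule mat_eq_by_vec[of _ n])
    fix v :: "complex Matrix.vec" assume v: "v \<in> carrier_vec n"
    have Ev: "E u *\<^sub>v v \<in> carrier_vec n" by (simp add: E_def carrier_vecI)
    have "E u *\<^sub>v (E u *\<^sub>v v) = E u *\<^sub>v v"
      using v mult_vec_assoc[of "E u" n "E u" v] EE by (simp add: E_def)
    then have "C *\<^sub>v (E u *\<^sub>v v) = complex_of_real u \<cdot>\<^sub>v (E u *\<^sub>v v)"
      using fixp Ev by blast
    then have "E u *\<^sub>v v = 0\<^sub>v n"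
      using that Ev C by (auto simp: eigenvalue_def eigenvector_def)
    then show "E u *\<^sub>v v = 0\<^sub>m n n *\<^sub>v v" using v by auto
  qed (auto simp: E_def)
  have "at_operator F C = msum n (\<lambda>u. F u * E u) {u. eigenvalue C (complex_of_real u)}"
    by (simp add: at_operator_def C ep)
  also have "\<dots> = msum n (\<lambda>u. F u * E u) (h ` S)"
  proof (rule eq_matI)
    fix i j assume "i < dim_row (msum n (\<lambda>u. F u * E u) (h ` S))" "j < dim_col (msum n (\<lambda>u. F u * E u) (h ` S))"
    then have ij: "i < n" "j < n" by auto
    have "(F u * E u) $$ (i, j) = 0" if "u \<in> h ` S" "\<not> eigenvalue C (complex_of_real u)" for u
      using nonev[OF that(2)] F that(1) ij by (auto simp: right_mult_zero_mat[of _ n n])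
    then show "msum n (\<lambda>u. F u * E u) {u. eigenvalue C (complex_of_real u)} $$ (i, j) =
        msum n (\<lambda>u. F u * E u) (h ` S) $$ (i, j)"
      unfolding msum_index[OF ij] using sub S by (intro sum.mono_neutral_left) auto
  qed auto
  also have "\<dots> = msum n (\<lambda>u. msum n (\<lambda>x. F (h x) * P x) {x \<in> S. h x = u}) (h ` S)"
  proof (rule msum_cong[OF refl])
    fix u assume "u \<in> h ` S"
    then have "F u \<in> carrier_mat n n" using F by auto
    then have "F u * E u = msum n (\<lambda>x. F u * P x) {x \<in> S. h x = u}"
      unfolding E_def using P by (intro msum_mult_left) auto
    also have "\<dots> = msum n (\<lambda>x. F (h x) * P x) {x \<in> S. h x = u}" by (rule msum_cong) auto
    finally show "F u * E u = msum n (\<lambda>x. F (h x) * P x) {x \<in> S. h x = u}" .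
  qed
  also have "\<dots> = msum n (\<lambda>x. F (h x) * P x) S"
  proof (rule eq_matI)
    fix i j assume "i < dim_row (msum n (\<lambda>x. F (h x) * P x) S)" "j < dim_col (msum n (\<lambda>x. F (h x) * P x) S)"
    then show "msum n (\<lambda>u. msum n (\<lambda>x. F (h x) * P x) {x \<in> S. h x = u}) (h ` S) $$ (i, j) =
        msum n (\<lambda>x. F (h x) * P x) S $$ (i, j)"
      using sum.group[OF S finite_imageI[OF S] order_refl, where h = "\<lambda>x. (F (h x) * P x) $$ (i, j)" and g = h]
      by (simp add: msum_index)
  qed auto
  finally show ?thesis by (simp add: C_def)
qed


section \<open>Powers and the exponential of a matrix\<close>

lemma pow_mat_add:
  fixes A :: "complex mat"
  assumes "A \<in> carrier_mat n n"
  shows "A ^\<^sub>m (i + j) = A ^\<^sub>m i * A ^\<^sub>m j"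
proof (induction j)
  case (Suc j)
  then show ?case
    using assms assoc_mult_mat[of "A ^\<^sub>m i" n n "A ^\<^sub>m j" n A n] by simp
qed (use assms in auto)

lemma pow_mat_smult:
  fixes A :: "complex mat"
  assumes "A \<in> carrier_mat n n"
  shows "(c \<cdot>\<^sub>m A) ^\<^sub>m k = c ^ k \<cdot>\<^sub>m A ^\<^sub>m k"
proof (induction k)
  case (Suc k)
  then show ?case using assms
    by (simp add: mult_smult_distrib[of _ n n] mult_smult_assoc_mat[of _ n n] smult_smult_mat)
qed (use assms in simp)

lemma pow_mat_adjoint:
  fixes A :: "complex mat"
  assumes "A \<in> carrier_mat n n"
  shows "mat_adjoint (A ^\<^sub>m k) = mat_adjoint A ^\<^sub>m k"
proof (induction k)
  case (Suc k)
  have "mat_adjoint (A ^\<^sub>m Suc k) = mat_adjoint A * mat_adjoint (A ^\<^sub>m k)"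
    using assms by (simp add: mat_adjoint_mult)
  \<comment> \<open>A power appends its last factor on the right, the adjoint puts it on the left;
    \<open>pow_mat_add\<close> reconciles the two.\<close>
  also have "\<dots> = mat_adjoint A ^\<^sub>m 1 * mat_adjoint A ^\<^sub>m k" using assms Suc by simp
  also have "\<dots> = mat_adjoint A ^\<^sub>m (1 + k)"
    by (rule pow_mat_add[symmetric]) (use assms in auto)
  finally show ?case by simp
qed (use assms in simp)

text \<open>A crude entrywise bound suffices: divided by \<open>fact k\<close> it is still a term of
  a convergent scalar exponential series.\<close>

lemma pow_mat_bound:
  fixes A :: "complex mat"
  assumes A: "A \<in> carrier_mat n n" and c: "\<And>i j. i < n \<Longrightarrow> j < n \<Longrightarrow> norm (A $$ (i, j)) \<le> c"
    and ij: "i < n" "j < n"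
  shows "norm ((A ^\<^sub>m k) $$ (i, j)) \<le> (real n * c) ^ k"
  using ij(2)
proof (induction k arbitrary: j)
  case 0
  then show ?case using A ij(1) by auto
next
  case (Suc k)
  have "c \<ge> 0" using c[OF ij] norm_ge_zero order_trans by blast
  have "norm ((A ^\<^sub>m Suc k) $$ (i, j)) = norm (\<Sum>l<n. (A ^\<^sub>m k) $$ (i, l) * A $$ (l, j))"
    using A ij(1) Suc.prems by (simp add: index_mult_sum del: index_mult_mat(1))
  also have "\<dots> \<le> (\<Sum>l<n. (real n * c) ^ k * c)"
    using Suc c \<open>c \<ge> 0\<close> by (intro sum_norm_le) (auto simp: norm_mult intro!: mult_mono)
  also have "\<dots> = (real n * c) ^ Suc k" by simp
  finally show ?case .
qed

lemma mexp_summable: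
  fixes A :: "complex mat"
  assumes A: "A \<in> carrier_mat n n" and ij: "i < n" "j < n"
  shows "summable (\<lambda>k. norm ((A ^\<^sub>m k) $$ (i, j) / fact k))"
proof -
  define c where "c = Max ((\<lambda>(i, j). norm (A $$ (i, j))) ` ({..<n} \<times> {..<n}))"
  have "norm (A $$ (i, j)) \<le> c" if "i < n" "j < n" for i j
    unfolding c_def using that by (intro Max_ge) auto
  note b = pow_mat_bound[OF A this ij]
  show ?thesis
  proof (rule summable_comparison_test'[OF summable_exp[of "real n * c"]])
    fix k :: nat
    show "norm (norm ((A ^\<^sub>m k) $$ (i, j) / fact k)) \<le> inverse (fact k) * (real n * c) ^ k"
      using b[of k] by (simp add: norm_divide divide_simps)
  qed
qed

lemma mexp_dim [simp]: "dim_row (mexp A) = dim_row A" "dim_col (mexp A) = dim_row A"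
  by (simp_all add: mexp_def)

lemma mexp_carrier [simp]: "A \<in> carrier_mat n n \<Longrightarrow> mexp A \<in> carrier_mat n n"
  by (intro carrier_matI) auto

lemma mexp_index:
  "A \<in> carrier_mat n n \<Longrightarrow> i < n \<Longrightarrow> j < n \<Longrightarrow> mexp A $$ (i, j) = (\<Sum>k. (A ^\<^sub>m k) $$ (i, j) / fact k)"
  by (simp add: mexp_def)

text \<open>These are the coefficients in the Cauchy product of the series of \<open>A\<close> and
  of its negative; multiplied by \<open>fact k\<close> they form the binomial expansion of (1 -
  1)^k.\<close>

lemma alternating_fact_sum:
  "(\<Sum>i\<le>k. (- 1) ^ (k - i) / (fact i * fact (k - i)) :: complex) = (if k = 0 then 1 else 0)"
proof -
  have "(\<Sum>i\<le>k. (- 1) ^ (k - i) / (fact i * fact (k - i)) :: complex) =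
      (\<Sum>i\<le>k. of_nat (k choose i) * 1 ^ i * (- 1) ^ (k - i)) / fact k"
    unfolding sum_divide_distrib by (intro sum.cong) (auto simp: binomial_fact field_simps)
  also have "\<dots> = (1 + (- 1)) ^ k / fact k" by (subst binomial_ring) simp
  also have "\<dots> = (if k = 0 then 1 else 0)" by (cases k) auto
  finally show ?thesis .
qed

lemma mexp_mult_minus:
  assumes A: "A \<in> carrier_mat n n"
  shows "mexp A * mexp ((- 1) \<cdot>\<^sub>m A) = 1\<^sub>m n"
proof (rule eq_matI)
  fix i j assume "i < dim_row (1\<^sub>m n :: complex mat)" "j < dim_col (1\<^sub>m n :: complex mat)"
  then have ij: "i < n" "j < n" by auto
  define B where "B = (- 1 :: complex) \<cdot>\<^sub>m A"
  have B: "B \<in> carrier_mat n n" using A by (simp add: B_def)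
  let ?a = "\<lambda>l k. (A ^\<^sub>m k) $$ (i, l) / fact k" and ?b = "\<lambda>l k. (B ^\<^sub>m k) $$ (l, j) / fact k"
  have sa: "summable (\<lambda>k. norm (?a l k))" and sb: "summable (\<lambda>k. norm (?b l k))" if "l < n" for l
    using mexp_summable A B ij that by auto
  \<comment> \<open>All terms of total degree \<open>k\<close> carry the same power
    \<open>A ^\<^sub>m k\<close>, so the alternating sum removes every degree except 0.\<close>
  have diag: "(\<Sum>l<n. \<Sum>p\<le>k. ?a l p * ?b l (k - p)) = (if k = 0 then 1\<^sub>m n $$ (i, j) else 0)" for k
  proof -
    have "(\<Sum>l<n. \<Sum>p\<le>k. ?a l p * ?b l (k - p)) =
        (\<Sum>p\<le>k. \<Sum>l<n. (- 1) ^ (k - p) / (fact p * fact (k - p)) * ((A ^\<^sub>m p) $$ (i, l) * (A ^\<^sub>m (k - p)) $$ (l, j)))"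
      using A ij by (subst sum.swap, intro sum.cong) (auto simp: B_def pow_mat_smult)
    also have "\<dots> = (\<Sum>p\<le>k. (- 1) ^ (k - p) / (fact p * fact (k - p)) * (A ^\<^sub>m k) $$ (i, j))"
    proof (rule sum.cong[OF refl])
      fix p assume "p \<in> {..k}"
      then have "A ^\<^sub>m k = A ^\<^sub>m p * A ^\<^sub>m (k - p)"
        using pow_mat_add[OF A, of p "k - p"] by simp
      moreover have "(A ^\<^sub>m p * A ^\<^sub>m (k - p)) $$ (i, j) = (\<Sum>l<n. (A ^\<^sub>m p) $$ (i, l) * (A ^\<^sub>m (k - p)) $$ (l, j))"
        using A ij by (simp add: index_mult_sum del: index_mult_mat(1))
      ultimately show "(\<Sum>l<n. (- 1) ^ (k - p) / (fact p * fact (k - p)) * ((A ^\<^sub>m p) $$ (i, l) * (A ^\<^sub>m (k - p)) $$ (l, j)))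
          = (- 1) ^ (k - p) / (fact p * fact (k - p)) * (A ^\<^sub>m k) $$ (i, j)"
        by (simp add: sum_distrib_left)
    qed
    also have "\<dots> = (if k = 0 then 1\<^sub>m n $$ (i, j) else 0)"
      using A unfolding sum_distrib_right[symmetric] alternating_fact_sum by auto
    finally show ?thesis .
  qed
  have "(mexp A * mexp B) $$ (i, j) = (\<Sum>l<n. (\<Sum>k. ?a l k) * (\<Sum>k. ?b l k))"
    using A B ij by (simp add: index_mult_sum mexp_index del: index_mult_mat(1))
  also have "\<dots> = (\<Sum>l<n. \<Sum>k. \<Sum>p\<le>k. ?a l p * ?b l (k - p))"
    using sa sb by (intro sum.cong refl Cauchy_product) auto
  also have "\<dots> = (\<Sum>k. \<Sum>l<n. \<Sum>p\<le>k. ?a l p * ?b l (k - p))"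
    using sa sb by (intro suminf_sum[symmetric] summable_Cauchy_product) auto
  also have "\<dots> = (\<Sum>k. if k = 0 then 1\<^sub>m n $$ (i, j) else 0)" by (simp only: diag)
  also have "\<dots> = 1\<^sub>m n $$ (i, j)" by (rule sums_unique[symmetric]) (rule sums_single)
  finally show "(mexp A * mexp ((- 1) \<cdot>\<^sub>m A)) $$ (i, j) = 1\<^sub>m n $$ (i, j)" by (simp add: B_def)
qed (use A in auto)

lemma mexp_adjoint:
  assumes A: "A \<in> carrier_mat n n"
  shows "mat_adjoint (mexp A) = mexp (mat_adjoint A)"
proof (rule eq_matI)
  fix i j assume "i < dim_row (mexp (mat_adjoint A))" "j < dim_col (mexp (mat_adjoint A))"
  then have ij: "i < n" "j < n" using A by auto
  have "mat_adjoint (mexp A) $$ (i, j) = cnj (\<Sum>k. (A ^\<^sub>m k) $$ (j, i) / fact k)"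
    using A ij by (simp add: mexp_index)
  also have "\<dots> = (\<Sum>k. cnj ((A ^\<^sub>m k) $$ (j, i) / fact k))"
    by (rule bounded_linear.suminf[OF bounded_linear_cnj summable_norm_cancel[OF mexp_summable[OF A ij(2,1)]]])
  also have "\<dots> = (\<Sum>k. (mat_adjoint A ^\<^sub>m k) $$ (i, j) / fact k)"
    using A ij by (simp flip: pow_mat_adjoint[OF A])
  also have "\<dots> = mexp (mat_adjoint A) $$ (i, j)"
    using A ij by (simp add: mexp_index[of _ n])
  finally show "mat_adjoint (mexp A) $$ (i, j) = mexp (mat_adjoint A) $$ (i, j)" .
qed (use A in auto)

lemma mexp_unitary:
  assumes h: "h \<in> carrier_mat n n" "selfadjoint h"
  shows "mat_adjoint (mexp ((- \<i>) \<cdot>\<^sub>m h)) * mexp ((- \<i>) \<cdot>\<^sub>m h) = 1\<^sub>m n"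
proof -
  have "mat_adjoint (mexp ((- \<i>) \<cdot>\<^sub>m h)) = mexp (\<i> \<cdot>\<^sub>m h)"
    using h by (simp add: mexp_adjoint[of _ n] mat_adjoint_smult selfadjoint_def)
  moreover have "(- 1) \<cdot>\<^sub>m (\<i> \<cdot>\<^sub>m h) = (- \<i>) \<cdot>\<^sub>m h" by (simp add: smult_smult_mat)
  ultimately show ?thesis using mexp_mult_minus[of "\<i> \<cdot>\<^sub>m h" n] h by simp
qed

text \<open>The assumption \<open>lin\<close> makes \<open>\<Psi>\<close> commute with the entrywise limits that define \<open>mexp\<close>.\<close>

lemma mexp_hom:
  fixes \<Psi> :: "complex mat \<Rightarrow> complex mat" and Z :: "'z set"
  assumes A: "A \<in> carrier_mat n n"
    and carr: "\<And>B. B \<in> carrier_mat n n \<Longrightarrow> \<Psi> B \<in> carrier_mat d d"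
    and lin: "\<And>B x y. B \<in> carrier_mat n n \<Longrightarrow> x < d \<Longrightarrow> y < d \<Longrightarrow>
      \<Psi> B $$ (x, y) = (\<Sum>z\<in>Z. c x y z * B $$ (p x y z, q x y z))"
    and bounds: "\<And>x y z. x < d \<Longrightarrow> y < d \<Longrightarrow> z \<in> Z \<Longrightarrow> p x y z < n \<and> q x y z < n"
    and mult: "\<And>B C. B \<in> carrier_mat n n \<Longrightarrow> C \<in> carrier_mat n n \<Longrightarrow> \<Psi> (B * C) = \<Psi> B * \<Psi> C"
    and one: "\<Psi> (1\<^sub>m n) = 1\<^sub>m d"
  shows "\<Psi> (mexp A) = mexp (\<Psi> A)"
proof (rule eq_matI)
  have pow: "\<Psi> (A ^\<^sub>m k) = \<Psi> A ^\<^sub>m k" for k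
  proof (induction k)
    case (Suc k)
    then show ?case using A by (simp add: mult)
  qed (use A carr[OF A] one in simp)
  fix x y assume "x < dim_row (mexp (\<Psi> A))" "y < dim_col (mexp (\<Psi> A))"
  then have xy: "x < d" "y < d" using carr[OF A] by auto
  note b = bounds[OF xy]
  have s: "summable (\<lambda>k. (A ^\<^sub>m k) $$ (i, j) / fact k)" if "i < n" "j < n" for i j
    using mexp_summable[OF A that] by (rule summable_norm_cancel)
  have "\<Psi> (mexp A) $$ (x, y) =
      (\<Sum>z\<in>Z. c x y z * (\<Sum>k. (A ^\<^sub>m k) $$ (p x y z, q x y z) / fact k))"
    using A xy b by (simp add: lin mexp_index)
  also have "\<dots> = (\<Sum>z\<in>Z. \<Sum>k. c x y z * ((A ^\<^sub>m k) $$ (p x y z, q x y z) / fact k))"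
    using s b by (intro sum.cong refl suminf_mult[symmetric]) auto
  also have "\<dots> = (\<Sum>k. \<Sum>z\<in>Z. c x y z * ((A ^\<^sub>m k) $$ (p x y z, q x y z) / fact k))"
    using s b by (intro suminf_sum[symmetric] summable_mult) auto
  also have "\<dots> = (\<Sum>k. \<Psi> (A ^\<^sub>m k) $$ (x, y) / fact k)"
    using A xy by (simp add: lin sum_divide_distrib)
  also have "\<dots> = mexp (\<Psi> A) $$ (x, y)"
    using carr[OF A] xy by (simp add: pow mexp_index)
  finally show "\<Psi> (mexp A) $$ (x, y) = mexp (\<Psi> A) $$ (x, y)" .
qed (use A carr[OF A] carr[OF mexp_carrier[OF A]] in auto)

section \<open>Tensor factors\<close>

text \<open>Matrix units: in terms of them \<open>sigma_minus\<close>, \<open>sigma_plus\<close> and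
  the vacuum projector are single terms, and products reduce to matching indices.\<close>

definition eu :: "nat \<Rightarrow> nat \<Rightarrow> complex mat" where
  "eu a b = Matrix.mat 2 2 (\<lambda>(i, j). if i = a \<and> j = b then 1 else 0)"

lemma eu_carrier [simp]: "eu a b \<in> carrier_mat 2 2" "dim_row (eu a b) = 2" "dim_col (eu a b) = 2"
  by (simp_all add: eu_def)

lemma less_2_iff: "i < 2 \<longleftrightarrow> i = 0 \<or> i = (1::nat)"
  by auto

lemma mat2_eqI:
  assumes "A \<in> carrier_mat 2 2" "B \<in> carrier_mat 2 2"
    and "A $$ (0, 0) = B $$ (0, 0)" "A $$ (0, 1) = B $$ (0, 1)"
      "A $$ (1, 0) = B $$ (1, 0)" "A $$ (1, 1) = B $$ (1, 1)"
  shows "A = B"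
  using assms by (intro eq_matI) (auto simp: less_2_iff)

lemma sum_less_2: "(\<Sum>i<2. f i) = f 0 + f (1::nat)"
  by (simp add: numeral_2_eq_2)

lemma eu_mult: "b < 2 \<Longrightarrow> eu a b * eu c d = (if b = c then eu a d else 0\<^sub>m 2 2)"
  by (rule eq_matI) (auto simp: index_mult_sum sum_less_2 eu_def less_2_iff simp del: index_mult_mat(1))

lemma eu_adjoint: "mat_adjoint (eu a b) = eu b a"
  by (rule eq_matI) (auto simp: eu_def)

lemma eu_one: "eu 0 0 + eu 1 1 = 1\<^sub>m 2"
  by (rule eq_matI) (auto simp: eu_def less_2_iff)

lemma sigma_minus_eu: "sigma_minus = eu 1 0"
  unfolding sigma_minus_def eu_def
  by (rule eq_matI) (auto simp: mat_of_rows_list_def less_2_iff)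

lemma sigma_plus_eu: "sigma_plus = eu 0 1"
  by (simp add: sigma_plus_def sigma_minus_eu eu_adjoint)

lemma vacuum_proj_eu: "vacuum_proj = eu 1 1"
  unfolding vacuum_proj_def eu_def Phi_def
  by (rule eq_matI) (auto simp: less_2_iff)

lemma amp_dim_gen:
  "dim_row (amp m i X) = 2 ^ i * dim_row X * 2 ^ (slots m - i)"
  "dim_col (amp m i X) = 2 ^ i * dim_col X * 2 ^ (slots m - i)"
  by (simp_all add: amp_def)

lemma pow_split: "i \<le> slots m \<Longrightarrow> 2 ^ i * 2 * 2 ^ (slots m - i) = dimH m"
  by (simp add: dimH_def flip: power_add power_Suc2)

lemma amp_carrier [simp]:
  "X \<in> carrier_mat 2 2 \<Longrightarrow> i \<le> slots m \<Longrightarrow> amp m i X \<in> carrier_mat (dimH m) (dimH m)"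
  by (intro carrier_matI) (auto simp: pow_split amp_dim_gen)

lemma amp_dim [simp]:
  "X \<in> carrier_mat 2 2 \<Longrightarrow> i \<le> slots m \<Longrightarrow> dim_row (amp m i X) = dimH m"
  "X \<in> carrier_mat 2 2 \<Longrightarrow> i \<le> slots m \<Longrightarrow> dim_col (amp m i X) = dimH m"
  using amp_carrier by blast+

lemma amp_mult:
  "dim_col X = dim_row Y \<Longrightarrow> amp m i X * amp m i Y = amp m i (X * Y)"
  by (simp add: amp_def kron_mult one_mult_dim)

lemma amp_add:
  "dim_row X = dim_row Y \<Longrightarrow> dim_col X = dim_col Y \<Longrightarrow> amp m i (X + Y) = amp m i X + amp m i Y"
  by (simp add: amp_def kron_add_left kron_add_right)

lemma amp_smult: "amp m i (c \<cdot>\<^sub>m X) = c \<cdot>\<^sub>m amp m i X"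
  by (simp add: amp_def kron_smult)

lemma amp_adjoint: "mat_adjoint (amp m i X) = amp m i (mat_adjoint X)"
  by (simp add: amp_def kron_adjoint)

lemma amp_one: "i \<le> slots m \<Longrightarrow> amp m i (1\<^sub>m 2) = 1\<^sub>m (dimH m)"
  by (simp add: amp_def kron_one_one pow_split)

lemma amp_zero: "i \<le> slots m \<Longrightarrow> amp m i (0\<^sub>m 2 2) = 0\<^sub>m (dimH m) (dimH m)"
proof -
  assume i: "i \<le> slots m"
  have "0\<^sub>m 2 2 = 0 \<cdot>\<^sub>m eu 0 0" by (rule eq_matI) auto
  then have "amp m i (0\<^sub>m 2 2) = 0 \<cdot>\<^sub>m amp m i (eu 0 0)" by (simp add: amp_smult)
  also have "\<dots> = 0\<^sub>m (dimH m) (dimH m)" using i by (intro eq_matI) (auto simp: pow_split)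
  finally show ?thesis .
qed

text \<open>Both operators are written as a product over the five groups of factors
  before \<open>i\<close>, at \<open>i\<close>, between, at \<open>j\<close>, after \<open>j\<close>.\<close>

lemma amp_commute_less:
  assumes ij: "i < j" "j \<le> slots m" and X: "X \<in> carrier_mat 2 2" and Y: "Y \<in> carrier_mat 2 2"
  shows "amp m i X * amp m j Y = amp m j Y * amp m i X"
proof -
  define a b where "a = j - i - 1" and "b = slots m - j"
  have eqs: "slots m - i = a + 1 + b" "j = i + 1 + a" "slots m - j = b"
    using ij by (auto simp: a_def b_def)
  have X': "amp m i X = kron (1\<^sub>m (2 ^ i)) (kron X (kron (1\<^sub>m (2 ^ a)) (kron (1\<^sub>m 2) (1\<^sub>m (2 ^ b)))))"
    by (simp add: amp_def kron_assoc eqs(1) kron_one_one power_add mult_ac)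
  have Y': "amp m j Y = kron (1\<^sub>m (2 ^ i)) (kron (1\<^sub>m 2) (kron (1\<^sub>m (2 ^ a)) (kron Y (1\<^sub>m (2 ^ b)))))"
    unfolding amp_def eqs(3) unfolding eqs(2) power_add kron_one_one[symmetric] kron_assoc by simp
  show ?thesis unfolding X' Y'
    using X Y by (simp add: kron_mult one_mult_dim)
qed

lemma amp_commute:
  assumes "i \<noteq> j" "i \<le> slots m" "j \<le> slots m" "X \<in> carrier_mat 2 2" "Y \<in> carrier_mat 2 2"
  shows "amp m i X * amp m j Y = amp m j Y * amp m i X"
  using amp_commute_less[of i j m X Y] amp_commute_less[of j i m Y X] assms
  by (metis linorder_neqE_nat)

lemma amp_inj:
  assumes X: "X \<in> carrier_mat 2 2" and Y: "Y \<in> carrier_mat 2 2" and eq: "amp m 0 X = amp m 0 Y"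
  shows "X = Y"
proof (rule eq_matI)
  fix i j assume "i < dim_row Y" "j < dim_col Y"
  then have ij: "i < 2" "j < 2" using Y by auto
  let ?N = "2 ^ slots m :: nat"
  \<comment> \<open>Multiples of \<open>?N\<close> have field index 0, where the identity on the
    field contributes the entry 1.\<close>
  have "amp m 0 W $$ (i * ?N, j * ?N) = W $$ (i, j)" if "W \<in> carrier_mat 2 2" for W
    using that ij unfolding amp_def by (simp add: kron_index flip: One_nat_def)
  then show "X $$ (i, j) = Y $$ (i, j)" using eq X Y by metis
qed (use X Y in auto)

definition tens :: "homodyne \<Rightarrow> nat \<Rightarrow> complex mat \<Rightarrow> complex mat \<Rightarrow> complex mat" where
  "tens m l X E = amp m 0 X * amp m l E"

lemma tens_carrier [simp]:
  "X \<in> carrier_mat 2 2 \<Longrightarrow> E \<in> carrier_mat 2 2 \<Longrightarrow> l \<le> slots m \<Longrightarrow> tens m l X E \<in> carrier_mat (dimH m) (dimH m)"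
  unfolding tens_def by (rule mult_carrier_mat[of _ _ "dimH m"]) auto

lemma tens_dim [simp]:
  "X \<in> carrier_mat 2 2 \<Longrightarrow> E \<in> carrier_mat 2 2 \<Longrightarrow> l \<le> slots m \<Longrightarrow> dim_row (tens m l X E) = dimH m"
  "X \<in> carrier_mat 2 2 \<Longrightarrow> E \<in> carrier_mat 2 2 \<Longrightarrow> l \<le> slots m \<Longrightarrow> dim_col (tens m l X E) = dimH m"
  using tens_carrier by blast+

lemma tens_mult:
  assumes "0 < l" "l \<le> slots m" "X \<in> carrier_mat 2 2" "Y \<in> carrier_mat 2 2"
    "E \<in> carrier_mat 2 2" "F \<in> carrier_mat 2 2"
  shows "tens m l X E * tens m l Y F = tens m l (X * Y) (E * F)"
proof -
  let ?D = "carrier_mat (dimH m) (dimH m)"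
  have c: "amp m 0 X \<in> ?D" "amp m 0 Y \<in> ?D" "amp m l E \<in> ?D" "amp m l F \<in> ?D"
    using assms by auto
  note d = c[THEN carrier_matD(1)] c[THEN carrier_matD(2)]
  have "tens m l X E * tens m l Y F = amp m 0 X * ((amp m l E * amp m 0 Y) * amp m l F)"
    unfolding tens_def using d by (simp add: mult_assoc_dim)
  also have "amp m l E * amp m 0 Y = amp m 0 Y * amp m l E"
    using assms by (intro amp_commute) auto
  also have "amp m 0 X * ((amp m 0 Y * amp m l E) * amp m l F) = (amp m 0 X * amp m 0 Y) * (amp m l E * amp m l F)"
    using d by (simp add: mult_assoc_dim)
  also have "\<dots> = tens m l (X * Y) (E * F)"
    using assms by (subst (1 2) amp_mult) (auto simp: tens_def)
  finally show ?thesis .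
qed

lemma tens_adjoint:
  assumes "0 < l" "l \<le> slots m" "X \<in> carrier_mat 2 2" "E \<in> carrier_mat 2 2"
  shows "mat_adjoint (tens m l X E) = tens m l (mat_adjoint X) (mat_adjoint E)"
proof -
  have "mat_adjoint (tens m l X E) = amp m l (mat_adjoint E) * amp m 0 (mat_adjoint X)"
    unfolding tens_def using assms by (subst mat_adjoint_mult) (auto simp: amp_adjoint)
  also have "\<dots> = amp m 0 (mat_adjoint X) * amp m l (mat_adjoint E)"
    using assms by (intro amp_commute) auto
  finally show ?thesis by (simp add: tens_def)
qed

lemma tens_add_left:
  assumes "l \<le> slots m" "X \<in> carrier_mat 2 2" "Y \<in> carrier_mat 2 2" "E \<in> carrier_mat 2 2"
  shows "tens m l (X + Y) E = tens m l X E + tens m l Y E"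
  unfolding tens_def using assms
  by (subst amp_add) (auto intro!: add_mult_dim)

lemma tens_add_right:
  assumes "l \<le> slots m" "X \<in> carrier_mat 2 2" "E \<in> carrier_mat 2 2" "F \<in> carrier_mat 2 2"
  shows "tens m l X (E + F) = tens m l X E + tens m l X F"
  unfolding tens_def using assms
  by (subst amp_add) (auto intro!: mult_add_dim)

lemma tens_smult:
  assumes "l \<le> slots m" "X \<in> carrier_mat 2 2" "E \<in> carrier_mat 2 2"
  shows "tens m l (c \<cdot>\<^sub>m X) E = c \<cdot>\<^sub>m tens m l X E" "tens m l X (c \<cdot>\<^sub>m E) = c \<cdot>\<^sub>m tens m l X E"
  unfolding tens_def amp_smult using assms
  by (auto intro!: mult_smult_dim smult_mult_dim)

lemma tens_one:
  assumes "l \<le> slots m" "X \<in> carrier_mat 2 2"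
  shows "tens m l X (1\<^sub>m 2) = amp m 0 X" "tens m l (1\<^sub>m 2) X = amp m l X"
  unfolding tens_def using assms by (auto simp: amp_one pow_split intro!: one_mult_dim)

lemma tens_zero:
  assumes "l \<le> slots m" "X \<in> carrier_mat 2 2"
  shows "tens m l X (0\<^sub>m 2 2) = 0\<^sub>m (dimH m) (dimH m)" "tens m l (0\<^sub>m 2 2) X = 0\<^sub>m (dimH m) (dimH m)"
  unfolding tens_def using assms
  by (auto simp: amp_zero pow_split intro!: right_mult_zero_mat left_mult_zero_mat)

lemma square_closed [simp]:
  fixes A B :: "complex mat"
  assumes "A \<in> carrier_mat n n" "B \<in> carrier_mat n n"
  shows "A * B \<in> carrier_mat n n" "A + B \<in> carrier_mat n n"
  using assms by auto

text \<open>A \<open>4 \<times> 4\<close> matrix acts on system \<open>\<otimes>\<close> one field factor, with index \<open>2 i + a\<close> for the system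
  index \<open>i\<close> and the field index \<open>a\<close>; \<open>\<Phi>\<close> has field index \<open>1\<close>.\<close>

definition blk :: "complex mat \<Rightarrow> nat \<Rightarrow> nat \<Rightarrow> complex mat" where
  "blk B a b = Matrix.mat 2 2 (\<lambda>(i, j). B $$ (2 * i + a, 2 * j + b))"

definition unblk :: "(nat \<Rightarrow> nat \<Rightarrow> complex mat) \<Rightarrow> complex mat" where
  "unblk F = Matrix.mat 4 4 (\<lambda>(p, q). F (p mod 2) (q mod 2) $$ (p div 2, q div 2))"

text \<open>The copy of a 4 by 4 matrix on the system and the \<open>l\<close>-th field factor. For
  positive \<open>l\<close> it is a unital star-homomorphism, so a single 4 by 4 exponential serves
  all time slots.\<close>

definition emb :: "homodyne \<Rightarrow> nat \<Rightarrow> complex mat \<Rightarrow> complex mat" where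
  "emb m l B = tens m l (blk B 0 0) (eu 0 0) + tens m l (blk B 0 1) (eu 0 1) +
     tens m l (blk B 1 0) (eu 1 0) + tens m l (blk B 1 1) (eu 1 1)"

lemma blk_carrier [simp]: "blk B a b \<in> carrier_mat 2 2" "dim_row (blk B a b) = 2" "dim_col (blk B a b) = 2"
  by (simp_all add: blk_def)

lemma unblk_carrier [simp]: "unblk F \<in> carrier_mat 4 4"
  by (simp add: unblk_def)

lemma blk_unblk:
  assumes "a < 2" "b < 2" "F a b \<in> carrier_mat 2 2"
  shows "blk (unblk F) a b = F a b"
  using assms by (intro eq_matI) (auto simp: blk_def unblk_def less_2_iff)

lemma sum_less_4: "(\<Sum>i<4. f i) = f 0 + f 1 + f 2 + f (3::nat)"
  by (simp add: eval_nat_numeral)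

lemma blk_mult:
  assumes "B \<in> carrier_mat 4 4" "C \<in> carrier_mat 4 4" "a < 2" "b < 2"
  shows "blk (B * C) a b = blk B a 0 * blk C 0 b + blk B a 1 * blk C 1 b"
proof -
  have "(B * C) $$ (2 * i + a, 2 * j + b) = (\<Sum>k<4. B $$ (2 * i + a, k) * C $$ (k, 2 * j + b))"
    if "i < 2" "j < 2" for i j
    using assms that by (simp add: index_mult_sum del: index_mult_mat(1))
  then show ?thesis
    by (intro eq_matI)
      (auto simp: blk_def index_mult_sum sum_less_2 sum_less_4 algebra_simps eval_nat_numeral simp del: index_mult_mat(1))
qed

lemma blk_adjoint:
  assumes "B \<in> carrier_mat 4 4" "a < 2" "b < 2"
  shows "blk (mat_adjoint B) a b = mat_adjoint (blk B b a)"
  using assms by (intro eq_matI) (auto simp: blk_def)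

lemma blk_one: "a < 2 \<Longrightarrow> b < 2 \<Longrightarrow> blk (1\<^sub>m 4) a b = (if a = b then 1\<^sub>m 2 else 0\<^sub>m 2 2)"
  by (intro eq_matI) (auto simp: blk_def less_2_iff)

lemma blk_smult: "B \<in> carrier_mat 4 4 \<Longrightarrow> a < 2 \<Longrightarrow> b < 2 \<Longrightarrow> blk (c \<cdot>\<^sub>m B) a b = c \<cdot>\<^sub>m blk B a b"
  by (intro eq_matI) (auto simp: blk_def)

lemma emb_carrier [simp]:
  assumes "l \<le> slots m"
  shows "emb m l B \<in> carrier_mat (dimH m) (dimH m)" "dim_row (emb m l B) = dimH m" "dim_col (emb m l B) = dimH m"
  using assms by (auto simp: emb_def intro!: add_carrier_mat)

lemma emb_mult:
  assumes l: "0 < l" "l \<le> slots m" and BC: "B \<in> carrier_mat 4 4" "C \<in> carrier_mat 4 4"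
  shows "emb m l (B * C) = emb m l B * emb m l C"
  unfolding emb_def using l
  by (simp add: blk_mult[OF BC] tens_add_left add_mult_dim mult_add_dim tens_mult eu_mult tens_zero)
    (intro eq_matI; simp)

lemma emb_one: "l \<le> slots m \<Longrightarrow> emb m l (1\<^sub>m 4) = 1\<^sub>m (dimH m)"
  by (simp add: emb_def blk_one tens_zero tens_one amp_one eu_one[unfolded One_nat_def] flip: amp_add)

lemma emb_smult:
  "l \<le> slots m \<Longrightarrow> B \<in> carrier_mat 4 4 \<Longrightarrow> emb m l (c \<cdot>\<^sub>m B) = c \<cdot>\<^sub>m emb m l B"
  by (simp add: emb_def blk_smult tens_smult smult_add_dim)

lemma emb_adjoint:
  assumes "0 < l" "l \<le> slots m" "B \<in> carrier_mat 4 4"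
  shows "mat_adjoint (emb m l B) = emb m l (mat_adjoint B)"
  using assms unfolding emb_def
  by (simp add: blk_adjoint mat_adjoint_add tens_adjoint eu_adjoint) (intro eq_matI; simp)

text \<open>Has the shape that \<open>mexp_hom\<close> asks for: linear in the entries of
  \<open>X\<close>, with coefficients independent of \<open>X\<close>.\<close>

lemma tens_index:
  assumes "l \<le> slots m" "X \<in> carrier_mat 2 2" "E \<in> carrier_mat 2 2" "x < dimH m" "y < dimH m"
  shows "tens m l X E $$ (x, y) = (\<Sum>z<dimH m. (1\<^sub>m (2 ^ slots m) $$ (x mod 2 ^ slots m, z mod 2 ^ slots m) *
    amp m l E $$ (z, y)) * X $$ (x div 2 ^ slots m, z div 2 ^ slots m))"
proof -
  have "amp m 0 X $$ (x, z) = X $$ (x div 2 ^ slots m, z div 2 ^ slots m) *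
      1\<^sub>m (2 ^ slots m) $$ (x mod 2 ^ slots m, z mod 2 ^ slots m)" if "z < dimH m" for z
    using that assms unfolding amp_def by (simp add: dimH_def kron_index flip: One_nat_def)
  then show ?thesis using assms
    by (simp add: tens_def index_mult_sum mult_ac del: index_mult_mat(1))
qed

lemma emb_mexp:
  assumes l: "0 < l" "l \<le> slots m" and B: "B \<in> carrier_mat 4 4"
  shows "emb m l (mexp B) = mexp (emb m l B)"
proof -
  let ?N = "2 ^ slots m :: nat"
  have half: "x div ?N < 2" if "x < dimH m" for x
    using that by (simp add: dimH_def less_mult_imp_div_less)
  \<comment> \<open>The summation index combines a block position \<open>(a, b)\<close> with the
    inner index \<open>z\<close> of a matrix product.\<close>
  let ?c = "\<lambda>x y (a, b, z). 1\<^sub>m ?N $$ (x mod ?N, z mod ?N) * amp m l (eu a b) $$ (z, y)"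
  let ?p = "\<lambda>x y (a, b, z). 2 * (x div ?N) + a" and ?q = "\<lambda>x y (a, b, z). 2 * (z div ?N) + b"
  let ?Z = "{..<2} \<times> {..<2} \<times> {..<dimH m}"
  have lin: "emb m l B $$ (x, y) = (\<Sum>z\<in>?Z. ?c x y z * B $$ (?p x y z, ?q x y z))"
    if "B \<in> carrier_mat 4 4" "x < dimH m" "y < dimH m" for B x y
  proof -
    have t: "tens m l (blk B a b) (eu a b) $$ (x, y) =
        (\<Sum>z<dimH m. ?c x y (a, b, z) * B $$ (?p x y (a, b, z), ?q x y (a, b, z)))" for a b
      using that l half by (subst tens_index) (auto simp: blk_def intro!: sum.cong)
    have "(\<Sum>z\<in>?Z. ?c x y z * B $$ (?p x y z, ?q x y z)) =
        (\<Sum>a<2. \<Sum>b<2. \<Sum>z<dimH m. ?c x y (a, b, z) * B $$ (?p x y (a, b, z), ?q x y (a, b, z)))"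
      by (simp add: sum.cartesian_product split_def)
    also have "\<dots> = emb m l B $$ (x, y)"
      unfolding t[symmetric] emb_def sum_less_2 using that l by simp
    finally show ?thesis by simp
  qed
  have bounds: "?p x y z < 4 \<and> ?q x y z < 4" if "x < dimH m" "y < dimH m" "z \<in> ?Z" for x y z
    using that half[of x] half[of "snd (snd z)"] by auto
  show ?thesis
    by (rule mexp_hom[where c = ?c and p = ?p and q = ?q and Z = ?Z and n = 4 and d = "dimH m"])
      (use B lin bounds emb_mult emb_one l in \<open>auto simp del: split_paired_All\<close>)
qed

section \<open>The one-step unitaries and their coefficients\<close>

definition tens4 :: "homodyne \<Rightarrow> nat \<Rightarrow> (nat \<Rightarrow> nat \<Rightarrow> complex mat) \<Rightarrow> complex mat" where
  "tens4 m l F = tens m l (F 0 0) (eu 0 0) + tens m l (F 0 1) (eu 0 1) +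
     tens m l (F 1 0) (eu 1 0) + tens m l (F 1 1) (eu 1 1)"

lemma emb_tens4: "emb m l B = tens4 m l (blk B)"
  by (simp add: emb_def tens4_def)

lemma tens4_cong:
  assumes "\<And>a b. a < 2 \<Longrightarrow> b < 2 \<Longrightarrow> F a b = G a b"
  shows "tens4 m l F = tens4 m l G"
  using assms by (simp add: tens4_def)

text \<open>Sandwiching between matrix units moves the block \<open>F a b\<close> to a diagonal
  place; adding both diagonal places restores the identity on the field factor.\<close>

lemma tens4_extract:
  assumes l: "0 < l" "l \<le> slots m" and F: "\<And>a b. a < 2 \<Longrightarrow> b < 2 \<Longrightarrow> F a b \<in> carrier_mat 2 2"
    and ab: "a < 2" "b < 2"
  shows "tens m l (1\<^sub>m 2) (eu 0 a) * tens4 m l F * tens m l (1\<^sub>m 2) (eu b 0) +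
     tens m l (1\<^sub>m 2) (eu 1 a) * tens4 m l F * tens m l (1\<^sub>m 2) (eu b 1) = amp m 0 (F a b)"
proof -
  have F': "F 0 0 \<in> carrier_mat 2 2" "F 0 1 \<in> carrier_mat 2 2" "F 1 0 \<in> carrier_mat 2 2" "F 1 1 \<in> carrier_mat 2 2"
    using F by auto
  have FD: "F 0 0 * 1\<^sub>m 2 = F 0 0" "F 0 1 * 1\<^sub>m 2 = F 0 1" "F 1 0 * 1\<^sub>m 2 = F 1 0" "F 1 1 * 1\<^sub>m 2 = F 1 1"
    "1\<^sub>m 2 * F 0 0 = F 0 0" "1\<^sub>m 2 * F 0 1 = F 0 1" "1\<^sub>m 2 * F 1 0 = F 1 0" "1\<^sub>m 2 * F 1 1 = F 1 1"
    using F' by (auto intro!: one_mult_dim)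
  have "tens m l (1\<^sub>m 2) (eu c a) * tens4 m l F * tens m l (1\<^sub>m 2) (eu b c) = tens m l (F a b) (eu c c)" for c
    unfolding tens4_def using l F' FD ab[unfolded less_2_iff]
    by (elim disjE;
      simp add: mult_add_dim add_mult_dim tens_mult eu_mult tens_zero;
      (intro eq_matI; simp))
  moreover have "tens m l (F a b) (eu 0 0) + tens m l (F a b) (eu 1 1) = amp m 0 (F a b)"
    using l F[OF ab] by (simp add: eu_one[unfolded One_nat_def] tens_one flip: tens_add_right)
  ultimately show ?thesis by simp
qed

text \<open>Linear independence of the four matrix units over the system operators, which makes the
  coefficients of \<open>Mop\<close> unique.\<close>

lemma tens4_inj:
  assumes l: "0 < l" "l \<le> slots m"
    and F: "\<And>a b. a < 2 \<Longrightarrow> b < 2 \<Longrightarrow> F a b \<in> carrier_mat 2 2"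
    and G: "\<And>a b. a < 2 \<Longrightarrow> b < 2 \<Longrightarrow> G a b \<in> carrier_mat 2 2"
    and eq: "tens4 m l F = tens4 m l G" and ab: "a < 2" "b < 2"
  shows "F a b = G a b"
proof -
  have "amp m 0 (H a b) = tens m l (1\<^sub>m 2) (eu 0 a) * tens4 m l H * tens m l (1\<^sub>m 2) (eu b 0) +
     tens m l (1\<^sub>m 2) (eu 1 a) * tens4 m l H * tens m l (1\<^sub>m 2) (eu b 1)"
    if "\<And>a b. a < 2 \<Longrightarrow> b < 2 \<Longrightarrow> H a b \<in> carrier_mat 2 2" for H
    by (rule tens4_extract[symmetric]) (use l that ab in blast)+
  from this[of F, OF F] this[of G, OF G] have "amp m 0 (F a b) = amp m 0 (G a b)"
    by (simp only: eq)
  then show ?thesis by (rule amp_inj[OF F[OF ab] G[OF ab]])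
qed

text \<open>The coefficients \<open>W\<close>, \<open>X\<close>, \<open>Y\<close>, \<open>Z\<close>
  belong to the gauge, creation, annihilation and time increments. \<open>Z\<close> occupies both
  diagonal blocks because the time increment is a multiple of the identity, while the gauge
  increment is \<open>eu 0 0\<close> alone.\<close>

definition noise_blocks :: "homodyne \<Rightarrow> complex mat \<Rightarrow> complex mat \<Rightarrow> complex mat \<Rightarrow> complex mat \<Rightarrow>
    nat \<Rightarrow> nat \<Rightarrow> complex mat" where
  "noise_blocks m W X Y Z a b =
     (if a = 0 then if b = 0 then W + complex_of_real ((lam m)\<^sup>2) \<cdot>\<^sub>m Z else complex_of_real (lam m) \<cdot>\<^sub>m X
      else if b = 0 then complex_of_real (lam m) \<cdot>\<^sub>m Y else complex_of_real ((lam m)\<^sup>2) \<cdot>\<^sub>m Z)"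

lemma noise_sum:
  assumes l: "0 < l" "l \<le> slots m"
    and c: "W \<in> carrier_mat 2 2" "X \<in> carrier_mat 2 2" "Y \<in> carrier_mat 2 2" "Z \<in> carrier_mat 2 2"
  shows "amp m 0 W * DLambda m l + amp m 0 X * DAs m l + amp m 0 Y * DA m l + amp m 0 Z * Dt m l =
     tens4 m l (noise_blocks m W X Y Z)"
proof -
  have 1: "amp m 0 W * DLambda m l = tens m l W (eu 0 0)"
    by (simp add: DLambda_def tens_def sigma_plus_eu sigma_minus_eu eu_mult)
  have 2: "amp m 0 X * DAs m l = complex_of_real (lam m) \<cdot>\<^sub>m tens m l X (eu 0 1)"
    using l c by (simp add: DAs_def tens_def sigma_plus_eu mult_smult_dim)
  have 3: "amp m 0 Y * DA m l = complex_of_real (lam m) \<cdot>\<^sub>m tens m l Y (eu 1 0)"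
    using l c by (simp add: DA_def tens_def sigma_minus_eu mult_smult_dim)
  have "amp m 0 Z * Dt m l = complex_of_real ((lam m)\<^sup>2) \<cdot>\<^sub>m amp m 0 Z"
    using l c by (simp add: Dt_def mult_smult_dim one_mult_dim)
  also have "\<dots> = complex_of_real ((lam m)\<^sup>2) \<cdot>\<^sub>m (tens m l Z (eu 0 0) + tens m l Z (eu 1 1))"
    using l c by (simp add: eu_one[unfolded One_nat_def] tens_one flip: tens_add_right)
  finally have 4: "amp m 0 Z * Dt m l = complex_of_real ((lam m)\<^sup>2) \<cdot>\<^sub>m tens m l Z (eu 0 0) +
      complex_of_real ((lam m)\<^sup>2) \<cdot>\<^sub>m tens m l Z (eu 1 1)"
    using l c by (simp add: smult_add_dim)
  show ?thesis unfolding 1 2 3 4 tens4_def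
    using l c by (simp add: noise_blocks_def tens_add_left tens_smult) (intro eq_matI; simp)
qed

definition gen :: "homodyne \<Rightarrow> real \<Rightarrow> complex mat" where
  "gen m u = unblk (noise_blocks m (L1 m u) (L2 m u) (mat_adjoint (L2 m u)) (L3 m u))"

definition step_unitary :: "homodyne \<Rightarrow> real \<Rightarrow> complex mat" where
  "step_unitary m u = mexp ((- \<i>) \<cdot>\<^sub>m gen m u)"

text \<open>The Kraus operator without its factor 1 / sqrt 2, which enters as the 1 / 2 in
  \<open>tau\<close>.\<close>

definition kraus :: "homodyne \<Rightarrow> real \<Rightarrow> real \<Rightarrow> complex mat" where
  "kraus m u y = 1\<^sub>m 2 + complex_of_real ((lam m)\<^sup>2) \<cdot>\<^sub>m Mcirc m u + complex_of_real y \<cdot>\<^sub>m Mplus m u"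

lemma gen_carrier [simp]: "gen m u \<in> carrier_mat 4 4"
  by (simp add: gen_def)

lemma step_unitary_carrier [simp]: "step_unitary m u \<in> carrier_mat 4 4"
  by (simp add: step_unitary_def)

lemma noise_blocks_carrier [simp]:
  assumes "W \<in> carrier_mat 2 2" "X \<in> carrier_mat 2 2" "Y \<in> carrier_mat 2 2" "Z \<in> carrier_mat 2 2"
  shows "noise_blocks m W X Y Z a b \<in> carrier_mat 2 2"
  using assms by (simp add: noise_blocks_def)

context
  fixes m :: homodyne
  assumes model: "homodyne_model m"
begin

lemma lam_pos: "0 < lam m"
  using model by (auto simp: homodyne_model_def lam_def)

lemma slots_pos: "0 < slots m"
  using model by (auto simp: homodyne_model_def)

context
  fixes u :: real
  assumes u: "u \<in> controls m"
begin

lemma L_carrier: "L1 m u \<in> carrier_mat 2 2" "L2 m u \<in> carrier_mat 2 2" "L3 m u \<in> carrier_mat 2 2"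
  "mat_adjoint (L1 m u) = L1 m u" "mat_adjoint (L3 m u) = L3 m u"
  using model u by (auto simp: homodyne_model_def selfadjoint_def)

text \<open>The exponent is the image under \<open>emb\<close> of a multiple of \<open>gen\<close>,
  and \<open>emb\<close> commutes with the exponential. Hence the same 4 by 4 unitary describes the
  interaction in every slot.\<close>

lemma Mop_emb:
  assumes l: "0 < l" "l \<le> slots m"
  shows "Mop m l u = emb m l (step_unitary m u)"
proof -
  let ?F = "noise_blocks m (L1 m u) (L2 m u) (mat_adjoint (L2 m u)) (L3 m u)"
  have "tens4 m l ?F = emb m l (gen m u)"
    unfolding emb_tens4 gen_def using L_carrier by (intro tens4_cong) (simp add: blk_unblk)
  then show ?thesis
    unfolding Mop_def step_unitary_def using l L_carrier
    by (simp add: noise_sum emb_mexp emb_smult)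
qed

lemma gen_selfadjoint: "selfadjoint (gen m u)"
proof -
  let ?F = "noise_blocks m (L1 m u) (L2 m u) (mat_adjoint (L2 m u)) (L3 m u)"
  have F: "mat_adjoint (?F a b) = ?F b a" for a b
    using L_carrier by (auto simp: noise_blocks_def mat_adjoint_add mat_adjoint_smult)
  have "cnj (?F b a $$ (j, i)) = ?F a b $$ (i, j)" if "i < 2" "j < 2" for a b i j
  proof -
    have "?F b a \<in> carrier_mat 2 2" using L_carrier by simp
    then show ?thesis unfolding F[of b a, symmetric] using that by simp
  qed
  then show ?thesis
    unfolding selfadjoint_def gen_def unblk_def by (intro eq_matI) (auto simp: less_mult_imp_div_less)
qed

lemma step_unitary: "mat_adjoint (step_unitary m u) * step_unitary m u = 1\<^sub>m 4"
  unfolding step_unitary_def by (rule mexp_unitary) (auto simp: gen_selfadjoint)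

lemma Mop_carrier [simp]:
  assumes "0 < l" "l \<le> slots m"
  shows "Mop m l u \<in> carrier_mat (dimH m) (dimH m)"
  using assms by (simp add: Mop_emb)

lemma Mop_unitary:
  assumes l: "0 < l" "l \<le> slots m"
  shows "mat_adjoint (Mop m l u) * Mop m l u = 1\<^sub>m (dimH m)"
  using l by (simp add: Mop_emb emb_adjoint emb_one step_unitary flip: emb_mult)

text \<open>The defining equation says that the step unitary minus the identity has the blocks
  \<open>noise_blocks\<close>, and it is solved block by block: the block at (1, 1) yields the time
  coefficient, and its difference from the block at (0, 0) the gauge coefficient.\<close>

lemma Mcoeffs_eq:
  defines "B \<equiv> step_unitary m u" and "c \<equiv> complex_of_real (lam m)"
  shows "Mcoeffs m u = (blk B 0 0 + (- 1) \<cdot>\<^sub>m blk B 1 1, (1 / c) \<cdot>\<^sub>m blk B 0 1, (1 / c) \<cdot>\<^sub>m blk B 1 0,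
     (1 / c\<^sup>2) \<cdot>\<^sub>m (blk B 1 1 + (- 1) \<cdot>\<^sub>m 1\<^sub>m 2))"
proof -
  have c0: "c \<noteq> 0" using lam_pos by (simp add: c_def)
  have eqv: "Mop m l u = 1\<^sub>m (dimH m) + amp m 0 W * DLambda m l +
        amp m 0 X * DAs m l + amp m 0 Y * DA m l + amp m 0 Z * Dt m l \<longleftrightarrow>
      tens4 m l (blk B) = tens4 m l (\<lambda>a b. blk (1\<^sub>m 4) a b + noise_blocks m W X Y Z a b)"
    if l: "0 < l" "l \<le> slots m"
      and C: "W \<in> carrier_mat 2 2" "X \<in> carrier_mat 2 2" "Y \<in> carrier_mat 2 2" "Z \<in> carrier_mat 2 2" for l W X Y Z
  proof -
    have "tens4 m l (\<lambda>a b. blk (1\<^sub>m 4) a b + noise_blocks m W X Y Z a b) =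
        tens4 m l (blk (1\<^sub>m 4)) + tens4 m l (noise_blocks m W X Y Z)"
      using l C unfolding tens4_def by (simp add: tens_add_left) (intro eq_matI; simp)
    also have "tens4 m l (blk (1\<^sub>m 4)) = 1\<^sub>m (dimH m)" using l by (simp add: emb_one flip: emb_tens4)
    also have "1\<^sub>m (dimH m) + tens4 m l (noise_blocks m W X Y Z) = 1\<^sub>m (dimH m) + amp m 0 W * DLambda m l +
        amp m 0 X * DAs m l + amp m 0 Y * DA m l + amp m 0 Z * Dt m l"
      unfolding noise_sum[OF l C, symmetric] using l C
      by (intro eq_matI) (auto simp: Dt_def DLambda_def DA_def DAs_def sigma_plus_eu sigma_minus_eu eu_mult
        simp del: index_mult_mat(1))
    finally show ?thesis unfolding Mop_emb[OF l] emb_tens4 B_def by simp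
  qed
  show ?thesis unfolding Mcoeffs_def
  proof (rule the_equality)
    have "tens4 m l (blk B) = tens4 m l (\<lambda>a b. blk (1\<^sub>m 4) a b + noise_blocks m (blk B 0 0 + (- 1) \<cdot>\<^sub>m blk B 1 1) ((1 / c) \<cdot>\<^sub>m blk B 0 1)
      ((1 / c) \<cdot>\<^sub>m blk B 1 0) ((1 / c\<^sup>2) \<cdot>\<^sub>m (blk B 1 1 + (- 1) \<cdot>\<^sub>m 1\<^sub>m 2)) a b)" for l
      using c0 by (intro tens4_cong eq_matI)
        (auto simp: noise_blocks_def blk_one less_2_iff simp flip: c_def)
    then show "case (blk B 0 0 + (- 1) \<cdot>\<^sub>m blk B 1 1, (1 / c) \<cdot>\<^sub>m blk B 0 1, (1 / c) \<cdot>\<^sub>m blk B 1 0,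
        (1 / c\<^sup>2) \<cdot>\<^sub>m (blk B 1 1 + (- 1) \<cdot>\<^sub>m 1\<^sub>m 2)) of (Mpm, Mp, Mm, Mo) \<Rightarrow>
      Mpm \<in> carrier_mat 2 2 \<and> Mp \<in> carrier_mat 2 2 \<and> Mm \<in> carrier_mat 2 2 \<and> Mo \<in> carrier_mat 2 2 \<and>
     (\<forall>l \<in> {1..slots m}. Mop m l u = 1\<^sub>m (dimH m) + amp m 0 Mpm * DLambda m l +
        amp m 0 Mp * DAs m l + amp m 0 Mm * DA m l + amp m 0 Mo * Dt m l)"
      by (auto simp: eqv)
  next
    fix w assume w: "case w of (Mpm, Mp, Mm, Mo) \<Rightarrow>
      Mpm \<in> carrier_mat 2 2 \<and> Mp \<in> carrier_mat 2 2 \<and> Mm \<in> carrier_mat 2 2 \<and> Mo \<in> carrier_mat 2 2 \<and>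
     (\<forall>l \<in> {1..slots m}. Mop m l u = 1\<^sub>m (dimH m) + amp m 0 Mpm * DLambda m l +
        amp m 0 Mp * DAs m l + amp m 0 Mm * DA m l + amp m 0 Mo * Dt m l)"
    obtain W X Y Z where wd: "w = (W, X, Y, Z)" by (cases w)
    have C: "W \<in> carrier_mat 2 2" "X \<in> carrier_mat 2 2" "Y \<in> carrier_mat 2 2" "Z \<in> carrier_mat 2 2"
      and eq: "\<forall>l \<in> {1..slots m}. Mop m l u = 1\<^sub>m (dimH m) + amp m 0 W * DLambda m l +
        amp m 0 X * DAs m l + amp m 0 Y * DA m l + amp m 0 Z * Dt m l"
      using w wd by auto
    \<comment> \<open>Uniqueness needs only one slot; slot 1 exists because there is at least one
      time step.\<close>
    have l: "0 < (1::nat)" "1 \<le> slots m" using slots_pos by auto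
    have "tens4 m 1 (blk B) = tens4 m 1 (\<lambda>a b. blk (1\<^sub>m 4) a b + noise_blocks m W X Y Z a b)"
      using eq eqv[OF l C] l by auto
    note blocks = tens4_inj[OF l _ _ this]
    have b: "blk B a b = blk (1\<^sub>m 4) a b + noise_blocks m W X Y Z a b" if "a < 2" "b < 2" for a b
      using C by (intro blocks that) auto
    have b00: "blk B 0 0 = 1\<^sub>m 2 + (W + c\<^sup>2 \<cdot>\<^sub>m Z)" and b01: "blk B 0 1 = 0\<^sub>m 2 2 + c \<cdot>\<^sub>m X"
      and b10: "blk B 1 0 = 0\<^sub>m 2 2 + c \<cdot>\<^sub>m Y" and b11: "blk B 1 1 = 1\<^sub>m 2 + c\<^sup>2 \<cdot>\<^sub>m Z"
      by (simp_all add: b[of 0 0] b[of 0 1] b[of 1 0] b[of 1 1] b[of 0 "Suc 0"] b[of "Suc 0" 0] b[of "Suc 0" "Suc 0"]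
        blk_one noise_blocks_def c_def)
    show "w = (blk B 0 0 + (- 1) \<cdot>\<^sub>m blk B 1 1, (1 / c) \<cdot>\<^sub>m blk B 0 1, (1 / c) \<cdot>\<^sub>m blk B 1 0,
      (1 / c\<^sup>2) \<cdot>\<^sub>m (blk B 1 1 + (- 1) \<cdot>\<^sub>m 1\<^sub>m 2))"
      unfolding wd b00 b01 b10 b11 prod.inject using C c0
      by (intro conjI; intro eq_matI; auto)
  qed
qed

lemma Mplus_eq: "Mplus m u = (1 / complex_of_real (lam m)) \<cdot>\<^sub>m blk (step_unitary m u) 0 1"
  and Mcirc_eq: "Mcirc m u = (1 / (complex_of_real (lam m))\<^sup>2) \<cdot>\<^sub>m (blk (step_unitary m u) 1 1 + (- 1) \<cdot>\<^sub>m 1\<^sub>m 2)"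
  by (simp_all add: Mplus_def Mcirc_def Mcoeffs_eq)

lemma M_carrier [simp]: "Mplus m u \<in> carrier_mat 2 2" "Mcirc m u \<in> carrier_mat 2 2"
  "dim_row (Mplus m u) = 2" "dim_col (Mplus m u) = 2" "dim_row (Mcirc m u) = 2" "dim_col (Mcirc m u) = 2"
  by (simp_all add: Mplus_eq Mcirc_eq)

lemma kraus_carrier [simp]: "kraus m u y \<in> carrier_mat 2 2" "dim_row (kraus m u y) = 2" "dim_col (kraus m u y) = 2"
  by (simp_all add: kraus_def)

text \<open>A vacuum input selects the second block column of the step unitary. Pairing it with the
  vector (y / \<lambda>, 1), for y = \<plusminus>\<lambda> an eigenvector of the field observable,
  gives \<open>kraus\<close>.\<close>

lemma kraus_blk: "kraus m u y = blk (step_unitary m u) 1 1 +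
    complex_of_real (y / lam m) \<cdot>\<^sub>m blk (step_unitary m u) 0 1"
  unfolding kraus_def Mplus_eq Mcirc_eq using lam_pos
  by (intro eq_matI) auto

end

end

section \<open>Observables along a path of outcomes\<close>

definition comm :: "complex mat \<Rightarrow> complex mat \<Rightarrow> bool" where
  "comm A B \<longleftrightarrow> A * B = B * A"

lemma comm_sym: "comm A B \<Longrightarrow> comm B A"
  by (simp add: comm_def)

lemma comm_mult:
  assumes "A \<in> carrier_mat n n" "B \<in> carrier_mat n n" "C \<in> carrier_mat n n" "comm A B" "comm A C"
  shows "comm A (B * C)"
proof -
  note d = assms(1-3)[THEN carrier_matD(1)] assms(1-3)[THEN carrier_matD(2)]
  have "A * (B * C) = A * B * C" using d by (simp add: mult_assoc_dim)
  also have "A * B = B * A" using assms(4) by (simp add: comm_def)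
  also have "B * A * C = B * (A * C)" using d by (simp add: mult_assoc_dim)
  also have "A * C = C * A" using assms(5) by (simp add: comm_def)
  also have "B * (C * A) = B * C * A" using d by (simp add: mult_assoc_dim)
  finally show ?thesis by (simp add: comm_def)
qed

lemma comm_add:
  assumes "A \<in> carrier_mat n n" "B \<in> carrier_mat n n" "C \<in> carrier_mat n n" "comm A B" "comm A C"
  shows "comm A (B + C)"
  using assms by (simp add: comm_def mult_add_distrib_mat[of _ n n] add_mult_distrib_mat[of _ n n])

lemma comm_msum:
  assumes "A \<in> carrier_mat n n" "\<And>x. x \<in> S \<Longrightarrow> F x \<in> carrier_mat n n" "\<And>x. x \<in> S \<Longrightarrow> comm A (F x)"
  shows "comm A (msum n F S)"
  using assms by (auto simp: comm_def msum_mult_left msum_mult_right intro!: msum_cong)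

lemma comm_one: "A \<in> carrier_mat n n \<Longrightarrow> comm A (1\<^sub>m n)"
  by (simp add: comm_def)

lemma comm_adjoint:
  assumes "A \<in> carrier_mat n n" "B \<in> carrier_mat n n" "comm (mat_adjoint A) B"
  shows "comm A (mat_adjoint B)"
proof -
  have "mat_adjoint (mat_adjoint A * B) = mat_adjoint (B * mat_adjoint A)"
    using assms by (simp add: comm_def)
  then show ?thesis using assms by (simp add: mat_adjoint_mult comm_def)
qed

lemma comm_tens:
  assumes "l \<le> slots m" "A \<in> carrier_mat (dimH m) (dimH m)" "X \<in> carrier_mat 2 2" "E \<in> carrier_mat 2 2"
    "comm A (amp m 0 X)" "comm A (amp m l E)"
  shows "comm A (tens m l X E)"
  unfolding tens_def using assms by (intro comm_mult[of _ "dimH m"]) auto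

lemma comm_emb:
  assumes "l \<le> slots m" "A \<in> carrier_mat (dimH m) (dimH m)"
    and c: "\<And>X. X \<in> carrier_mat 2 2 \<Longrightarrow> comm A (amp m 0 X)" "\<And>X. X \<in> carrier_mat 2 2 \<Longrightarrow> comm A (amp m l X)"
  shows "comm A (emb m l B)"
  unfolding emb_def using assms by (intro comm_add[of _ "dimH m"] comm_tens) auto

text \<open>For y = \<plusminus>\<lambda> this is the spectral projector at \<open>y\<close> of the
  observable on one field factor, \<lambda> times the sum of \<open>sigma_plus\<close> and
  \<open>sigma_minus\<close>.\<close>

definition outp :: "homodyne \<Rightarrow> real \<Rightarrow> complex mat" where
  "outp m y = complex_of_real (1 / 2) \<cdot>\<^sub>m (1\<^sub>m 2 + complex_of_real (lam m / y) \<cdot>\<^sub>m (eu 0 1 + eu 1 0))"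

lemma outp_carrier [simp]: "outp m y \<in> carrier_mat 2 2" "dim_row (outp m y) = 2" "dim_col (outp m y) = 2"
  by (simp_all add: outp_def)

definition outcomes :: "homodyne \<Rightarrow> real set" where
  "outcomes m = {lam m, - lam m}"

definition obs_proj :: "homodyne \<Rightarrow> nat \<Rightarrow> real list \<Rightarrow> complex mat" where
  "obs_proj m n ys = joint_eigenproj (dimH m) (map (DZ m) [1..<Suc n]) ys"

lemma paths_0 [simp]: "paths m 0 = {[]}"
  by (auto simp: paths_def)

lemma paths_Suc: "paths m (Suc n) = (\<lambda>(ys, y). ys @ [y]) ` (paths m n \<times> outcomes m)"
proof (intro equalityI subsetI)
  fix zs assume zs: "zs \<in> paths m (Suc n)"
  then have ne: "zs \<noteq> []" by (auto simp: paths_def)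
  then have "set (butlast zs) \<subseteq> set zs" "last zs \<in> set zs" by (auto dest: in_set_butlastD)
  then have "butlast zs \<in> paths m n" "last zs \<in> outcomes m"
    using zs by (auto simp: paths_def outcomes_def)
  then show "zs \<in> (\<lambda>(ys, y). ys @ [y]) ` (paths m n \<times> outcomes m)"
    using ne by (intro image_eqI[of _ _ "(butlast zs, last zs)"]) auto
qed (auto simp: paths_def outcomes_def)

lemma paths_SucE:
  assumes "zs \<in> paths m (Suc n)"
  obtains ys y where "zs = ys @ [y]" "ys \<in> paths m n" "y \<in> outcomes m"
  using assms unfolding paths_Suc by auto

lemma paths_SucI: "ys \<in> paths m n \<Longrightarrow> y \<in> outcomes m \<Longrightarrow> ys @ [y] \<in> paths m (Suc n)"
  unfolding paths_Suc by auto

lemma finite_outcomes [simp]: "finite (outcomes m)"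
  by (simp add: outcomes_def)

lemma finite_paths [simp]: "finite (paths m n)"
  by (induction n) (auto simp: paths_Suc)

lemma sum_paths_Suc:
  "(\<Sum>zs\<in>paths m (Suc n). F zs) = (\<Sum>ys\<in>paths m n. \<Sum>y\<in>outcomes m. F (ys @ [y]))"
  unfolding paths_Suc
  by (subst sum.reindex) (auto simp: inj_on_def sum.cartesian_product split_def)

lemma admissible_control:
  "f \<in> admissible_strategies m \<Longrightarrow> n < slots m \<Longrightarrow> ys \<in> paths m n \<Longrightarrow> f (Suc n) ys \<in> controls m"
  by (auto simp: admissible_strategies_def Ball_def)

lemma joint_eigenproj_snoc:
  assumes "length As = length as" "\<And>A a. (A, a) \<in> set (zip As as) \<Longrightarrow> eigenproj A a \<in> carrier_mat d d"
    and E: "eigenproj A a \<in> carrier_mat d d"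
  shows "joint_eigenproj d (As @ [A]) (as @ [a]) = joint_eigenproj d As as * eigenproj A a"
    and "joint_eigenproj d As as \<in> carrier_mat d d"
proof -
  \<comment> \<open>The start value of the fold is generalised, so that an appended projector can be
    pulled out as a right factor.\<close>
  have "foldr (\<lambda>(A, a) E. eigenproj A a * E) ps F = foldr (\<lambda>(A, a) E. eigenproj A a * E) ps (1\<^sub>m d) * F \<and>
      foldr (\<lambda>(A, a) E. eigenproj A a * E) ps (1\<^sub>m d) \<in> carrier_mat d d"
    if "\<And>A a. (A, a) \<in> set ps \<Longrightarrow> eigenproj A a \<in> carrier_mat d d" "F \<in> carrier_mat d d" for ps F
    using that
  proof (induction ps)
    case (Cons p ps)
    obtain A a where p: "p = (A, a)" by (cases p)
    show ?case using Cons p by (auto simp: assoc_mult_mat[of _ d d])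
  qed auto
  from this[of "zip As as" "eigenproj A a * 1\<^sub>m d"] assms
  show "joint_eigenproj d (As @ [A]) (as @ [a]) = joint_eigenproj d As as * eigenproj A a"
    and "joint_eigenproj d As as \<in> carrier_mat d d"
    by (auto simp: joint_eigenproj_def)
qed

context
  fixes m :: homodyne
  assumes model: "homodyne_model m"
begin

lemma outcomes_nonzero: "y \<in> outcomes m \<Longrightarrow> y \<noteq> 0"
  using lam_pos[OF model] by (auto simp: outcomes_def)

lemma sum_outcomes: "(\<Sum>y\<in>outcomes m. F y) = F (lam m) + F (- lam m)"
  using lam_pos[OF model] by (simp add: outcomes_def)

lemma outp_adjoint: "mat_adjoint (outp m y) = outp m y"
  by (simp add: outp_def mat_adjoint_smult mat_adjoint_add eu_adjoint) (intro eq_matI; simp)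

lemma outp_mult:
  assumes "y \<in> outcomes m" "y' \<in> outcomes m"
  shows "outp m y * outp m y' = (if y = y' then outp m y else 0\<^sub>m 2 2)"
  using assms lam_pos[OF model] unfolding outp_def outcomes_def
  by (intro mat2_eqI)
    (auto simp: index_mult_sum sum_less_2 eu_def simp del: index_mult_mat(1))

lemma outp_sum: "outp m (lam m) + outp m (- lam m) = 1\<^sub>m 2"
  using lam_pos[OF model] unfolding outp_def
  by (intro mat2_eqI) (auto simp: eu_def)

lemma DZ_amp:
  assumes "i \<le> slots m"
  shows "DZ m i = complex_of_real (lam m) \<cdot>\<^sub>m amp m i (eu 0 1 + eu 1 0)"
  unfolding DZ_def DA_def DAs_def sigma_minus_eu sigma_plus_eu using assms
  by (simp add: amp_add smult_add_dim) (intro eq_matI; simp)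

lemma DZ_carrier [simp]: "i \<le> slots m \<Longrightarrow> DZ m i \<in> carrier_mat (dimH m) (dimH m)"
  by (simp add: DZ_amp)

lemma DZ_selfadjoint: "i \<le> slots m \<Longrightarrow> mat_adjoint (DZ m i) = DZ m i"
  by (simp add: DZ_amp mat_adjoint_smult amp_adjoint mat_adjoint_add eu_adjoint amp_add)
    (intro eq_matI; simp)

lemma DZ_square:
  assumes "i \<le> slots m" "y \<in> outcomes m"
  shows "DZ m i * DZ m i = complex_of_real (y\<^sup>2) \<cdot>\<^sub>m 1\<^sub>m (dimH m)"
proof -
  have "(eu 0 1 + eu 1 0) * (eu 0 1 + eu 1 0) = 1\<^sub>m 2"
    by (intro mat2_eqI) (auto simp: index_mult_sum sum_less_2 eu_def simp del: index_mult_mat(1))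
  moreover have "y\<^sup>2 = (lam m)\<^sup>2" using assms(2) by (auto simp: outcomes_def)
  ultimately show ?thesis using assms(1)
    by (simp add: DZ_amp mult_smult_dim smult_mult_dim smult_smult_mat amp_mult amp_one power2_eq_square)
qed

lemma eigenproj_DZ:
  assumes "i \<le> slots m" "y \<in> outcomes m"
  shows "eigenproj (DZ m i) y = amp m i (outp m y)"
proof -
  have "eigenproj (DZ m i) y = complex_of_real (1 / 2) \<cdot>\<^sub>m (1\<^sub>m (dimH m) + complex_of_real (1 / y) \<cdot>\<^sub>m DZ m i)"
    by (rule eigenproj_reflection)
      (use assms in \<open>auto simp: DZ_selfadjoint selfadjoint_def DZ_square outcomes_nonzero\<close>)
  also have "\<dots> = amp m i (outp m y)"
    using assms(1) by (simp add: outp_def amp_smult amp_add DZ_amp smult_smult_mat flip: amp_one[of i m])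
  finally show ?thesis .
qed

lemma obs_proj_0 [simp]: "obs_proj m 0 [] = 1\<^sub>m (dimH m)"
  by (simp add: obs_proj_def joint_eigenproj_def)

lemma obs_proj_carrier_Suc:
  assumes n: "n \<le> slots m" and ys: "ys \<in> paths m n"
  shows "obs_proj m n ys \<in> carrier_mat (dimH m) (dimH m)"
    and "Suc n \<le> slots m \<Longrightarrow> y \<in> outcomes m \<Longrightarrow> obs_proj m (Suc n) (ys @ [y]) = obs_proj m n ys * amp m (Suc n) (outp m y)"
proof -
  have len: "length (map (DZ m) [1..<Suc n]) = length ys" using ys by (simp add: paths_def)
  have car: "eigenproj A a \<in> carrier_mat (dimH m) (dimH m)" if Aa: "(A, a) \<in> set (zip (map (DZ m) [1..<Suc n]) ys)" for A a
  proof -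
    obtain i where i: "i \<in> set [1..<Suc n]" "A = DZ m i" using set_zip_leftD[OF Aa] by auto
    then have "i \<le> slots m" using n by auto
    moreover have "a \<in> outcomes m"
      using set_zip_rightD[OF Aa] ys by (auto simp: paths_def outcomes_def)
    ultimately show ?thesis using i(2) by (simp add: eigenproj_DZ)
  qed
  have "eigenproj (DZ m 0) (lam m) \<in> carrier_mat (dimH m) (dimH m)"
    by (subst eigenproj_DZ) (auto simp: outcomes_def)
  from joint_eigenproj_snoc(2)[OF len car this]
  show "obs_proj m n ys \<in> carrier_mat (dimH m) (dimH m)" by (simp add: obs_proj_def)
  assume sn: "Suc n \<le> slots m" "y \<in> outcomes m"
  then have "eigenproj (DZ m (Suc n)) y \<in> carrier_mat (dimH m) (dimH m)" by (simp add: eigenproj_DZ)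
  from joint_eigenproj_snoc(1)[OF len car this] sn
  show "obs_proj m (Suc n) (ys @ [y]) = obs_proj m n ys * amp m (Suc n) (outp m y)"
    by (simp add: obs_proj_def eigenproj_DZ)
qed

lemmas obs_proj_carrier [simp] = obs_proj_carrier_Suc(1)
lemma obs_proj_dim [simp]:
  "n \<le> slots m \<Longrightarrow> ys \<in> paths m n \<Longrightarrow> dim_row (obs_proj m n ys) = dimH m"
  "n \<le> slots m \<Longrightarrow> ys \<in> paths m n \<Longrightarrow> dim_col (obs_proj m n ys) = dimH m"
  using obs_proj_carrier by blast+

lemmas obs_proj_Suc = obs_proj_carrier_Suc(2)

text \<open>The projectors in \<open>obs_proj\<close> sit on the factors 1 to \<open>n\<close>, so
  the system and later factors are not touched; on a shared factor the outcome projectors commute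
  with each other.\<close>

lemma obs_proj_comm:
  assumes n: "n \<le> slots m" and ys: "ys \<in> paths m n" and j: "j \<le> slots m" and X: "X \<in> carrier_mat 2 2"
    and c: "j = 0 \<or> n < j \<or> (\<exists>y\<in>outcomes m. X = outp m y)"
  shows "comm (amp m j X) (obs_proj m n ys)"
  using n ys c
proof (induction n arbitrary: ys)
  case 0
  then show ?case using j X by (auto intro!: comm_one)
next
  case (Suc n)
  obtain zs y where zs: "ys = zs @ [y]" "zs \<in> paths m n" "y \<in> outcomes m"
    using Suc.prems(2) by (rule paths_SucE)
  have "comm (amp m j X) (amp m (Suc n) (outp m y))"
  proof (cases "j = Suc n")
    case True
    then obtain y' where y': "y' \<in> outcomes m" "X = outp m y'" using Suc.prems(3) by auto
    then have "X * outp m y = outp m y * X" using outp_mult zs(3) by auto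
    then show ?thesis using True X by (simp add: comm_def amp_mult)
  next
    case False
    then show ?thesis using j X Suc.prems(1) by (auto simp: comm_def intro!: amp_commute)
  qed
  moreover have "comm (amp m j X) (obs_proj m n zs)"
    using Suc.prems zs by (intro Suc.IH) auto
  ultimately show ?case
    using Suc.prems(1) zs j X by (auto simp: obs_proj_Suc intro!: comm_mult[of _ "dimH m"])
qed

lemma obs_proj_adjoint:
  assumes "n \<le> slots m" "ys \<in> paths m n"
  shows "mat_adjoint (obs_proj m n ys) = obs_proj m n ys"
  using assms
proof (induction n arbitrary: ys)
  case (Suc n)
  obtain zs y where zs: "ys = zs @ [y]" "zs \<in> paths m n" "y \<in> outcomes m"
    using Suc.prems(2) by (rule paths_SucE)
  have "comm (amp m (Suc n) (outp m y)) (obs_proj m n zs)"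
    using Suc.prems(1) zs by (intro obs_proj_comm) auto
  moreover have "obs_proj m n zs \<in> carrier_mat (dimH m) (dimH m)" using Suc.prems(1) zs by simp
  ultimately show ?case
    using Suc zs by (simp add: obs_proj_Suc mat_adjoint_mult amp_adjoint outp_adjoint comm_def)
qed simp

lemma obs_proj_orth:
  assumes "n \<le> slots m" "ys \<in> paths m n" "zs \<in> paths m n"
  shows "obs_proj m n ys * obs_proj m n zs = (if ys = zs then obs_proj m n ys else 0\<^sub>m (dimH m) (dimH m))"
  using assms
proof (induction n arbitrary: ys zs)
  case (Suc n)
  obtain ys' y where ys: "ys = ys' @ [y]" "ys' \<in> paths m n" "y \<in> outcomes m"
    using Suc.prems(2) by (rule paths_SucE)
  obtain zs' z where zs: "zs = zs' @ [z]" "zs' \<in> paths m n" "z \<in> outcomes m"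
    using Suc.prems(3) by (rule paths_SucE)
  let ?P = "obs_proj m n ys'" and ?Q = "obs_proj m n zs'"
    and ?E = "amp m (Suc n) (outp m y)" and ?F = "amp m (Suc n) (outp m z)"
  have c: "?P \<in> carrier_mat (dimH m) (dimH m)" "?Q \<in> carrier_mat (dimH m) (dimH m)"
    "?E \<in> carrier_mat (dimH m) (dimH m)" "?F \<in> carrier_mat (dimH m) (dimH m)"
    using Suc.prems(1) ys zs by auto
  note dc = c[THEN carrier_matD(1)] c[THEN carrier_matD(2)]
  have "comm ?E ?Q" using Suc.prems(1) zs by (intro obs_proj_comm) auto
  have "?P * ?E * (?Q * ?F) = ?P * (?E * ?Q * ?F)" using dc by (simp add: mult_assoc_dim)
  also have "?E * ?Q = ?Q * ?E" using \<open>comm ?E ?Q\<close> by (simp add: comm_def)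
  also have "?P * (?Q * ?E * ?F) = ?P * ?Q * (?E * ?F)" using dc by (simp add: mult_assoc_dim)
  also have "?E * ?F = (if y = z then ?E else 0\<^sub>m (dimH m) (dimH m))"
    using ys zs Suc.prems(1) by (simp add: amp_mult outp_mult amp_zero)
  also have "?P * ?Q = (if ys' = zs' then ?P else 0\<^sub>m (dimH m) (dimH m))"
    using Suc.prems(1) ys zs by (intro Suc.IH) auto
  finally show ?case using Suc.prems(1) ys zs c
    by (auto simp: obs_proj_Suc left_mult_zero_mat[of _ "dimH m"] right_mult_zero_mat[of _ "dimH m"])
qed simp

lemma obs_proj_sum:
  assumes "n \<le> slots m"
  shows "msum (dimH m) (obs_proj m n) (paths m n) = 1\<^sub>m (dimH m)"
  using assms
proof (induction n)
  case 0
  then show ?case by (intro eq_matI) (auto simp: msum_index)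
next
  case (Suc n)
  let ?E = "\<lambda>y. amp m (Suc n) (outp m y)"
  have one: "?E (lam m) + ?E (- lam m) = 1\<^sub>m (dimH m)"
    using Suc.prems by (simp add: outp_sum amp_one flip: amp_add)
  have "msum (dimH m) (obs_proj m (Suc n)) (paths m (Suc n)) = msum (dimH m) (obs_proj m n) (paths m n)"
  proof (rule eq_matI)
    fix i j assume "i < dim_row (msum (dimH m) (obs_proj m n) (paths m n))"
      "j < dim_col (msum (dimH m) (obs_proj m n) (paths m n))"
    then have ij: "i < dimH m" "j < dimH m" by auto
    have "(\<Sum>y\<in>outcomes m. obs_proj m (Suc n) (ys @ [y]) $$ (i, j)) = obs_proj m n ys $$ (i, j)"
      if "ys \<in> paths m n" for ys
    proof -
      have c: "obs_proj m n ys \<in> carrier_mat (dimH m) (dimH m)" using that Suc.prems by simp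
      have "(\<Sum>y\<in>outcomes m. obs_proj m (Suc n) (ys @ [y]) $$ (i, j)) =
          (\<Sum>y\<in>outcomes m. (obs_proj m n ys * ?E y) $$ (i, j))"
        using that Suc.prems by (intro sum.cong) (auto simp: obs_proj_Suc)
      also have "\<dots> = (obs_proj m n ys * ?E (lam m) + obs_proj m n ys * ?E (- lam m)) $$ (i, j)"
        using ij that Suc.prems by (simp add: sum_outcomes del: index_mult_mat(1))
      also have "\<dots> = obs_proj m n ys $$ (i, j)"
        using c one Suc.prems mult_add_dim[of "obs_proj m n ys" "?E (lam m)" "?E (- lam m)"] by simp
      finally show ?thesis .
    qed
    then show "msum (dimH m) (obs_proj m (Suc n)) (paths m (Suc n)) $$ (i, j) =
        msum (dimH m) (obs_proj m n) (paths m n) $$ (i, j)"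
      using ij by (simp add: msum_index sum_paths_Suc)
  qed auto
  then show ?case using Suc by simp
qed

text \<open>Outcome paths index a resolution of the identity that diagonalises the control operator.
  It may be finer than the eigenspaces, since several paths can give the same control.\<close>

lemma at_control_op:
  assumes n: "n \<le> slots m" and F: "\<And>ys. ys \<in> paths m n \<Longrightarrow> F (f (Suc n) ys) \<in> carrier_mat (dimH m) (dimH m)"
  shows "at_operator F (control_op m f (Suc n)) =
    msum (dimH m) (\<lambda>ys. F (f (Suc n) ys) * obs_proj m n ys) (paths m n)"
proof -
  have "control_op m f (Suc n) =
      msum (dimH m) (\<lambda>ys. complex_of_real (f (Suc n) ys) \<cdot>\<^sub>m obs_proj m n ys) (paths m n)"
    by (simp add: control_op_def obs_proj_def)
  then show ?thesis
    using at_operator_resolution[OF finite_paths, of m n "obs_proj m n" "dimH m" F "f (Suc n)"] n F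
    by (simp add: obs_proj_adjoint selfadjoint_def obs_proj_orth obs_proj_sum)
qed

end

section \<open>The quantum filter\<close>

definition vac_state :: "homodyne \<Rightarrow> complex mat" where
  "vac_state m = kron (init m) (kron_pow vacuum_proj (slots m))"

definition step_op :: "homodyne \<Rightarrow> strategy \<Rightarrow> nat \<Rightarrow> complex mat" where
  "step_op m f n = at_operator (Mop m (Suc n)) (control_op m f (Suc n))"

lemma Uop_Suc: "Uop m f (Suc n) = step_op m f n * Uop m f n"
  by (simp add: step_op_def)

declare Uop.simps(2) [simp del]

text \<open>Commutation lets \<open>v\<close> travel inwards from both ends until it meets
  \<open>N\<close>. The intended \<open>v\<close> is the vacuum projector of the next field factor,
  with the past evolution around it.\<close>

lemma sandwich:
  assumes c: "v \<in> carrier_mat n n" "A \<in> carrier_mat n n" "P \<in> carrier_mat n n" "N \<in> carrier_mat n n" "B \<in> carrier_mat n n"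
    and cm: "comm v A" "comm v P" "comm v B"
  shows "v * (A * (P * N * P) * B) * v = A * (P * (v * N * v) * P) * B"
proof -
  note d = c[THEN carrier_matD(1)] c[THEN carrier_matD(2)]
  have move: "v * (Y * Z) = Y * (v * Z)" if "comm v Y" "Y \<in> carrier_mat n n" "Z \<in> carrier_mat n n" for Y Z
  proof -
    have "v * (Y * Z) = v * Y * Z" using that d by (simp add: mult_assoc_dim)
    also have "v * Y = Y * v" using that by (simp add: comm_def)
    also have "Y * v * Z = Y * (v * Z)" using that d by (simp add: mult_assoc_dim)
    finally show ?thesis .
  qed
  have "v * (A * (P * N * P) * B) * v = v * (A * (P * (N * (P * (B * v)))))"
    using d by (simp add: mult_assoc_dim)
  also have "\<dots> = A * (v * (P * (N * (P * (B * v)))))" using c cm by (intro move) auto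
  also have "v * (P * (N * (P * (B * v)))) = P * (v * (N * (P * (B * v))))" using c cm by (intro move) auto
  also have "B * v = v * B" using cm by (simp add: comm_def)
  also have "P * (v * B) = v * (P * B)" using c cm by (intro move[symmetric]) auto
  also have "A * (P * (v * (N * (v * (P * B))))) = A * (P * (v * N * v) * P) * B"
    using d by (simp add: mult_assoc_dim)
  finally show ?thesis .
qed

text \<open>Used in both directions: by cyclicity of the trace, a state that absorbs
  \<open>v\<close> cannot tell an operator from its compression.\<close>

lemma tr_compress:
  assumes c: "R \<in> carrier_mat n n" "v \<in> carrier_mat n n" "A \<in> carrier_mat n n"
    and R: "R * v = R" "v * R = R"
  shows "tr (R * (v * A * v)) = tr (R * A)"
proof -
  note d = c[THEN carrier_matD(1)] c[THEN carrier_matD(2)]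
  have "R * (v * A * v) = R * v * A * v" using d by (simp add: mult_assoc_dim)
  also have "\<dots> = (R * A) * v" by (simp add: R)
  finally have "tr (R * (v * A * v)) = tr ((R * A) * v)" by simp
  also have "\<dots> = tr (v * (R * A))" using d by (intro tr_mult_commute) auto
  also have "v * (R * A) = v * R * A" using d by (simp add: mult_assoc_dim)
  finally show ?thesis by (simp add: R)
qed

text \<open>The unnormalised conditional state, whose trace is the probability of the outcomes so far.\<close>

primrec tau :: "homodyne \<Rightarrow> strategy \<Rightarrow> nat \<Rightarrow> real list \<Rightarrow> complex mat" where
  "tau m f 0 ys = init m"
| "tau m f (Suc l) ys = complex_of_real (1 / 2) \<cdot>\<^sub>m
     (kraus m (f (Suc l) (take l ys)) (ys ! l) * tau m f l ys * mat_adjoint (kraus m (f (Suc l) (take l ys)) (ys ! l)))"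

lemma tau_take: "l \<le> n \<Longrightarrow> tau m f l (take n ys) = tau m f l ys"
  by (induction l) (auto simp: min_def)

lemma tau_append: "length ys = l \<Longrightarrow> tau m f l (ys @ zs) = tau m f l ys"
  using tau_take[of l l m f "ys @ zs"] by simp

context
  fixes m :: homodyne
  assumes model: "homodyne_model m"
begin

lemmas [simp] = obs_proj_carrier[OF model] obs_proj_dim[OF model]

lemma init_carrier [simp]: "init m \<in> carrier_mat 2 2" "dim_row (init m) = 2" "dim_col (init m) = 2"
  using model by (auto simp: homodyne_model_def density_matrices_def)

lemma vac_state_carrier [simp]: "vac_state m \<in> carrier_mat (dimH m) (dimH m)"
  by (intro carrier_matI) (auto simp: vac_state_def dimH_def vacuum_proj_eu)

lemma vac_state_split:
  assumes "0 < l" "l \<le> slots m"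
  shows "vac_state m = kron (kron (kron (init m) (kron_pow vacuum_proj (l - 1))) vacuum_proj)
    (kron_pow vacuum_proj (slots m - l))"
proof -
  have k: "slots m = (l - 1) + Suc (slots m - l)" using assms by simp
  have "kron_pow vacuum_proj (slots m) =
      kron (kron_pow vacuum_proj (l - 1)) (kron vacuum_proj (kron_pow vacuum_proj (slots m - l)))"
    by (subst k) (simp only: kron_pow_add kron_pow.simps)
  then show ?thesis by (simp add: vac_state_def kron_assoc)
qed

lemma vac_state_absorb:
  assumes l: "0 < l" "l \<le> slots m"
  shows "vac_state m * amp m l (eu 1 1) = vac_state m" "amp m l (eu 1 1) * vac_state m = vac_state m"
proof -
  obtain j where j: "l = Suc j" using l by (cases l) auto
  have vp: "eu 1 1 * eu 1 1 = eu 1 1" by (simp add: eu_mult)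
  show "vac_state m * amp m l (eu 1 1) = vac_state m"
    unfolding vac_state_split[OF l] amp_def using vp
    by (simp add: kron_mult vacuum_proj_eu one_mult_dim j)
  show "amp m l (eu 1 1) * vac_state m = vac_state m"
    unfolding vac_state_split[OF l] amp_def using vp
    by (simp add: kron_mult vacuum_proj_eu one_mult_dim j)
qed

lemma tr_vac_state:
  assumes "X \<in> carrier_mat 2 2"
  shows "tr (vac_state m * amp m 0 X) = tr (init m * X)"
proof -
  have "tr vacuum_proj = 1" by (simp add: vacuum_proj_eu tr_def sum_less_2 eu_def)
  moreover have "vac_state m * amp m 0 X = kron (init m * X) (kron_pow vacuum_proj (slots m))"
    using assms unfolding vac_state_def amp_def
    by (simp add: kron_mult one_mult_dim vacuum_proj_eu flip: One_nat_def)
  ultimately show ?thesis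
    using assms by (simp add: tr_kron tr_kron_pow vacuum_proj_eu)
qed

lemma tau_carrier:
  assumes "f \<in> admissible_strategies m" "ys \<in> paths m n" "n \<le> slots m" "l \<le> n"
  shows "tau m f l ys \<in> carrier_mat 2 2"
  using assms(4)
proof (induction l)
  case (Suc l)
  have "take l ys \<in> paths m l"
    using assms(2) Suc.prems by (auto simp: paths_def dest: in_set_takeD)
  then have "f (Suc l) (take l ys) \<in> controls m"
    using assms(1,3) Suc.prems by (auto simp: admissible_strategies_def Ball_def)
  then show ?case using Suc by (auto simp: kraus_carrier[OF model])
qed simp

text \<open>The one-step computation behind the filter. Between vacuum projectors only the blocks
  fed by the vacuum survive, and the outcome projector combines them into a single conjugation by
  \<open>K\<close>; the field part returns to the vacuum, which makes the step repeatable.\<close>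

lemma compress_step:
  assumes l: "0 < l" "l \<le> slots m" and u: "u \<in> controls m" and y: "y \<in> outcomes m" and X: "X \<in> carrier_mat 2 2"
  defines "K \<equiv> kraus m u y"
  shows "amp m l (eu 1 1) * (mat_adjoint (Mop m l u) * (amp m 0 X * amp m l (outp m y)) * Mop m l u) * amp m l (eu 1 1) =
    tens m l (complex_of_real (1 / 2) \<cdot>\<^sub>m (mat_adjoint K * X * K)) (eu 1 1)"
proof -
  let ?Bx = "blk (step_unitary m u) 0 1" and ?By = "blk (step_unitary m u) 1 1" and ?O = "outp m y"
  let ?Ax = "mat_adjoint ?Bx" and ?Ay = "mat_adjoint ?By" and ?v = "amp m l (eu 1 1)"
  let ?M = "Mop m l u"
  \<comment> \<open>The ratio is a sign and so equals its inverse: \<open>outp\<close> contains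
    \<lambda> / y, whereas \<open>kraus_blk\<close> contains y / \<lambda>.\<close>
  define s where "s = complex_of_real (lam m / y)"
  have s: "complex_of_real (y / lam m) = s" "cnj s = s" "s * s = 1"
    using y lam_pos[OF model] by (auto simp: s_def outcomes_def)
  have M: "?M \<in> carrier_mat (dimH m) (dimH m)" using Mop_carrier[OF model u l] .
  have v: "?v = tens m l (1\<^sub>m 2) (eu 1 1)" using l by (simp add: tens_one)
  have Mv: "?M * ?v = tens m l ?Bx (eu 0 1) + tens m l ?By (eu 1 1)"
    unfolding Mop_emb[OF model u l] emb_def v using l
    by (simp add: add_mult_dim tens_mult eu_mult tens_zero one_mult_dim)
  have vM: "?v * mat_adjoint ?M = tens m l ?Ax (eu 1 0) + tens m l ?Ay (eu 1 1)"
  proof -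
    have "?v * mat_adjoint ?M = mat_adjoint (?M * ?v)"
      using M l by (simp add: mat_adjoint_mult amp_adjoint eu_adjoint)
    then show ?thesis unfolding Mv using l
      by (simp add: mat_adjoint_add tens_adjoint eu_adjoint)
  qed
  have O: "eu 1 a * (?O * eu b 1) = (?O $$ (a, b)) \<cdot>\<^sub>m eu 1 1" if "a < 2" "b < 2" for a b
    using that by (intro mat2_eqI) (auto simp: index_mult_sum sum_less_2 eu_def less_2_iff simp del: index_mult_mat(1))
  have Ov: "?O $$ (0, 0) = 1 / 2" "?O $$ (0, 1) = s / 2" "?O $$ (1, 0) = s / 2" "?O $$ (1, 1) = 1 / 2"
    by (simp_all add: outp_def eu_def s_def)
  have "?v * (mat_adjoint ?M * (amp m 0 X * amp m l ?O) * ?M) * ?v =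
      (?v * mat_adjoint ?M) * (tens m l X ?O * (?M * ?v))"
    using M l X by (simp add: mult_assoc_dim tens_def)
  also have "\<dots> = tens m l (?Ax * (X * ?Bx)) (eu 1 0 * (?O * eu 0 1)) + tens m l (?Ax * (X * ?By)) (eu 1 0 * (?O * eu 1 1)) +
      (tens m l (?Ay * (X * ?Bx)) (eu 1 1 * (?O * eu 0 1)) + tens m l (?Ay * (X * ?By)) (eu 1 1 * (?O * eu 1 1)))"
    unfolding Mv vM using l X
    by (simp add: mult_add_dim add_mult_dim tens_mult) (intro eq_matI; simp)
  also have "\<dots> = tens m l ((1 / 2) \<cdot>\<^sub>m (?Ax * (X * ?Bx)) + (s / 2) \<cdot>\<^sub>m (?Ax * (X * ?By)) +
      ((s / 2) \<cdot>\<^sub>m (?Ay * (X * ?Bx)) + (1 / 2) \<cdot>\<^sub>m (?Ay * (X * ?By)))) (eu 1 1)"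
    using l X by (simp add: O[unfolded One_nat_def] Ov[unfolded One_nat_def] tens_add_left tens_smult)
  \<comment> \<open>As s^2 = 1, the weights 1 / 2 on the pure terms and s / 2 on the mixed terms
    factor as a product.\<close>
  also have "(1 / 2) \<cdot>\<^sub>m (?Ax * (X * ?Bx)) + (s / 2) \<cdot>\<^sub>m (?Ax * (X * ?By)) +
      ((s / 2) \<cdot>\<^sub>m (?Ay * (X * ?Bx)) + (1 / 2) \<cdot>\<^sub>m (?Ay * (X * ?By))) =
      complex_of_real (1 / 2) \<cdot>\<^sub>m (mat_adjoint K * X * K)"
  proof -
    have K: "K = ?By + s \<cdot>\<^sub>m ?Bx" "mat_adjoint K = ?Ay + s \<cdot>\<^sub>m ?Ax"
      unfolding K_def kraus_blk[OF model u] s by (simp_all add: mat_adjoint_add mat_adjoint_smult s)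
    have dX: "dim_row X = 2" "dim_col X = 2" using X by auto
    show ?thesis unfolding K(2) unfolding K(1) using X dX
      by (simp add: mult_add_dim add_mult_dim mult_smult_dim smult_mult_dim smult_smult_mat smult_add_dim s(3) mult_assoc_dim)
        (intro eq_matI; simp del: index_mult_mat(1))
  qed
  finally show ?thesis .
qed

text \<open>The mixed terms cancel between the two outcomes. What remains is twice the vacuum block
  of the unitarity relation of the step.\<close>

lemma kraus_complete:
  assumes u: "u \<in> controls m"
  shows "mat_adjoint (kraus m u (lam m)) * kraus m u (lam m) +
     mat_adjoint (kraus m u (- lam m)) * kraus m u (- lam m) = 2 \<cdot>\<^sub>m 1\<^sub>m 2"
proof -
  let ?B = "step_unitary m u"
  let ?Bx = "blk ?B 0 1" and ?By = "blk ?B 1 1"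
  let ?Ax = "mat_adjoint ?Bx" and ?Ay = "mat_adjoint ?By"
  have "blk (mat_adjoint ?B * ?B) 1 1 = 1\<^sub>m 2" unfolding step_unitary[OF model u] by (simp add: blk_one)
  then have one: "?Ax * ?Bx + ?Ay * ?By = 1\<^sub>m 2"
    by (simp add: blk_mult blk_adjoint)
  have l0: "lam m \<noteq> 0" using lam_pos[OF model] by simp
  have K: "kraus m u (lam m) = ?By + ?Bx" "kraus m u (- lam m) = ?By + (- 1) \<cdot>\<^sub>m ?Bx"
    unfolding kraus_blk[OF model u] using l0 by simp_all
  have "mat_adjoint (kraus m u (lam m)) * kraus m u (lam m) +
     mat_adjoint (kraus m u (- lam m)) * kraus m u (- lam m) = 2 \<cdot>\<^sub>m (?Ax * ?Bx + ?Ay * ?By)"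
    unfolding K
    by (simp add: mat_adjoint_add mat_adjoint_smult mult_add_dim add_mult_dim mult_smult_dim smult_mult_dim smult_smult_mat)
      (intro eq_matI; simp del: index_mult_mat(1))
  then show ?thesis by (simp only: one)
qed

end

context
  fixes m :: homodyne and f :: strategy
  assumes model: "homodyne_model m" and adm: "f \<in> admissible_strategies m"
begin

abbreviation (input) op_space where "op_space \<equiv> carrier_mat (dimH m) (dimH m)"

lemmas obs_proj_simps [simp] = obs_proj_carrier[OF model] obs_proj_dim[OF model]

abbreviation (input) step_at where "step_at n ys \<equiv> Mop m (Suc n) (f (Suc n) ys)"

lemma step_at_carrier [simp]: "n < slots m \<Longrightarrow> ys \<in> paths m n \<Longrightarrow> step_at n ys \<in> op_space"
  using Mop_carrier[OF model admissible_control[OF adm]] by simp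

lemma step_at_dim [simp]:
  "n < slots m \<Longrightarrow> ys \<in> paths m n \<Longrightarrow> dim_row (step_at n ys) = dimH m"
  "n < slots m \<Longrightarrow> ys \<in> paths m n \<Longrightarrow> dim_col (step_at n ys) = dimH m"
  using step_at_carrier by blast+

lemma comm_step_at:
  assumes "n < slots m" "ys \<in> paths m n" "A \<in> op_space"
    "\<And>X. X \<in> carrier_mat 2 2 \<Longrightarrow> comm A (amp m 0 X)" "\<And>X. X \<in> carrier_mat 2 2 \<Longrightarrow> comm A (amp m (Suc n) X)"
  shows "comm A (step_at n ys)"
proof -
  have "step_at n ys = emb m (Suc n) (step_unitary m (f (Suc n) ys))"
    using assms by (intro Mop_emb[OF model admissible_control[OF adm]]) auto
  then show ?thesis using assms by (auto intro!: comm_emb)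
qed

lemma step_at_obs_proj:
  assumes "n < slots m" "ys \<in> paths m n" "zs \<in> paths m n"
  shows "obs_proj m n zs * step_at n ys = step_at n ys * obs_proj m n zs"
proof -
  have "comm (obs_proj m n zs) (step_at n ys)"
    using assms by (intro comm_step_at) (auto intro!: comm_sym[OF obs_proj_comm[OF model]])
  then show ?thesis by (simp add: comm_def)
qed

lemma step_op_msum:
  assumes n: "n < slots m"
  shows "step_op m f n = msum (dimH m) (\<lambda>ys. step_at n ys * obs_proj m n ys) (paths m n)"
  unfolding step_op_def using n by (intro at_control_op[OF model]) auto

lemma step_op_carrier [simp]:
  "n < slots m \<Longrightarrow> step_op m f n \<in> op_space" "n < slots m \<Longrightarrow> dim_row (step_op m f n) = dimH m"
  "n < slots m \<Longrightarrow> dim_col (step_op m f n) = dimH m"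
  by (simp_all add: step_op_msum)

text \<open>Once the past outcomes are fixed, the control is a number: orthogonality removes all
  other paths, and the step acts as an ordinary \<open>Mop\<close>.\<close>

lemma step_op_obs_proj:
  assumes n: "n < slots m" and ys: "ys \<in> paths m n"
  shows "step_op m f n * obs_proj m n ys = step_at n ys * obs_proj m n ys"
    and "obs_proj m n ys * step_op m f n = step_at n ys * obs_proj m n ys"
proof -
  let ?P = "obs_proj m n"
  have orth: "?P zs * ?P ys = (if zs = ys then ?P ys else 0\<^sub>m (dimH m) (dimH m))"
    "?P ys * ?P zs = (if zs = ys then ?P ys else 0\<^sub>m (dimH m) (dimH m))" if "zs \<in> paths m n" for zs
    using obs_proj_orth[OF model, of n] n ys that by auto
  have c: "step_at n zs * ?P zs * ?P ys = (if zs = ys then step_at n ys * ?P ys else 0\<^sub>m (dimH m) (dimH m))"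
    "?P ys * (step_at n zs * ?P zs) = (if zs = ys then step_at n ys * ?P ys else 0\<^sub>m (dimH m) (dimH m))"
    if zs: "zs \<in> paths m n" for zs
  proof -
    have "step_at n zs * ?P zs * ?P ys = step_at n zs * (?P zs * ?P ys)"
      using n ys zs by (simp add: mult_assoc_dim)
    then show 1: "step_at n zs * ?P zs * ?P ys = (if zs = ys then step_at n ys * ?P ys else 0\<^sub>m (dimH m) (dimH m))"
      using orth(1)[OF zs] right_mult_zero_mat[OF step_at_carrier[OF n zs]] by auto
    have "?P ys * (step_at n zs * ?P zs) = (?P ys * step_at n zs) * ?P zs"
      using n ys zs by (simp add: mult_assoc_dim)
    also have "\<dots> = step_at n zs * (?P ys * ?P zs)"
      using n ys zs by (simp add: step_at_obs_proj mult_assoc_dim)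
    finally show "?P ys * (step_at n zs * ?P zs) = (if zs = ys then step_at n ys * ?P ys else 0\<^sub>m (dimH m) (dimH m))"
      using orth(2)[OF zs] right_mult_zero_mat[OF step_at_carrier[OF n zs]] by auto
  qed
  have MP: "step_at n zs * ?P zs \<in> op_space" if "zs \<in> paths m n" for zs using that n by simp
  have "step_op m f n * ?P ys = msum (dimH m) (\<lambda>zs. step_at n zs * ?P zs * ?P ys) (paths m n)"
    unfolding step_op_msum[OF n] using n ys MP by (intro msum_mult_right) auto
  also have "\<dots> = msum (dimH m) (\<lambda>zs. if zs = ys then step_at n ys * ?P ys else 0\<^sub>m (dimH m) (dimH m)) (paths m n)"
    using c(1) by (intro msum_cong) auto
  also have "\<dots> = step_at n ys * ?P ys" using MP[OF ys] ys by (simp add: msum_delta)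
  finally show "step_op m f n * ?P ys = step_at n ys * ?P ys" .
  have "?P ys * step_op m f n = msum (dimH m) (\<lambda>zs. ?P ys * (step_at n zs * ?P zs)) (paths m n)"
    unfolding step_op_msum[OF n] using n ys MP by (intro msum_mult_left) auto
  also have "\<dots> = msum (dimH m) (\<lambda>zs. if zs = ys then step_at n ys * ?P ys else 0\<^sub>m (dimH m) (dimH m)) (paths m n)"
    using c(2) by (intro msum_cong) auto
  also have "\<dots> = step_at n ys * ?P ys" using MP[OF ys] ys by (simp add: msum_delta)
  finally show "?P ys * step_op m f n = step_at n ys * ?P ys" .
qed

lemma adjoint_step_op_obs_proj:
  assumes n: "n < slots m" and ys: "ys \<in> paths m n"
  shows "mat_adjoint (step_op m f n) * obs_proj m n ys = obs_proj m n ys * mat_adjoint (step_at n ys)"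
proof -
  have sa: "mat_adjoint (obs_proj m n ys) = obs_proj m n ys"
    using n ys by (intro obs_proj_adjoint[OF model]) auto
  have "mat_adjoint (step_op m f n) * obs_proj m n ys = mat_adjoint (obs_proj m n ys * step_op m f n)"
    using n ys by (simp add: mat_adjoint_mult sa)
  also have "\<dots> = mat_adjoint (step_at n ys * obs_proj m n ys)" by (simp only: step_op_obs_proj[OF n ys])
  also have "\<dots> = obs_proj m n ys * mat_adjoint (step_at n ys)"
    using n ys by (simp add: mat_adjoint_mult sa)
  finally show ?thesis .
qed

text \<open>The controlled step is block diagonal over the orthogonal outcome paths, with a unitary
  in each block.\<close>

lemma step_op_unitary:
  assumes n: "n < slots m"
  shows "mat_adjoint (step_op m f n) * step_op m f n = 1\<^sub>m (dimH m)"
proof -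
  let ?P = "obs_proj m n" and ?S = "step_op m f n"
  have "mat_adjoint ?S * ?S = msum (dimH m) (\<lambda>ys. mat_adjoint ?S * (step_at n ys * ?P ys)) (paths m n)"
    by (subst (2) step_op_msum[OF n], rule msum_mult_left) (use n in auto)
  also have "\<dots> = msum (dimH m) ?P (paths m n)"
  proof (rule msum_cong[OF refl])
    fix ys assume ys: "ys \<in> paths m n"
    have "mat_adjoint ?S * (step_at n ys * ?P ys) = mat_adjoint ?S * ?P ys * step_at n ys"
      using n ys by (simp add: step_at_obs_proj[symmetric] mult_assoc_dim)
    also have "\<dots> = ?P ys * (mat_adjoint (step_at n ys) * step_at n ys)"
      unfolding adjoint_step_op_obs_proj[OF n ys] using n ys by (simp add: mult_assoc_dim)
    also have "mat_adjoint (step_at n ys) * step_at n ys = 1\<^sub>m (dimH m)"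
      using n by (intro Mop_unitary[OF model admissible_control[OF adm n ys]]) auto
    finally show "mat_adjoint ?S * (step_at n ys * ?P ys) = ?P ys" using n ys by (simp add: one_mult_dim)
  qed
  finally show ?thesis using obs_proj_sum[OF model, of n] n by simp
qed

text \<open>On a past factor the operator must be an outcome projector, because the step reads the
  past observations through \<open>obs_proj\<close>; a future factor admits any operator.\<close>

lemma step_op_comm:
  assumes n: "n < slots m" and j: "0 < j" "j \<le> slots m" "j \<noteq> Suc n" and X: "X \<in> carrier_mat 2 2"
    and c: "Suc n < j \<or> (\<exists>y\<in>outcomes m. X = outp m y)"
  shows "comm (amp m j X) (step_op m f n)"
  unfolding step_op_msum[OF n]
proof (rule comm_msum)
  fix ys assume ys: "ys \<in> paths m n"
  have "comm (amp m j X) (step_at n ys)"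
    using n ys j X by (intro comm_step_at) (auto simp: comm_def intro!: amp_commute)
  moreover have "comm (amp m j X) (obs_proj m n ys)"
    using n ys j X c by (intro obs_proj_comm[OF model]) auto
  ultimately show "comm (amp m j X) (step_at n ys * obs_proj m n ys)"
    using n ys j X by (auto intro!: comm_mult[of _ "dimH m"])
qed (use n j X in auto)

lemma Uop_carrier [simp]: "l \<le> slots m \<Longrightarrow> Uop m f l \<in> op_space"
  by (induction l) (auto simp: Uop_Suc)

lemma Uop_dim [simp]:
  "l \<le> slots m \<Longrightarrow> dim_row (Uop m f l) = dimH m" "l \<le> slots m \<Longrightarrow> dim_col (Uop m f l) = dimH m"
  using Uop_carrier by blast+

lemma Uop_unitary: "l \<le> slots m \<Longrightarrow> mat_adjoint (Uop m f l) * Uop m f l = 1\<^sub>m (dimH m)"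
proof (induction l)
  case (Suc l)
  let ?S = "step_op m f l" and ?U = "Uop m f l"
  have "mat_adjoint (?S * ?U) * (?S * ?U) = mat_adjoint ?U * ((mat_adjoint ?S * ?S) * ?U)"
    using Suc.prems by (simp add: mat_adjoint_mult mult_assoc_dim)
  also have "\<dots> = mat_adjoint ?U * ?U"
    using Suc.prems by (simp add: step_op_unitary one_mult_dim)
  finally show ?case using Suc by (simp add: Uop_Suc)
qed simp

lemma Uop_unitary': "l \<le> slots m \<Longrightarrow> Uop m f l * mat_adjoint (Uop m f l) = 1\<^sub>m (dimH m)"
  by (rule mat_mult_left_right_inverse[OF _ _ Uop_unitary]) auto

lemma Uop_comm:
  assumes "l < j" "j \<le> slots m" "X \<in> carrier_mat 2 2"
  shows "comm (amp m j X) (Uop m f l)"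
  using assms(1)
proof (induction l)
  case 0
  then show ?case using assms by (auto intro!: comm_one)
next
  case (Suc l)
  have "comm (amp m j X) (step_op m f l)" using Suc.prems assms by (intro step_op_comm) auto
  then show ?case using Suc assms by (auto simp: Uop_Suc intro!: comm_mult[of _ "dimH m"])
qed

text \<open>The test operator \<open>X\<close> is arbitrary because the induction changes it: the
  last step turns \<open>X\<close> into \<open>X'\<close>, to which the hypothesis for the shorter
  path applies. Cyclicity of the trace then moves the Kraus operators from \<open>X'\<close> onto
  \<open>tau\<close>.\<close>

lemma quantum_filter:
  assumes "l \<le> slots m" "ys \<in> paths m l" "X \<in> carrier_mat 2 2"
  shows "tr (vac_state m * (mat_adjoint (Uop m f l) * (amp m 0 X * obs_proj m l ys) * Uop m f l)) =
    tr (tau m f l ys * X)"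
  using assms
proof (induction l arbitrary: ys X)
  case 0
  then show ?case by (simp add: one_mult_dim obs_proj_0[OF model] tr_vac_state[OF model])
next
  case (Suc l)
  obtain zs y where zs: "ys = zs @ [y]" "zs \<in> paths m l" "y \<in> outcomes m"
    using Suc.prems(2) by (rule paths_SucE)
  have l: "l < slots m" "l \<le> slots m" "Suc l \<le> slots m" using Suc.prems by auto
  note X = Suc.prems(3)
  let ?R = "vac_state m" and ?U = "Uop m f l" and ?S = "step_op m f l" and ?P = "obs_proj m l zs"
    and ?M = "step_at l zs" and ?E = "amp m (Suc l) (outp m y)" and ?v = "amp m (Suc l) (eu 1 1)" and ?X = "amp m 0 X"
  let ?N = "mat_adjoint ?M * (?X * ?E) * ?M"
  define K where "K = kraus m (f (Suc l) zs) y"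
  define X' where "X' = complex_of_real (1 / 2) \<cdot>\<^sub>m (mat_adjoint K * X * K)"
  have u: "f (Suc l) zs \<in> controls m" using admissible_control[OF adm] l zs by auto
  have K: "K \<in> carrier_mat 2 2" "dim_row K = 2" "dim_col K = 2" using kraus_carrier[OF model u] by (auto simp: K_def)
  have X': "X' \<in> carrier_mat 2 2" using K X by (auto simp: X'_def)
  have PP: "?P * ?P = ?P" using obs_proj_orth[OF model, of l zs zs] l zs by auto
  have cPX: "comm (amp m 0 Y) ?P" if "Y \<in> carrier_mat 2 2" for Y using l zs that by (intro obs_proj_comm[OF model]) auto
  have cP: "comm (amp m (Suc l) Y) ?P" if "Y \<in> carrier_mat 2 2" for Y using l zs that by (intro obs_proj_comm[OF model]) auto
  have swap: "comm ?P (?X * ?E)"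
    using l zs X cPX[of X] cP[of "outp m y"] by (intro comm_mult[of _ "dimH m"]) (auto intro: comm_sym)
  \<comment> \<open>Being idempotent and commuting with the observable, \<open>?P\<close> can stand
    on both sides, where it fixes the control inside \<open>?S\<close>.\<close>
  have XPE: "?X * (?P * ?E) = ?P * (?X * ?E) * ?P"
  proof -
    have "?X * (?P * ?E) = ?X * ?E * ?P"
      using l zs X cP[of "outp m y"] by (simp add: comm_def mult_assoc_dim)
    also have "\<dots> = ?X * ?E * (?P * ?P)" by (simp only: PP)
    also have "\<dots> = ((?X * ?E) * ?P) * ?P" using l zs X by (simp add: mult_assoc_dim)
    also have "(?X * ?E) * ?P = ?P * (?X * ?E)" using swap by (simp add: comm_def)
    finally show ?thesis .
  qed
  have inner: "mat_adjoint ?S * (?X * (?P * ?E)) * ?S = ?P * ?N * ?P"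
  proof -
    have "mat_adjoint ?S * (?X * (?P * ?E)) * ?S = (mat_adjoint ?S * ?P) * (?X * ?E) * (?P * ?S)"
      unfolding XPE using l zs X by (simp add: mult_assoc_dim)
    also have "\<dots> = ?P * ?N * ?P"
      unfolding adjoint_step_op_obs_proj[OF l(1) zs(2)] step_op_obs_proj(2)[OF l(1) zs(2)]
      using l zs X by (simp add: mult_assoc_dim)
    finally show ?thesis .
  qed
  have obsS: "obs_proj m (Suc l) ys = ?P * ?E" using obs_proj_Suc[OF model, of l zs y] l zs by simp
  have vU: "comm ?v ?U" using l by (intro Uop_comm) auto
  have vUa: "comm ?v (mat_adjoint ?U)"
    using l Uop_comm[of l "Suc l" "eu 1 1"] by (intro comm_adjoint[of _ "dimH m"]) (auto simp: amp_adjoint eu_adjoint)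
  have vP: "comm ?v ?P" using cP by auto
  have N: "?N \<in> op_space" using l zs X by auto
  have vNv: "?v * ?N * ?v = amp m 0 X' * ?v"
    using compress_step[OF model _ _ u zs(3) X, of "Suc l"] l by (simp add: X'_def K_def tens_def)
  have vXv: "?v * amp m 0 X' * ?v = amp m 0 X' * ?v"
  proof -
    have "?v * amp m 0 X' = amp m 0 X' * ?v" using l X' by (intro amp_commute) auto
    then have "?v * amp m 0 X' * ?v = amp m 0 X' * (?v * ?v)" using l X' by (simp add: mult_assoc_dim)
    also have "?v * ?v = ?v" using l by (simp add: amp_mult eu_mult)
    finally show ?thesis .
  qed
  have R: "?R * ?v = ?R" "?v * ?R = ?R" using vac_state_absorb[OF model, of "Suc l"] l by auto
  have "mat_adjoint (Uop m f (Suc l)) * (?X * obs_proj m (Suc l) ys) * Uop m f (Suc l) =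
      mat_adjoint ?U * (mat_adjoint ?S * (?X * (?P * ?E)) * ?S) * ?U"
    unfolding obsS Uop_Suc using l zs(2,3) X by (simp add: mat_adjoint_mult mult_assoc_dim)
  also have "\<dots> = mat_adjoint ?U * (?P * ?N * ?P) * ?U" by (simp only: inner)
  finally have "tr (?R * (mat_adjoint (Uop m f (Suc l)) * (?X * obs_proj m (Suc l) ys) * Uop m f (Suc l))) =
      tr (?R * (mat_adjoint ?U * (?P * ?N * ?P) * ?U))" by simp
  \<comment> \<open>The vacuum state absorbs \<open>?v\<close>, which commutes with the past
    evolution and outcomes, so only \<open>?N\<close> gets compressed.\<close>
  also have "\<dots> = tr (?R * (?v * (mat_adjoint ?U * (?P * ?N * ?P) * ?U) * ?v))"
    using l zs X N R by (intro tr_compress[symmetric, of _ "dimH m"]) (auto simp: vac_state_carrier[OF model])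
  also have "?v * (mat_adjoint ?U * (?P * ?N * ?P) * ?U) * ?v = mat_adjoint ?U * (?P * (?v * ?N * ?v) * ?P) * ?U"
    using l zs N vU vUa vP by (intro sandwich[of _ "dimH m"]) auto
  \<comment> \<open>The compressed \<open>?N\<close> is also the compression of a system operator,
    so the vacuum projectors can be removed by the same two lemmas read backwards.\<close>
  also have "?v * ?N * ?v = ?v * amp m 0 X' * ?v" by (simp only: vNv vXv)
  also have "mat_adjoint ?U * (?P * (?v * amp m 0 X' * ?v) * ?P) * ?U = ?v * (mat_adjoint ?U * (?P * amp m 0 X' * ?P) * ?U) * ?v"
    using l zs X' vU vUa vP by (intro sandwich[symmetric, of _ "dimH m"]) auto
  also have "tr (?R * \<dots>) = tr (?R * (mat_adjoint ?U * (?P * amp m 0 X' * ?P) * ?U))"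
    using l zs X' R by (intro tr_compress[of _ "dimH m"]) (auto simp: vac_state_carrier[OF model])
  also have "?P * amp m 0 X' * ?P = amp m 0 X' * ?P"
  proof -
    have "?P * amp m 0 X' = amp m 0 X' * ?P" using cPX[OF X'] by (simp add: comm_def)
    then have "?P * amp m 0 X' * ?P = amp m 0 X' * (?P * ?P)" using l zs X' by (simp add: mult_assoc_dim)
    then show ?thesis by (simp only: PP)
  qed
  also have "tr (?R * (mat_adjoint ?U * (amp m 0 X' * ?P) * ?U)) = tr (tau m f l zs * X')"
    using l zs X' by (intro Suc.IH) auto
  also have "\<dots> = tr (tau m f (Suc l) ys * X)"
  proof -
    have t: "tau m f l zs \<in> carrier_mat 2 2" using tau_carrier[OF model adm zs(2)] l by auto
    have dX: "dim_row X = 2" "dim_col X = 2" "dim_row (tau m f l zs) = 2" "dim_col (tau m f l zs) = 2" using X t by auto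
    have len: "length zs = l" using zs by (simp add: paths_def)
    have "tau m f (Suc l) ys = complex_of_real (1 / 2) \<cdot>\<^sub>m (K * tau m f l zs * mat_adjoint K)"
      using len by (simp add: zs(1) K_def nth_append tau_append)
    moreover have "tr (tau m f l zs * (mat_adjoint K * X * K)) = tr (K * tau m f l zs * mat_adjoint K * X)"
    proof -
      have "tau m f l zs * (mat_adjoint K * X * K) = (tau m f l zs * (mat_adjoint K * X)) * K"
        using dX K by (simp add: mult_assoc_dim)
      also have "tr \<dots> = tr (K * (tau m f l zs * (mat_adjoint K * X)))"
        using dX K by (intro tr_mult_commute) auto
      also have "K * (tau m f l zs * (mat_adjoint K * X)) = K * tau m f l zs * mat_adjoint K * X"
        using dX K by (simp add: mult_assoc_dim)
      finally show ?thesis .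
    qed
    ultimately show ?thesis
      using dX K by (simp add: X'_def mult_smult_dim smult_mult_dim tr_smult)
  qed
  finally show ?case .
qed

end

section \<open>The law of the observations and the total cost\<close>

lemma qstate_vac: "qstate m A = tr (vac_state m * A)"
  by (simp add: qstate_def vac_state_def)

context
  fixes m :: homodyne and f :: strategy
  assumes model: "homodyne_model m" and adm: "f \<in> admissible_strategies m"
begin

lemmas model_simps [simp] = obs_proj_carrier[OF model] obs_proj_dim[OF model] Uop_carrier[OF model adm]
  Uop_dim[OF model adm] step_op_carrier[OF model adm] vac_state_carrier[OF model]

text \<open>Every later step commutes with the outcome projector of factor \<open>l\<close> and
  cancels by unitarity, so an output may be expressed through any later evolution operator.\<close>

lemma conj_outp:
  assumes l: "0 < l" "l \<le> n" and n: "n \<le> slots m" and y: "y \<in> outcomes m"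
  shows "mat_adjoint (Uop m f n) * amp m l (outp m y) * Uop m f n =
    mat_adjoint (Uop m f l) * amp m l (outp m y) * Uop m f l"
  using l(2) n
proof (induction n rule: dec_induct)
  case (step n)
  let ?S = "step_op m f n" and ?U = "Uop m f n" and ?E = "amp m l (outp m y)"
  have n: "n < slots m" "n \<le> slots m" "l \<le> slots m" using step by auto
  have "comm ?E ?S" using step n l y by (intro step_op_comm[OF model adm]) auto
  then have "mat_adjoint ?S * ?E * ?S = mat_adjoint ?S * ?S * ?E"
    using n by (simp add: comm_def mult_assoc_dim)
  also have "\<dots> = ?E" using n by (simp add: step_op_unitary[OF model adm] one_mult_dim)
  finally have S: "mat_adjoint ?S * ?E * ?S = ?E" .
  have "mat_adjoint (Uop m f (Suc n)) * ?E * Uop m f (Suc n) = mat_adjoint ?U * (mat_adjoint ?S * ?E * ?S) * ?U"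
    using n by (simp add: Uop_Suc mat_adjoint_mult mult_assoc_dim)
  then show ?case using step n by (simp only: S)
qed simp

text \<open>Unitary conjugation preserves the square and self-adjointness of \<open>DZ\<close>, so
  \<open>eigenproj_reflection\<close> applies to the output as well.\<close>

lemma eigenproj_DY:
  assumes l: "0 < l" "l \<le> slots m" and y: "y \<in> outcomes m"
  shows "eigenproj (DY m f l) y = mat_adjoint (Uop m f l) * amp m l (outp m y) * Uop m f l"
proof -
  let ?U = "Uop m f l" and ?Z = "DZ m l"
  note Z = DZ_carrier[OF model l(2)]
  have dZ: "dim_row ?Z = dimH m" "dim_col ?Z = dimH m" using Z by auto
  have UU: "mat_adjoint ?U * ?U = 1\<^sub>m (dimH m)" "?U * mat_adjoint ?U = 1\<^sub>m (dimH m)"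
    using l Uop_unitary[OF model adm] Uop_unitary'[OF model adm] by auto
  have DY: "DY m f l = mat_adjoint ?U * ?Z * ?U" by (simp add: DY_def heisenberg_def)
  have y0: "y \<noteq> 0" using outcomes_nonzero[OF model] y by auto
  have "amp m l (outp m y) = eigenproj ?Z y" using eigenproj_DZ[OF model l(2) y] by simp
  also have "\<dots> = complex_of_real (1 / 2) \<cdot>\<^sub>m (1\<^sub>m (dimH m) + complex_of_real (1 / y) \<cdot>\<^sub>m ?Z)"
    using Z l y y0 DZ_selfadjoint[OF model l(2)] DZ_square[OF model l(2) y]
    by (intro eigenproj_reflection) (auto simp: selfadjoint_def)
  finally have E: "amp m l (outp m y) = \<dots>" .
  have sq: "DY m f l * DY m f l = complex_of_real (y\<^sup>2) \<cdot>\<^sub>m 1\<^sub>m (dimH m)"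
  proof -
    have "DY m f l * DY m f l = mat_adjoint ?U * (?Z * ((?U * mat_adjoint ?U) * (?Z * ?U)))"
      unfolding DY using l dZ by (simp add: mult_assoc_dim)
    also have "\<dots> = mat_adjoint ?U * ((?Z * ?Z) * ?U)"
      unfolding UU using l dZ by (simp add: one_mult_dim mult_assoc_dim)
    also have "\<dots> = complex_of_real (y\<^sup>2) \<cdot>\<^sub>m 1\<^sub>m (dimH m)"
      unfolding DZ_square[OF model l(2) y] using l UU(1)
      by (simp add: smult_mult_dim mult_smult_dim one_mult_dim)
    finally show ?thesis .
  qed
  have "eigenproj (DY m f l) y = complex_of_real (1 / 2) \<cdot>\<^sub>m (1\<^sub>m (dimH m) + complex_of_real (1 / y) \<cdot>\<^sub>m DY m f l)"
  proof (rule eigenproj_reflection)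
    show "DY m f l \<in> carrier_mat (dimH m) (dimH m)" using l Z by (simp add: DY)
    show "selfadjoint (DY m f l)"
      using l dZ DZ_selfadjoint[OF model l(2)] by (simp add: selfadjoint_def DY mat_adjoint_mult mult_assoc_dim)
  qed (use sq y0 in auto)
  also have "\<dots> = mat_adjoint ?U * amp m l (outp m y) * ?U"
    unfolding E DY using l dZ UU(1)
    by (simp add: smult_mult_dim mult_smult_dim mult_add_dim add_mult_dim one_mult_dim)
  finally show ?thesis .
qed

text \<open>By \<open>conj_outp\<close> all outputs can be conjugated by the same final evolution,
  and the product of their projectors telescopes to a conjugated \<open>obs_proj\<close>.\<close>

lemma joint_eigenproj_DY:
  assumes "n \<le> slots m" "ys \<in> paths m n"
  shows "joint_eigenproj (dimH m) (map (DY m f) [1..<Suc n]) ys =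
    mat_adjoint (Uop m f (slots m)) * obs_proj m n ys * Uop m f (slots m)"
  using assms
proof (induction n arbitrary: ys)
  case 0
  then show ?case
    by (simp add: joint_eigenproj_def obs_proj_0[OF model] one_mult_dim Uop_unitary[OF model adm])
next
  case (Suc n)
  let ?U = "Uop m f (slots m)"
  obtain zs y where zs: "ys = zs @ [y]" "zs \<in> paths m n" "y \<in> outcomes m"
    using Suc.prems(2) by (rule paths_SucE)
  have n: "n \<le> slots m" "Suc n \<le> slots m" using Suc.prems by auto
  have E: "eigenproj (DY m f i) a = mat_adjoint ?U * amp m i (outp m a) * ?U"
    if "0 < i" "i \<le> slots m" "a \<in> outcomes m" for i a
    using that by (simp add: eigenproj_DY conj_outp[symmetric, of i "slots m"])
  have len: "length (map (DY m f) [1..<Suc n]) = length zs" using zs by (simp add: paths_def)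
  have car: "eigenproj A a \<in> carrier_mat (dimH m) (dimH m)"
    if Aa: "(A, a) \<in> set (zip (map (DY m f) [1..<Suc n]) zs)" for A a
  proof -
    obtain i where i: "i \<in> set [1..<Suc n]" "A = DY m f i" using set_zip_leftD[OF Aa] by auto
    then have "0 < i" "i \<le> slots m" using n by auto
    moreover have "a \<in> outcomes m"
      using set_zip_rightD[OF Aa] zs(2) by (auto simp: paths_def outcomes_def)
    ultimately show ?thesis using i(2) by (simp add: E)
  qed
  have car1: "eigenproj (DY m f (Suc n)) y \<in> carrier_mat (dimH m) (dimH m)" using n zs by (simp add: E)
  have "joint_eigenproj (dimH m) (map (DY m f) [1..<Suc (Suc n)]) ys =
      joint_eigenproj (dimH m) (map (DY m f) [1..<Suc n]) zs * eigenproj (DY m f (Suc n)) y"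
    using joint_eigenproj_snoc(1)[OF len car car1] by (simp add: zs(1))
  also have "\<dots> = (mat_adjoint ?U * obs_proj m n zs * ?U) * (mat_adjoint ?U * amp m (Suc n) (outp m y) * ?U)"
    using n zs by (simp only: Suc.IH E zero_less_Suc)
  also have "\<dots> = mat_adjoint ?U * (obs_proj m n zs * ((?U * mat_adjoint ?U) * (amp m (Suc n) (outp m y) * ?U)))"
    using n zs(2,3) by (simp add: mult_assoc_dim)
  also have "\<dots> = mat_adjoint ?U * obs_proj m (Suc n) ys * ?U"
    unfolding zs(1) obs_proj_Suc[OF model n(1) zs(2) n(2) zs(3)] Uop_unitary'[OF model adm order_refl]
    using n zs(2,3) by (simp add: mult_assoc_dim one_mult_dim)
  finally show ?case .
qed

lemma obs_density:
  assumes "ys \<in> paths m (slots m)"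
  shows "qstate m (joint_eigenproj (dimH m) (map (DY m f) [1..<Suc (slots m)]) ys) = tr (tau m f (slots m) ys)"
proof -
  have t: "tau m f (slots m) ys \<in> carrier_mat 2 2" using tau_carrier[OF model adm assms] by auto
  have "qstate m (joint_eigenproj (dimH m) (map (DY m f) [1..<Suc (slots m)]) ys) =
      tr (vac_state m * (mat_adjoint (Uop m f (slots m)) * (amp m 0 (1\<^sub>m 2) * obs_proj m (slots m) ys) * Uop m f (slots m)))"
    unfolding joint_eigenproj_DY[OF order_refl assms] qstate_vac
    using assms by (simp add: amp_one one_mult_dim)
  also have "\<dots> = tr (tau m f (slots m) ys * 1\<^sub>m 2)"
    by (rule quantum_filter[OF model adm]) (use assms in auto)
  finally show ?thesis using t by simp
qed

lemma qstate_heisenberg_msum: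
  assumes n: "n \<le> slots m" and F: "\<And>ys. ys \<in> paths m n \<Longrightarrow> F ys \<in> carrier_mat 2 2"
  shows "qstate m (heisenberg m f n (msum (dimH m) (\<lambda>ys. amp m 0 (F ys) * obs_proj m n ys) (paths m n))) =
    (\<Sum>ys\<in>paths m n. tr (tau m f n ys * F ys))"
proof -
  let ?U = "Uop m f n" and ?R = "vac_state m"
  have c: "amp m 0 (F ys) * obs_proj m n ys \<in> carrier_mat (dimH m) (dimH m)" if "ys \<in> paths m n" for ys
    using that n F[OF that] by simp
  have "heisenberg m f n (msum (dimH m) (\<lambda>ys. amp m 0 (F ys) * obs_proj m n ys) (paths m n)) =
      msum (dimH m) (\<lambda>ys. mat_adjoint ?U * (amp m 0 (F ys) * obs_proj m n ys)) (paths m n) * ?U"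
    unfolding heisenberg_def using n c by (subst msum_mult_left) auto
  also have "\<dots> = msum (dimH m) (\<lambda>ys. mat_adjoint ?U * (amp m 0 (F ys) * obs_proj m n ys) * ?U) (paths m n)"
    using n c by (intro msum_mult_right) (auto intro!: square_closed)
  finally have "qstate m (heisenberg m f n (msum (dimH m) (\<lambda>ys. amp m 0 (F ys) * obs_proj m n ys) (paths m n))) =
      tr (msum (dimH m) (\<lambda>ys. ?R * (mat_adjoint ?U * (amp m 0 (F ys) * obs_proj m n ys) * ?U)) (paths m n))"
    unfolding qstate_vac using n c by (subst msum_mult_left[symmetric]) (auto intro!: square_closed)
  also have "\<dots> = (\<Sum>ys\<in>paths m n. tr (?R * (mat_adjoint ?U * (amp m 0 (F ys) * obs_proj m n ys) * ?U)))"
    using n c by (intro tr_msum) (auto intro!: square_closed)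
  also have "\<dots> = (\<Sum>ys\<in>paths m n. tr (tau m f n ys * F ys))"
    using n F by (intro sum.cong refl quantum_filter[OF model adm]) auto
  finally show ?thesis .
qed

lemma total_cost_tau:
  "total_cost m f = (\<Sum>n<slots m. \<Sum>ys\<in>paths m n. Re (tr (tau m f n ys * Qcost m (f (Suc n) ys))) * dt m) +
    (\<Sum>ys\<in>paths m (slots m). Re (tr (tau m f (slots m) ys * Kcost m)))"
proof -
  let ?k = "slots m" and ?d = "dimH m"
  let ?H = "\<lambda>n. heisenberg m f n (at_operator (\<lambda>u. amp m 0 (Qcost m u)) (control_op m f (Suc n)))"
  have K: "Kcost m \<in> carrier_mat 2 2" using model by (simp add: homodyne_model_def)
  have Q: "Qcost m (f (Suc n) ys) \<in> carrier_mat 2 2" if "n < ?k" "ys \<in> paths m n" for n ys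
    using model admissible_control[OF adm that] by (simp add: homodyne_model_def)
  have at: "at_operator (\<lambda>u. amp m 0 (Qcost m u)) (control_op m f (Suc n)) =
      msum ?d (\<lambda>ys. amp m 0 (Qcost m (f (Suc n) ys)) * obs_proj m n ys) (paths m n)" if "n < ?k" for n
    using that Q by (intro at_control_op[OF model]) auto
  have H: "?H n \<in> carrier_mat ?d ?d" if "n < ?k" for n
    using that by (simp add: at heisenberg_def)
  have runn: "qstate m (?H n * Dt m (Suc n)) = complex_of_real (dt m) *
      (\<Sum>ys\<in>paths m n. tr (tau m f n ys * Qcost m (f (Suc n) ys)))" if n: "n < ?k" for n
  proof -
    have "?H n * Dt m (Suc n) = complex_of_real (dt m) \<cdot>\<^sub>m ?H n"
      unfolding Dt_def dt_def using H[OF n] by (subst mult_smult_dim) auto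
    then have "qstate m (?H n * Dt m (Suc n)) = complex_of_real (dt m) * qstate m (?H n)"
      unfolding qstate_vac using carrier_matD[OF H[OF n]] carrier_matD[OF vac_state_carrier[OF model]]
      by (simp add: mult_smult_dim tr_smult)
    also have "qstate m (?H n) = (\<Sum>ys\<in>paths m n. tr (tau m f n ys * Qcost m (f (Suc n) ys)))"
      unfolding at[OF n] using n Q by (intro qstate_heisenberg_msum) auto
    finally show ?thesis .
  qed
  \<comment> \<open>Inserting the sum of all path projectors brings the terminal cost into the form
    of the running costs.\<close>
  have amp_K: "amp m 0 (Kcost m) = msum ?d (\<lambda>ys. amp m 0 (Kcost m) * obs_proj m ?k ys) (paths m ?k)"
    using K obs_proj_sum[OF model order_refl] by (simp flip: msum_mult_left)
  have fin: "qstate m (heisenberg m f ?k (amp m 0 (Kcost m))) = (\<Sum>ys\<in>paths m ?k. tr (tau m f ?k ys * Kcost m))"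
    by (subst amp_K) (rule qstate_heisenberg_msum, use K in auto)
  have HD: "?H n * Dt m (Suc n) \<in> carrier_mat ?d ?d" if "n < ?k" for n
    using H[OF that] by (auto simp: Dt_def intro!: square_closed)
  let ?F = "\<lambda>l. heisenberg m f (l - 1) (at_operator (\<lambda>u. amp m 0 (Qcost m u)) (control_op m f l)) * Dt m l"
  have FD: "?F l \<in> carrier_mat ?d ?d" if "l \<in> {1..?k}" for l
    using that HD by (cases l) auto
  have "qstate m (msum ?d ?F {1..?k} + heisenberg m f ?k (amp m 0 (Kcost m))) =
      qstate m (msum ?d ?F {1..?k}) + qstate m (heisenberg m f ?k (amp m 0 (Kcost m)))"
    unfolding qstate_vac using K carrier_matD[OF vac_state_carrier[OF model]]
    by (subst mult_add_dim) (auto simp: heisenberg_def intro!: tr_add)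
  also have "qstate m (msum ?d ?F {1..?k}) = (\<Sum>l\<in>{1..?k}. qstate m (?F l))"
  proof -
    have "vac_state m * msum ?d ?F {1..?k} = msum ?d (\<lambda>l. vac_state m * ?F l) {1..?k}"
      by (rule msum_mult_left[OF vac_state_carrier[OF model] FD])
    also have "tr \<dots> = (\<Sum>l\<in>{1..?k}. tr (vac_state m * ?F l))"
      by (rule tr_msum) (rule square_closed(1)[OF vac_state_carrier[OF model] FD])
    finally show ?thesis by (simp only: qstate_vac)
  qed
  also have "\<dots> = (\<Sum>n<?k. qstate m (?H n * Dt m (Suc n)))"
    by (simp only: sum.atLeast1_atMost_eq One_nat_def diff_Suc_Suc diff_zero)
  also have "\<dots> = (\<Sum>n<?k. complex_of_real (dt m) *
      (\<Sum>ys\<in>paths m n. tr (tau m f n ys * Qcost m (f (Suc n) ys))))"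
    using runn by (intro sum.cong) auto
  finally show ?thesis
    unfolding total_cost_def fin
    by (simp add: sum_distrib_left sum_distrib_right mult.commute)
qed

end

section \<open>The conditional density matrix\<close>

text \<open>Serves for outcomes of probability zero. The diagonal entries are nonnegative with sum
  zero, so only the off-diagonal entry remains to be excluded.\<close>

lemma psd_trace_zero:
  assumes A: "A \<in> carrier_mat 2 2" "selfadjoint A" "nonnegative A" and t: "tr A = 0"
  shows "A = 0\<^sub>m 2 2"
proof -
  have h: "A $$ (j, i) = cnj (A $$ (i, j))" if "i < 2" "j < 2" for i j
    using A(1,2) that mat_adjoint_index[of j A i] by (auto simp: selfadjoint_def)
  define z where "z = A $$ (0, 1)"
  have z: "A $$ (0, 1) = z" "A $$ (1, 0) = cnj z" using h[of 0 1] by (auto simp: z_def)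
  have pos: "0 \<le> Re ((A *\<^sub>v v) \<bullet>c v)" if "v \<in> carrier_vec 2" for v
    using A(1,3) that by (auto simp: nonnegative_def)
  have inner: "(A *\<^sub>v v) \<bullet>c v = (A $$ (0, 0) * v $ 0 + z * v $ 1) * cnj (v $ 0) + (cnj z * v $ 0 + A $$ (1, 1) * v $ 1) * cnj (v $ 1)"
    if "v \<in> carrier_vec 2" for v
    using A(1) that z by (simp add: scalar_prod_def atLeast0LessThan sum_less_2)
  have d: "0 \<le> Re (A $$ (0, 0))" "0 \<le> Re (A $$ (1, 1))"
    using pos[of "unit_vec 2 0"] inner[of "unit_vec 2 0"] pos[of "unit_vec 2 1"] inner[of "unit_vec 2 1"] by auto
  have im: "Im (A $$ (0, 0)) = 0" "Im (A $$ (1, 1)) = 0"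
    using h[of 0 0] h[of 1 1] by (auto simp: complex_eq_iff)
  have "A $$ (0, 0) + A $$ (1, 1) = 0" using t A(1) by (simp add: tr_def sum_less_2)
  then have zero: "A $$ (0, 0) = 0" "A $$ (1, 1) = 0" using d im by (auto simp: complex_eq_iff)
  \<comment> \<open>Chosen so that, with a vanishing diagonal, the quadratic form equals -2
    |z|^2.\<close>
  define v where "v = vec_of_list [1, - cnj z]"
  have v: "v \<in> carrier_vec 2" "v $ 0 = 1" "v $ 1 = - cnj z" by (auto simp: v_def carrier_vecI)
  have "(A *\<^sub>v v) \<bullet>c v = - 2 * (z * cnj z)" unfolding inner[OF v(1)] v zero by simp
  also have "z * cnj z = complex_of_real ((cmod z)\<^sup>2)" by (rule complex_norm_square[symmetric])
  finally have "Re ((A *\<^sub>v v) \<bullet>c v) = - 2 * (cmod z)\<^sup>2" by simp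
  with pos[OF v(1)] have "z = 0" by simp
  then show ?thesis using A(1) zero z by (intro mat2_eqI) auto
qed

lemma psd_trace:
  assumes A: "A \<in> carrier_mat 2 2" "selfadjoint A" "nonnegative A"
  shows "Im (tr A) = 0" "0 \<le> Re (tr A)"
proof -
  have h: "Im (A $$ (i, i)) = 0" if "i < 2" for i
    using A(1,2) that mat_adjoint_index[of i A i] by (auto simp: selfadjoint_def complex_eq_iff)
  have "0 \<le> Re (A $$ (i, i))" if i: "i < 2" for i
  proof -
    have "(A *\<^sub>v unit_vec 2 i) \<bullet>c unit_vec 2 i = A $$ (i, i)"
      using A(1) i by (auto simp: scalar_prod_def atLeast0LessThan sum_less_2 less_2_iff)
    moreover have "0 \<le> Re ((A *\<^sub>v unit_vec 2 i) \<bullet>c unit_vec 2 i)"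
      using A by (simp add: nonnegative_def)
    ultimately show ?thesis by simp
  qed
  then show "Im (tr A) = 0" "0 \<le> Re (tr A)"
    using A(1) h[of 0] h[of 1] by (auto simp: tr_def sum_less_2)
qed

lemma psd_conj:
  assumes A: "A \<in> carrier_mat 2 2" "selfadjoint A" "nonnegative A" and K: "K \<in> carrier_mat 2 2"
  shows "K * A * mat_adjoint K \<in> carrier_mat 2 2" "selfadjoint (K * A * mat_adjoint K)"
    "nonnegative (K * A * mat_adjoint K)"
proof -
  note d = carrier_matD[OF A(1)] carrier_matD[OF K]
  show "K * A * mat_adjoint K \<in> carrier_mat 2 2" using A K by simp
  show "selfadjoint (K * A * mat_adjoint K)"
    using A(2) d by (simp add: selfadjoint_def mat_adjoint_mult mult_assoc_dim)
  show "nonnegative (K * A * mat_adjoint K)" unfolding nonnegative_def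
  proof
    fix v :: "complex Matrix.vec" assume "v \<in> carrier_vec (dim_row (K * A * mat_adjoint K))"
    then have v: "v \<in> carrier_vec 2" using d by simp
    define w where "w = mat_adjoint K *\<^sub>v v"
    have w: "w \<in> carrier_vec 2" using d by (simp add: w_def carrier_vecI)
    have Aw: "A *\<^sub>v w \<in> carrier_vec 2" using d by (simp add: carrier_vecI)
    have "K * A * mat_adjoint K *\<^sub>v v = K *\<^sub>v (A *\<^sub>v w)"
      using mult_vec_assoc[of "K * A" 2 "mat_adjoint K" v] mult_vec_assoc[of K 2 A w] A(1) K v w
      by (simp add: w_def)
    then have "(K * A * mat_adjoint K *\<^sub>v v) \<bullet>c v = (A *\<^sub>v w) \<bullet>c w"
      using inner_mult_adjoint[of "A *\<^sub>v w" K v] Aw v d by (simp add: w_def)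
    then show "0 \<le> Re ((K * A * mat_adjoint K *\<^sub>v v) \<bullet>c v)"
      using A(1,3) w by (simp add: nonnegative_def)
  qed
qed

lemma density_scale:
  assumes A: "A \<in> carrier_mat 2 2" "selfadjoint A" "nonnegative A" and c: "0 \<le> c" "complex_of_real c * tr A = 1"
  shows "complex_of_real c \<cdot>\<^sub>m A \<in> density_matrices"
proof -
  have "nonnegative (complex_of_real c \<cdot>\<^sub>m A)" unfolding nonnegative_def
  proof
    fix v :: "complex Matrix.vec" assume "v \<in> carrier_vec (dim_row (complex_of_real c \<cdot>\<^sub>m A))"
    then have v: "v \<in> carrier_vec 2" using A by simp
    have "((complex_of_real c \<cdot>\<^sub>m A) *\<^sub>v v) \<bullet>c v = complex_of_real c * ((A *\<^sub>v v) \<bullet>c v)"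
    proof -
      have "(complex_of_real c \<cdot>\<^sub>m A) *\<^sub>v v = complex_of_real c \<cdot>\<^sub>v (A *\<^sub>v v)"
        using A(1) v by (intro smult_mult_vec) auto
      moreover have "A *\<^sub>v v \<in> carrier_vec 2" using A(1) by (intro carrier_vecI) auto
      ultimately show ?thesis using v by (simp add: smult_scalar_prod_distrib[of _ 2])
    qed
    then show "0 \<le> Re (((complex_of_real c \<cdot>\<^sub>m A) *\<^sub>v v) \<bullet>c v)"
      using A(1,3) v c(1) by (auto simp: nonnegative_def)
  qed
  then show ?thesis
    using A c by (auto simp: density_matrices_def selfadjoint_def mat_adjoint_smult tr_smult)
qed

lemma density_props:
  assumes "\<rho> \<in> density_matrices"
  shows "\<rho> \<in> carrier_mat 2 2" "selfadjoint \<rho>" "nonnegative \<rho>" "tr \<rho> = 1" "dim_row \<rho> = 2" "dim_col \<rho> = 2"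
  using assms by (auto simp: density_matrices_def)

context
  fixes m :: homodyne
  assumes model: "homodyne_model m"
begin

context
  fixes u :: real and \<rho> :: "complex mat"
  assumes u: "u \<in> controls m" and \<rho>: "\<rho> \<in> density_matrices"
begin

text \<open>Since y^2 = \<lambda>^2, the term quadratic in \<open>y\<close> joins
  \<open>Lbar\<close>; the terms linear in \<open>y\<close> make up \<open>Jbar\<close>.\<close>

lemma kraus_expand:
  assumes y: "y \<in> outcomes m"
  shows "kraus m u y * \<rho> * mat_adjoint (kraus m u y) =
    \<rho> + complex_of_real ((lam m)\<^sup>2) \<cdot>\<^sub>m Lbar m \<rho> u + complex_of_real y \<cdot>\<^sub>m Jbar m \<rho> u"
proof -
  let ?l = "complex_of_real ((lam m)\<^sup>2)" and ?y = "complex_of_real y" and ?O = "Mcirc m u" and ?M = "Mplus m u"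
  note d = density_props(5,6)[OF \<rho>] M_carrier(3-6)[OF model u]
  have yy: "?y * ?y = ?l" using y by (auto simp: outcomes_def power2_eq_square)
  have K: "kraus m u y = 1\<^sub>m 2 + ?l \<cdot>\<^sub>m ?O + ?y \<cdot>\<^sub>m ?M" by (simp add: kraus_def)
  have Ka: "mat_adjoint (kraus m u y) = 1\<^sub>m 2 + ?l \<cdot>\<^sub>m mat_adjoint ?O + ?y \<cdot>\<^sub>m mat_adjoint ?M"
    unfolding K using d by (simp add: mat_adjoint_add mat_adjoint_smult)
  show ?thesis unfolding Ka unfolding K Lbar_def Jbar_def using d
    by (simp add: mult_add_dim add_mult_dim mult_smult_dim smult_mult_dim smult_smult_mat smult_add_dim
        one_mult_dim yy mult_assoc_dim del: of_real_power)
      (intro eq_matI; simp add: algebra_simps del: index_mult_mat(1) of_real_power)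
qed

lemma kraus_psd:
  "kraus m u y * \<rho> * mat_adjoint (kraus m u y) \<in> carrier_mat 2 2"
  "selfadjoint (kraus m u y * \<rho> * mat_adjoint (kraus m u y))"
  "nonnegative (kraus m u y * \<rho> * mat_adjoint (kraus m u y))"
  using psd_conj[OF density_props(1-3)[OF \<rho>] kraus_carrier(1)[OF model u]] by auto

lemma bar_carrier: "Lbar m \<rho> u \<in> carrier_mat 2 2" "Jbar m \<rho> u \<in> carrier_mat 2 2"
  unfolding Lbar_def Jbar_def using density_props[OF \<rho>] M_carrier[OF model u] by auto

text \<open>Adding the two outcomes isolates the part even in \<open>y\<close>, whose trace follows
  from \<open>kraus_complete\<close>. The odd part has real trace because the unnormalised states
  are positive.\<close>

lemma tr_filter_parts:
  "tr (\<rho> + complex_of_real ((lam m)\<^sup>2) \<cdot>\<^sub>m Lbar m \<rho> u) = 1" "Im (tr (Jbar m \<rho> u)) = 0"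
proof -
  let ?A = "\<rho> + complex_of_real ((lam m)\<^sup>2) \<cdot>\<^sub>m Lbar m \<rho> u" and ?J = "Jbar m \<rho> u"
  let ?K = "\<lambda>y. kraus m u y"
  have lam: "lam m \<in> outcomes m" "- lam m \<in> outcomes m" "lam m \<noteq> 0" using lam_pos[OF model] by (auto simp: outcomes_def)
  have dims: "dim_row ?A = 2" "dim_col ?A = 2" "dim_row ?J = 2" "dim_col ?J = 2"
    using density_props[OF \<rho>] carrier_matD[OF bar_carrier(1)] carrier_matD[OF bar_carrier(2)] by auto
  have t: "tr (?K y * \<rho> * mat_adjoint (?K y)) = tr ?A + complex_of_real y * tr ?J" if "y \<in> outcomes m" for y
    unfolding kraus_expand[OF that] using dims by (simp add: tr_add tr_smult)
  have c: "tr (?K y * \<rho> * mat_adjoint (?K y)) = tr (mat_adjoint (?K y) * ?K y * \<rho>)" for y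
    using density_props[OF \<rho>] kraus_carrier[OF model u]
    by (subst tr_mult_commute) (auto simp: mult_assoc_dim)
  have "tr (?K (lam m) * \<rho> * mat_adjoint (?K (lam m))) + tr (?K (- lam m) * \<rho> * mat_adjoint (?K (- lam m))) =
      tr ((mat_adjoint (?K (lam m)) * ?K (lam m) + mat_adjoint (?K (- lam m)) * ?K (- lam m)) * \<rho>)"
    unfolding c using density_props[OF \<rho>] kraus_carrier[OF model u]
    by (simp add: add_mult_dim tr_add)
  also have "\<dots> = 2 * tr \<rho>"
    unfolding kraus_complete[OF model u] using density_props[OF \<rho>]
    by (simp add: smult_mult_dim one_mult_dim tr_smult)
  finally have "2 * tr ?A = 2" using t[OF lam(1)] t[OF lam(2)] density_props(4)[OF \<rho>] by simp
  then show one: "tr ?A = 1" by simp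
  have "Im (tr (?K (lam m) * \<rho> * mat_adjoint (?K (lam m)))) = 0" by (rule psd_trace(1)[OF kraus_psd])
  then show "Im (tr ?J) = 0" unfolding t[OF lam(1)] one using lam(3) by simp
qed

lemma tr_kraus:
  assumes "y \<in> outcomes m"
  shows "tr (kraus m u y * \<rho> * mat_adjoint (kraus m u y)) = complex_of_real (2 * pr m y \<rho> u)"
proof -
  have "tr (kraus m u y * \<rho> * mat_adjoint (kraus m u y)) = 1 + complex_of_real y * tr (Jbar m \<rho> u)"
    unfolding kraus_expand[OF assms]
    using tr_filter_parts(1) density_props[OF \<rho>] carrier_matD[OF bar_carrier(1)] carrier_matD[OF bar_carrier(2)]
    by (simp add: tr_add tr_smult)
  also have "tr (Jbar m \<rho> u) = complex_of_real (Re (tr (Jbar m \<rho> u)))"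
    using tr_filter_parts(2) by (simp add: complex_eq_iff)
  finally show ?thesis by (simp add: pr_def algebra_simps)
qed

lemma pr_nonneg: "y \<in> outcomes m \<Longrightarrow> 0 \<le> pr m y \<rho> u"
  using psd_trace(2)[OF kraus_psd, of y] tr_kraus[of y] by simp

lemma pr_sum: "(\<Sum>y\<in>outcomes m. pr m y \<rho> u) = 1"
  by (simp add: sum_outcomes[OF model] pr_def)

text \<open>If an outcome has probability zero, then by positivity its unnormalised state vanishes, so the
  other outcome carries the whole state.\<close>

lemma Gam_kraus:
  assumes y: "y \<in> outcomes m"
  shows "Gam m \<rho> u y = (if pr m y \<rho> u = 0 then complex_of_real (1 / 2) \<cdot>\<^sub>m (kraus m u (- y) * \<rho> * mat_adjoint (kraus m u (- y)))
    else complex_of_real (1 / (2 * pr m y \<rho> u)) \<cdot>\<^sub>m (kraus m u y * \<rho> * mat_adjoint (kraus m u y)))"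
proof -
  let ?A = "\<rho> + complex_of_real ((lam m)\<^sup>2) \<cdot>\<^sub>m Lbar m \<rho> u" and ?J = "Jbar m \<rho> u"
  let ?S = "\<lambda>y. kraus m u y * \<rho> * mat_adjoint (kraus m u y)"
  define t where "t = Re (tr ?J)"
  have t: "tr ?J = complex_of_real t" using tr_filter_parts(2) by (simp add: complex_eq_iff t_def)
  have y': "- y \<in> outcomes m" using y by (auto simp: outcomes_def)
  have l2: "(lam m)\<^sup>2 = y\<^sup>2" using y by (auto simp: outcomes_def)
  have S: "?S y = ?A + complex_of_real y \<cdot>\<^sub>m ?J" "?S (- y) = ?A + (- complex_of_real y) \<cdot>\<^sub>m ?J"
    using kraus_expand[OF y] kraus_expand[OF y'] by simp_all
  have dims: "dim_row ?A = 2" "dim_col ?A = 2" "dim_row ?J = 2" "dim_col ?J = 2"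
    using density_props[OF \<rho>] carrier_matD[OF bar_carrier(1)] carrier_matD[OF bar_carrier(2)] by auto
  have p: "2 * pr m y \<rho> u = 1 + y * t" "2 * pr m (- y) \<rho> u = 1 - y * t" by (simp_all add: pr_def t_def)
  have vanish: "?S z = 0\<^sub>m 2 2" if "z \<in> outcomes m" "pr m z \<rho> u = 0" for z
    using tr_kraus[OF that(1)] that(2) by (intro psd_trace_zero kraus_psd) simp
  have G: "Gam m \<rho> u y = ?A + complex_of_real ((y - y\<^sup>2 * t) / (1 - y\<^sup>2 * t\<^sup>2)) \<cdot>\<^sub>m (?J - complex_of_real t \<cdot>\<^sub>m ?A)"
    unfolding Gam_def Let_def t l2 by simp
  \<comment> \<open>The factors 1 + y t and 1 - y t are twice the probabilities of \<open>y\<close>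
    and of its negative; the cases below ask which of them vanishes.\<close>
  have coef: "(y - y\<^sup>2 * t) / (1 - y\<^sup>2 * t\<^sup>2) = (y * (1 - y * t)) / ((1 - y * t) * (1 + y * t))"
    by (simp add: algebra_simps power2_eq_square)
  show ?thesis
  proof (cases "1 + y * t = 0")
    case True
    then have p0: "pr m y \<rho> u = 0" using p by simp
    \<comment> \<open>The outcome \<open>y\<close> is impossible and the denominator is zero, so
      division by zero in HOL leaves only \<open>?A\<close>.\<close>
    have GA: "Gam m \<rho> u y = ?A"
      unfolding G coef True using dims by (intro eq_matI) auto
    have "?A = complex_of_real (1 / 2) \<cdot>\<^sub>m (?S y + ?S (- y))"
      unfolding S using dims by (intro eq_matI) (auto simp: field_simps simp del: index_mult_mat(1))
    also have "\<dots> = complex_of_real (1 / 2) \<cdot>\<^sub>m ?S (- y)"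
      unfolding vanish[OF y p0] using carrier_matD[OF kraus_psd(1)] by (intro eq_matI) (auto simp del: index_mult_mat(1))
    finally show ?thesis using p0 GA by simp
  next
    case nz: False
    then have p1: "pr m y \<rho> u \<noteq> 0" using p by simp
    show ?thesis
    proof (cases "1 - y * t = 0")
      case True
      then have p0: "pr m (- y) \<rho> u = 0" and p2: "pr m y \<rho> u = 1" using p by simp_all
      \<comment> \<open>Now \<open>y\<close> is certain; numerator and denominator of the
        coefficient are both zero, and again only \<open>?A\<close> is left.\<close>
      have GA: "Gam m \<rho> u y = ?A"
        unfolding G coef True using dims by (intro eq_matI) auto
      have "?A = complex_of_real (1 / 2) \<cdot>\<^sub>m (?S y + ?S (- y))"
        unfolding S using dims by (intro eq_matI) (auto simp: field_simps simp del: index_mult_mat(1))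
      also have "\<dots> = complex_of_real (1 / 2) \<cdot>\<^sub>m ?S y"
        unfolding vanish[OF y' p0] using carrier_matD[OF kraus_psd(1)] by (intro eq_matI) (auto simp del: index_mult_mat(1))
      finally show ?thesis using p2 GA by simp
    next
      case False
      have "(y - y\<^sup>2 * t) / (1 - y\<^sup>2 * t\<^sup>2) = y / (1 + y * t)" unfolding coef using False by simp
      then have "Gam m \<rho> u y = ?A + complex_of_real (y / (1 + y * t)) \<cdot>\<^sub>m (?J - complex_of_real t \<cdot>\<^sub>m ?A)"
        using G by simp
      also have "\<dots> = complex_of_real (1 / (1 + y * t)) \<cdot>\<^sub>m ?S y"
      proof -
        have c: "1 + complex_of_real y * complex_of_real t \<noteq> 0"
        proof -
          have "complex_of_real (1 + y * t) \<noteq> 0" using nz by (simp only: of_real_eq_0_iff not_False_eq_True)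
          then show ?thesis by simp
        qed
        show ?thesis
          unfolding S using dims c
          by (intro eq_matI) (auto simp: field_simps simp del: index_mult_mat(1))
      qed
      finally show ?thesis using p1 by (simp add: p)
    qed
  qed
qed

text \<open>Includes outcomes of probability zero, so the filter stays among density matrices along
  every path, not just almost surely.\<close>

lemma Gam_density:
  assumes y: "y \<in> outcomes m"
  shows "Gam m \<rho> u y \<in> density_matrices"
proof (cases "pr m y \<rho> u = 0")
  case True
  have y': "- y \<in> outcomes m" using y by (auto simp: outcomes_def)
  have "pr m (- y) \<rho> u = 1" using True by (simp add: pr_def)
  then have "complex_of_real (1 / 2) * tr (kraus m u (- y) * \<rho> * mat_adjoint (kraus m u (- y))) = 1"
    using tr_kraus[OF y'] by simp
  then show ?thesis using density_scale[OF kraus_psd, of "1 / 2" "- y"] Gam_kraus[OF y] True by simp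
next
  case False
  then have "complex_of_real (1 / (2 * pr m y \<rho> u)) * tr (kraus m u y * \<rho> * mat_adjoint (kraus m u y)) = 1"
    using tr_kraus[OF y] by simp
  then show ?thesis
    using density_scale[OF kraus_psd, of "1 / (2 * pr m y \<rho> u)" y] Gam_kraus[OF y] False pr_nonneg[OF y] by simp
qed

text \<open>Multiplying by the probability avoids the division: for an impossible outcome both sides
  are zero, so later arguments need no case distinction.\<close>

lemma pr_Gam:
  assumes y: "y \<in> outcomes m"
  shows "complex_of_real (pr m y \<rho> u) \<cdot>\<^sub>m Gam m \<rho> u y =
    complex_of_real (1 / 2) \<cdot>\<^sub>m (kraus m u y * \<rho> * mat_adjoint (kraus m u y))"
proof (cases "pr m y \<rho> u = 0")
  case True
  then have "kraus m u y * \<rho> * mat_adjoint (kraus m u y) = 0\<^sub>m 2 2"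
    using tr_kraus[OF y] by (intro psd_trace_zero kraus_psd) simp
  then show ?thesis using True carrier_matD[OF density_props(1)[OF Gam_density[OF y]]]
    by (intro eq_matI) auto
next
  case False
  then show ?thesis unfolding Gam_kraus[OF y] by (simp add: smult_smult_mat)
qed

end

end

section \<open>Dynamic programming\<close>

definition path_weight :: "homodyne \<Rightarrow> strategy \<Rightarrow> nat \<Rightarrow> real list \<Rightarrow> real" where
  "path_weight m f l ys = Re (tr (tau m f l ys))"

lemma cond_state_take: "l \<le> n \<Longrightarrow> cond_state m f l (take n ys) = cond_state m f l ys"
  by (induction l) (auto simp: min_def)

lemma cond_state_append: "length ys = l \<Longrightarrow> cond_state m f l (ys @ zs) = cond_state m f l ys"
  using cond_state_take[of l l m f "ys @ zs"] by simp

lemma take_paths: "ys \<in> paths m n \<Longrightarrow> l \<le> n \<Longrightarrow> take l ys \<in> paths m l"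
  by (auto simp: paths_def dest: in_set_takeD)

lemma nth_paths: "ys \<in> paths m n \<Longrightarrow> l < n \<Longrightarrow> ys ! l \<in> outcomes m"
  using nth_mem[of l ys] by (auto simp: paths_def outcomes_def simp del: nth_mem)

lemma sum_extensions_split:
  fixes F :: "real list \<Rightarrow> real"
  assumes l: "l < k" and ys: "ys \<in> paths m l"
  shows "(\<Sum>zs | zs \<in> paths m k \<and> take l zs = ys. F zs) =
    (\<Sum>y\<in>outcomes m. \<Sum>zs | zs \<in> paths m k \<and> take (Suc l) zs = ys @ [y]. F zs)"
proof -
  let ?S = "{zs. zs \<in> paths m k \<and> take l zs = ys}"
  have "{zs \<in> ?S. zs ! l = y} = {zs. zs \<in> paths m k \<and> take (Suc l) zs = ys @ [y]}" for y
    using l by (auto simp: paths_def take_Suc_conv_app_nth)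
  moreover have "(\<Sum>y\<in>outcomes m. \<Sum>zs | zs \<in> ?S \<and> zs ! l = y. F zs) = sum F ?S"
    using l nth_paths by (intro sum.group) auto
  ultimately show ?thesis by simp
qed

lemma separated_control:
  "separated_by m f g \<Longrightarrow> n < slots m \<Longrightarrow> ys \<in> paths m n \<Longrightarrow> f (Suc n) ys = g n (cond_state m f n ys)"
  by (auto simp: separated_by_def Ball_def)

text \<open>The number \<open>n\<close> counts the remaining steps, which makes the backward
  recursion primitive. The law of the strategy does not enter, so the value is meaningful at
  unreachable states too.\<close>

primrec dp_value :: "homodyne \<Rightarrow> (nat \<Rightarrow> complex mat \<Rightarrow> real) \<Rightarrow> nat \<Rightarrow> complex mat \<Rightarrow> real" where
  "dp_value m g 0 \<rho> = Re (tr (\<rho> * Kcost m))"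
| "dp_value m g (Suc n) \<rho> =
     Re (tr (\<rho> * Qcost m (g (slots m - Suc n) \<rho>))) * dt m +
     (\<Sum>y\<in>outcomes m. pr m y \<rho> (g (slots m - Suc n) \<rho>) *
        dp_value m g n (Gam m \<rho> (g (slots m - Suc n) \<rho>) y))"

context
  fixes m :: homodyne
  assumes model: "homodyne_model m"
begin

lemma init_density: "init m \<in> density_matrices"
  using model by (simp add: homodyne_model_def)

context
  fixes f :: strategy
  assumes adm: "f \<in> admissible_strategies m"
begin

lemma cond_state_density:
  assumes ys: "ys \<in> paths m n" and n: "n \<le> slots m" and l: "l \<le> n"
  shows "cond_state m f l ys \<in> density_matrices"
  using l
proof (induction l)
  case (Suc l)
  then have "f (Suc l) (take l ys) \<in> controls m"
    using take_paths[OF ys, of l] n by (intro admissible_control[OF adm]) auto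
  then show ?case using Suc nth_paths[OF ys] by (auto intro!: Gam_density[OF model])
qed (simp add: init_density)

text \<open>The inductive step of \<open>tau_cond_state\<close>, kept separate because
  \<open>path_weight_Suc\<close> rests on the same identity.\<close>

lemma tau_step:
  assumes ys: "ys \<in> paths m n" and n: "n < slots m" and y: "y \<in> outcomes m"
    and IH: "tau m f n ys = complex_of_real (path_weight m f n ys) \<cdot>\<^sub>m cond_state m f n ys"
  shows "tau m f (Suc n) (ys @ [y]) = complex_of_real (path_weight m f n ys *
      pr m y (cond_state m f n ys) (f (Suc n) ys)) \<cdot>\<^sub>m cond_state m f (Suc n) (ys @ [y])"
proof -
  let ?\<rho> = "cond_state m f n ys" and ?u = "f (Suc n) ys" and ?w = "complex_of_real (path_weight m f n ys)"
  have len: "length ys = n" using ys by (simp add: paths_def)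
  have u: "?u \<in> controls m" using ys n by (intro admissible_control[OF adm]) auto
  have \<rho>: "?\<rho> \<in> density_matrices" using ys n by (intro cond_state_density) auto
  note d = density_props(5,6)[OF \<rho>] kraus_carrier(2,3)[OF model u]
  have "tau m f (Suc n) (ys @ [y]) = complex_of_real (1 / 2) \<cdot>\<^sub>m (kraus m ?u y * (?w \<cdot>\<^sub>m ?\<rho>) * mat_adjoint (kraus m ?u y))"
    using len by (simp add: nth_append tau_append IH)
  also have "\<dots> = ?w \<cdot>\<^sub>m (complex_of_real (1 / 2) \<cdot>\<^sub>m (kraus m ?u y * ?\<rho> * mat_adjoint (kraus m ?u y)))"
    using d by (simp add: mult_smult_dim smult_mult_dim smult_smult_mat mult.commute)
  also have "\<dots> = ?w \<cdot>\<^sub>m (complex_of_real (pr m y ?\<rho> ?u) \<cdot>\<^sub>m Gam m ?\<rho> ?u y)"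
    by (simp only: pr_Gam[OF model u \<rho> y])
  also have "Gam m ?\<rho> ?u y = cond_state m f (Suc n) (ys @ [y])"
    using len by (simp add: nth_append cond_state_append)
  finally show ?thesis by (simp add: smult_smult_mat)
qed

lemma tau_cond_state:
  assumes "ys \<in> paths m n" "n \<le> slots m"
  shows "tau m f n ys = complex_of_real (path_weight m f n ys) \<cdot>\<^sub>m cond_state m f n ys"
  using assms
proof (induction n arbitrary: ys)
  case 0
  then show ?case using density_props(4)[OF init_density] by (simp add: path_weight_def)
next
  case (Suc n)
  obtain zs y where zs: "ys = zs @ [y]" "zs \<in> paths m n" "y \<in> outcomes m"
    using Suc.prems(1) by (rule paths_SucE)
  have n: "n < slots m" using Suc.prems by simp
  have step: "tau m f (Suc n) ys = complex_of_real (path_weight m f n zs *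
      pr m y (cond_state m f n zs) (f (Suc n) zs)) \<cdot>\<^sub>m cond_state m f (Suc n) ys"
    unfolding zs(1) using Suc.IH[OF zs(2)] n by (intro tau_step zs) auto
  have "cond_state m f (Suc n) ys \<in> density_matrices"
    using Suc.prems by (intro cond_state_density[OF Suc.prems(1)]) auto
  then have "tr (tau m f (Suc n) ys) = complex_of_real (path_weight m f n zs *
      pr m y (cond_state m f n zs) (f (Suc n) zs))"
    unfolding step using density_props by (simp add: tr_smult del: cond_state.simps)
  then have "path_weight m f (Suc n) ys = path_weight m f n zs * pr m y (cond_state m f n zs) (f (Suc n) zs)"
    unfolding path_weight_def[of m f "Suc n"] by (simp only: Re_complex_of_real)
  then show ?case using step by (simp only:)
qed

lemma path_weight_0: "path_weight m f 0 ys = 1"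
  using density_props(4)[OF init_density] by (simp add: path_weight_def)

lemma path_weight_Suc:
  assumes ys: "ys \<in> paths m n" and n: "n < slots m" and y: "y \<in> outcomes m"
  shows "path_weight m f (Suc n) (ys @ [y]) = path_weight m f n ys * pr m y (cond_state m f n ys) (f (Suc n) ys)"
proof -
  have "cond_state m f (Suc n) (ys @ [y]) \<in> density_matrices"
    using n paths_SucI[OF ys y] by (intro cond_state_density[of _ "Suc n"]) auto
  then have "tr (tau m f (Suc n) (ys @ [y])) = complex_of_real (path_weight m f n ys *
      pr m y (cond_state m f n ys) (f (Suc n) ys))"
    unfolding tau_step[OF ys n y tau_cond_state[OF ys less_imp_le[OF n]]]
    using density_props by (simp add: tr_smult del: cond_state.simps)
  then show ?thesis unfolding path_weight_def[of m f "Suc n"] by (simp only: Re_complex_of_real)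
qed

lemma path_weight_nonneg:
  assumes "ys \<in> paths m n" "n \<le> slots m"
  shows "0 \<le> path_weight m f n ys"
  using assms
proof (induction n arbitrary: ys)
  case (Suc n)
  obtain zs y where zs: "ys = zs @ [y]" "zs \<in> paths m n" "y \<in> outcomes m"
    using Suc.prems(1) by (rule paths_SucE)
  have "0 \<le> pr m y (cond_state m f n zs) (f (Suc n) zs)"
    using Suc.prems zs by (intro pr_nonneg[OF model] admissible_control[OF adm] cond_state_density[OF zs(2)]) auto
  then show ?case using Suc zs by (simp add: path_weight_Suc)
qed (simp add: path_weight_0)

lemma Re_tr_tau:
  assumes "ys \<in> paths m n" "n \<le> slots m" "X \<in> carrier_mat 2 2"
  shows "Re (tr (tau m f n ys * X)) = path_weight m f n ys * Re (tr (cond_state m f n ys * X))"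
proof -
  have "cond_state m f n ys \<in> density_matrices" using assms by (intro cond_state_density[OF assms(1)]) auto
  then show ?thesis unfolding tau_cond_state[OF assms(1,2)]
    using density_props(5,6) assms(3) by (simp add: smult_mult_dim tr_smult)
qed

lemma sum_path_weight:
  assumes "n < slots m" "ys \<in> paths m n"
  shows "(\<Sum>y\<in>outcomes m. path_weight m f (Suc n) (ys @ [y])) = path_weight m f n ys"
  using assms pr_sum[OF model, of "f (Suc n) ys" "cond_state m f n ys"]
    admissible_control[OF adm assms] cond_state_density[OF assms(2), of n]
  by (simp add: path_weight_Suc flip: sum_distrib_left)

lemma sum_extensions_weight:
  assumes "l \<le> slots m" "ys \<in> paths m l"
  shows "(\<Sum>zs | zs \<in> paths m (slots m) \<and> take l zs = ys. path_weight m f (slots m) zs) = path_weight m f l ys"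
  using assms
proof (induction l arbitrary: ys rule: inc_induct)
  case base
  then have "{zs. zs \<in> paths m (slots m) \<and> take (slots m) zs = ys} = {ys}" by (auto simp: paths_def)
  then show ?case by simp
next
  case (step l)
  then show ?case
    by (simp add: sum_extensions_split paths_SucI sum_path_weight)
qed

section \<open>Events and integrals under the law of the outcomes\<close>

lemma obs_law_eq:
  "obs_law m f = point_measure (paths m (slots m)) (\<lambda>ys. ennreal (path_weight m f (slots m) ys))"
  unfolding obs_law_def point_measure_def path_weight_def
  by (rule density_cong) (auto simp: AE_count_space obs_density[OF model adm, unfolded One_nat_def] simp del: upt_Suc)

lemma space_obs_law: "space (obs_law m f) = paths m (slots m)"
  by (simp add: obs_law_eq space_point_measure)

lemma obs_law_integral:
  assumes "E \<subseteq> paths m (slots m)"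
  shows "(LINT ys:E|obs_law m f. h ys) = (\<Sum>ys\<in>E. path_weight m f (slots m) ys * h ys)"
    and "measure (obs_law m f) E = (\<Sum>ys\<in>E. path_weight m f (slots m) ys)"
proof -
  have nn: "0 \<le> path_weight m f (slots m) ys" if "ys \<in> paths m (slots m)" for ys
    using that by (intro path_weight_nonneg) auto
  have int: "integral\<^sup>L (obs_law m f) F = (\<Sum>ys\<in>paths m (slots m). path_weight m f (slots m) ys * F ys)" for F :: "real list \<Rightarrow> real"
    unfolding obs_law_eq using nn by (subst lebesgue_integral_point_measure_finite) auto
  show "(LINT ys:E|obs_law m f. h ys) = (\<Sum>ys\<in>E. path_weight m f (slots m) ys * h ys)"
    unfolding set_lebesgue_integral_def int using assms
    by (intro sum.mono_neutral_cong_right) (auto simp: indicator_def)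
  have "emeasure (obs_law m f) E = (\<Sum>ys\<in>E. ennreal (path_weight m f (slots m) ys))"
    unfolding obs_law_eq using assms by (intro emeasure_point_measure_finite) auto
  also have "\<dots> = ennreal (\<Sum>ys\<in>E. path_weight m f (slots m) ys)"
    using nn assms by (intro sum_ennreal) auto
  finally show "measure (obs_law m f) E = (\<Sum>ys\<in>E. path_weight m f (slots m) ys)"
    using nn assms by (auto simp: measure_def intro!: enn2real_ennreal sum_nonneg)
qed

text \<open>The state at time \<open>l\<close> depends only on the first \<open>l\<close> outcomes,
  so complete paths can be grouped by that prefix.\<close>

lemma sum_state_event:
  assumes "l \<le> slots m"
  shows "sum F (state_event m f l \<rho>) =
    (\<Sum>ys | ys \<in> paths m l \<and> cond_state m f l ys = \<rho>. \<Sum>zs | zs \<in> paths m (slots m) \<and> take l zs = ys. F zs)"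
proof -
  let ?E = "state_event m f l \<rho>" and ?T = "{ys. ys \<in> paths m l \<and> cond_state m f l ys = \<rho>}"
  have E: "?E = {zs \<in> paths m (slots m). cond_state m f l zs = \<rho>}"
    by (simp add: state_event_def space_obs_law)
  have "sum F ?E = (\<Sum>ys\<in>?T. sum F {zs \<in> ?E. take l zs = ys})"
    unfolding E using assms take_paths
    by (intro sum.group[symmetric]) (auto simp: cond_state_take)
  also have "\<dots> = (\<Sum>ys\<in>?T. \<Sum>zs | zs \<in> paths m (slots m) \<and> take l zs = ys. F zs)"
    unfolding E using cond_state_take[of l l m f] by (intro sum.cong) auto
  finally show ?thesis .
qed

lemma measure_state_event:
  assumes "l \<le> slots m"
  shows "measure (obs_law m f) (state_event m f l \<rho>) = (\<Sum>ys | ys \<in> paths m l \<and> cond_state m f l ys = \<rho>. path_weight m f l ys)"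
proof -
  have "state_event m f l \<rho> \<subseteq> paths m (slots m)" by (auto simp: state_event_def space_obs_law)
  then show ?thesis using assms
    by (simp add: obs_law_integral(2) sum_state_event sum_extensions_weight)
qed

lemma reachable_density:
  assumes "l \<le> slots m" "reachable m f l \<rho>"
  shows "\<rho> \<in> density_matrices"
proof -
  have "{ys. ys \<in> paths m l \<and> cond_state m f l ys = \<rho>} \<noteq> {}"
  proof
    assume "{ys. ys \<in> paths m l \<and> cond_state m f l ys = \<rho>} = {}"
    then have "measure (obs_law m f) (state_event m f l \<rho>) = 0"
      unfolding measure_state_event[OF assms(1)] by (simp only: sum.empty)
    then show False using assms(2) by (simp add: reachable_def)
  qed
  then show ?thesis using cond_state_density assms(1) by auto
qed

lemma Qcost_carrier: "n < slots m \<Longrightarrow> ys \<in> paths m n \<Longrightarrow> Qcost m (f (Suc n) ys) \<in> carrier_mat 2 2"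
  using model admissible_control[OF adm] by (simp add: homodyne_model_def)

section \<open>Cost-to-go and total cost through the backward recursion\<close>

context
  fixes g :: "nat \<Rightarrow> complex mat \<Rightarrow> real"
  assumes sep: "separated_by m f g"
begin

lemma dp_value_step:
  assumes n: "n < slots m" and ys: "ys \<in> paths m n"
  shows "path_weight m f n ys * dp_value m g (slots m - n) (cond_state m f n ys) =
    path_weight m f n ys * (Re (tr (cond_state m f n ys * Qcost m (f (Suc n) ys))) * dt m) +
    (\<Sum>y\<in>outcomes m. path_weight m f (Suc n) (ys @ [y]) * dp_value m g (slots m - Suc n) (cond_state m f (Suc n) (ys @ [y])))"
proof -
  have k: "slots m - n = Suc (slots m - Suc n)" "slots m - Suc (slots m - Suc n) = n" using n by auto
  have len: "length ys = n" using ys by (simp add: paths_def)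
  have "cond_state m f (Suc n) (ys @ [y]) = Gam m (cond_state m f n ys) (f (Suc n) ys) y" for y
    using len by (simp add: nth_append cond_state_append)
  then show ?thesis
    using n ys by (simp add: k path_weight_Suc separated_control[OF sep, symmetric] sum_distrib_left distrib_left mult.assoc
        del: cond_state.simps)
qed

text \<open>The Markov property in unnormalised form: the expected remaining cost after a prefix
  depends on the prefix only through its filter state. Keeping the weight as a factor makes the
  identity valid for null prefixes too.\<close>

lemma sum_extensions_remaining_cost:
  assumes "l \<le> slots m" "ys \<in> paths m l"
  shows "(\<Sum>zs | zs \<in> paths m (slots m) \<and> take l zs = ys. path_weight m f (slots m) zs * remaining_cost m f l zs) =
    path_weight m f l ys * dp_value m g (slots m - l) (cond_state m f l ys)"
  using assms
proof (induction l arbitrary: ys rule: inc_induct)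
  case base
  then have "{zs. zs \<in> paths m (slots m) \<and> take (slots m) zs = ys} = {ys}" by (auto simp: paths_def)
  then show ?case by (simp add: remaining_cost_def)
next
  case (step l)
  let ?c = "Re (tr (cond_state m f l ys * Qcost m (f (Suc l) ys))) * dt m"
  let ?Z = "{zs. zs \<in> paths m (slots m) \<and> take l zs = ys}"
  have rc: "remaining_cost m f l zs = ?c + remaining_cost m f (Suc l) zs" if "zs \<in> ?Z" for zs
  proof -
    have "cond_state m f l zs = cond_state m f l ys" using that cond_state_take[of l l m f zs] by auto
    then show ?thesis using that step.hyps
      by (simp add: remaining_cost_def sum.atLeast_Suc_atMost[of "Suc l"] distrib_right)
  qed
  have "(\<Sum>zs\<in>?Z. path_weight m f (slots m) zs * remaining_cost m f l zs) =
      (\<Sum>zs\<in>?Z. path_weight m f (slots m) zs) * ?c + (\<Sum>zs\<in>?Z. path_weight m f (slots m) zs * remaining_cost m f (Suc l) zs)"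
    unfolding sum_distrib_right sum.distrib[symmetric]
    by (intro sum.cong refl) (simp add: rc distrib_left del: mem_Collect_eq)
  also have "(\<Sum>zs\<in>?Z. path_weight m f (slots m) zs) = path_weight m f l ys"
    using step by (intro sum_extensions_weight) auto
  also have "(\<Sum>zs\<in>?Z. path_weight m f (slots m) zs * remaining_cost m f (Suc l) zs) =
      (\<Sum>y\<in>outcomes m. path_weight m f (Suc l) (ys @ [y]) * dp_value m g (slots m - Suc l) (cond_state m f (Suc l) (ys @ [y])))"
    unfolding sum_extensions_split[OF step.hyps(2) step.prems]
    using step.IH paths_SucI[OF step.prems] by (intro sum.cong) auto
  finally show ?case using dp_value_step[OF step.hyps(2) step.prems] by simp
qed

text \<open>Shows that the two versions combined in \<open>cost_to_go\<close> fit together, so the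
  backward recursion holds at every state.\<close>

lemma cost_to_go_dp_value:
  assumes "l \<le> slots m"
  shows "cost_to_go m f g l \<rho> = dp_value m g (slots m - l) \<rho>"
  using assms
proof (induction l arbitrary: \<rho> rule: inc_induct)
  \<comment> \<open>Different prefixes may end in the same state; all of them have the same value
    there, so averaging over them changes nothing.\<close>
  have reach: "cost_to_go m f g l \<rho> = dp_value m g (slots m - l) \<rho>" if l: "l \<le> slots m" and r: "reachable m f l \<rho>" for l \<rho>
  proof -
    let ?E = "state_event m f l \<rho>"
    have E: "?E \<subseteq> paths m (slots m)" by (auto simp: state_event_def space_obs_law)
    have "(LINT ys:?E|obs_law m f. remaining_cost m f l ys) =
        (\<Sum>ys | ys \<in> paths m l \<and> cond_state m f l ys = \<rho>. path_weight m f l ys * dp_value m g (slots m - l) (cond_state m f l ys))"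
      unfolding obs_law_integral(1)[OF E] sum_state_event[OF l]
      by (intro sum.cong refl sum_extensions_remaining_cost l) auto
    also have "\<dots> = measure (obs_law m f) ?E * dp_value m g (slots m - l) \<rho>"
      unfolding measure_state_event[OF l] sum_distrib_right by (intro sum.cong) auto
    finally show ?thesis
      using r by (subst cost_to_go.simps) (auto simp: reachable_def)
  qed
  {
    case base
    show ?case
    proof (cases "reachable m f (slots m) \<rho>")
      case False
      then show ?thesis by (subst cost_to_go.simps) simp
    qed (simp add: reach)
  next
    case (step l)
    have k: "slots m - l = Suc (slots m - Suc l)" "slots m - Suc (slots m - Suc l) = l"
      using step.hyps by auto
    show ?case
    proof (cases "reachable m f l \<rho>")
      case True
      then show ?thesis using reach step.hyps by simp
    next
      case False
      then have "cost_to_go m f g l \<rho> = Re (tr (\<rho> * Qcost m (g l \<rho>))) * dt m +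
          (\<Sum>y\<in>outcomes m. pr m y \<rho> (g l \<rho>) * cost_to_go m f g (Suc l) (Gam m \<rho> (g l \<rho>) y))"
        using step.hyps unfolding outcomes_def by (subst cost_to_go.simps) (simp only: if_False not_le[symmetric] simp_thms)
      then show ?thesis unfolding k(1) dp_value.simps k(2) by (simp only: step.IH)
    qed
  }
qed

text \<open>Condenses only the costs from time \<open>l\<close> on, so that strategies with a common
  past can be compared through their values at time \<open>l\<close>.\<close>

lemma total_cost_split:
  assumes "l \<le> slots m"
  shows "total_cost m f =
    (\<Sum>n<l. \<Sum>ys\<in>paths m n. path_weight m f n ys * (Re (tr (cond_state m f n ys * Qcost m (f (Suc n) ys))) * dt m)) +
    (\<Sum>ys\<in>paths m l. path_weight m f l ys * dp_value m g (slots m - l) (cond_state m f l ys))"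
  using assms
proof (induction l rule: inc_induct)
  case base
  have K: "Kcost m \<in> carrier_mat 2 2" using model by (simp add: homodyne_model_def)
  show ?case unfolding total_cost_tau[OF model adm]
    by (intro arg_cong2[where f = "(+)"] sum.cong refl) (auto simp: Re_tr_tau Qcost_carrier K)
next
  case (step l)
  have "(\<Sum>ys\<in>paths m l. path_weight m f l ys * dp_value m g (slots m - l) (cond_state m f l ys)) =
      (\<Sum>ys\<in>paths m l. path_weight m f l ys * (Re (tr (cond_state m f l ys * Qcost m (f (Suc l) ys))) * dt m)) +
      (\<Sum>ys\<in>paths m (Suc l). path_weight m f (Suc l) ys * dp_value m g (slots m - Suc l) (cond_state m f (Suc l) ys))"
    unfolding sum_paths_Suc sum.distrib[symmetric]
    using step.hyps by (intro sum.cong refl dp_value_step) auto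
  then show ?case using step.IH by simp
qed

end

end

end

section \<open>Strategies generated by feedback maps\<close>

primrec feedback_state :: "homodyne \<Rightarrow> (nat \<Rightarrow> complex mat \<Rightarrow> real) \<Rightarrow> nat \<Rightarrow> real list \<Rightarrow> complex mat" where
  "feedback_state m g 0 ys = init m"
| "feedback_state m g (Suc l) ys = Gam m (feedback_state m g l ys) (g l (feedback_state m g l ys)) (ys ! l)"

text \<open>Uses \<open>feedback_state\<close> because \<open>cond_state\<close> takes as argument
  the very strategy under construction; \<open>cond_state_feedback\<close> shows that both filters
  agree.\<close>

definition feedback_strategy :: "homodyne \<Rightarrow> (nat \<Rightarrow> complex mat \<Rightarrow> real) \<Rightarrow> strategy" where
  "feedback_strategy m g l ys = g (l - 1) (feedback_state m g (l - 1) ys)"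

lemma feedback_state_take: "l \<le> n \<Longrightarrow> feedback_state m g l (take n ys) = feedback_state m g l ys"
  by (induction l) auto

lemma cond_state_feedback: "cond_state m (feedback_strategy m g) l ys = feedback_state m g l ys"
  by (induction l) (simp_all add: feedback_strategy_def feedback_state_take)

lemma dp_value_cong:
  assumes "n \<le> slots m" "\<And>j. slots m - n \<le> j \<Longrightarrow> j < slots m \<Longrightarrow> g j = g' j"
  shows "dp_value m g n \<rho> = dp_value m g' n \<rho>"
  using assms by (induction n arbitrary: \<rho>) auto

lemma separated_by_feedback:
  assumes model: "homodyne_model m"
    and g: "\<And>n \<rho>. n < slots m \<Longrightarrow> \<rho> \<in> density_matrices \<Longrightarrow> g n \<rho> \<in> controls m"
  shows "separated_by m (feedback_strategy m g) g"
proof -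
  have dens: "feedback_state m g l ys \<in> density_matrices" if "ys \<in> paths m n" "l \<le> n" "n \<le> slots m" for n l ys
    using that(2)
  proof (induction l)
    case (Suc l)
    then show ?case using nth_paths[OF that(1)] that(3) g by (auto intro!: Gam_density[OF model])
  qed (simp add: init_density[OF model])
  have "feedback_strategy m g l ys \<in> controls m" if "l \<in> {1..slots m}" "ys \<in> paths m (l - 1)" for l ys
    unfolding feedback_strategy_def using that by (intro g dens[of ys "l - 1"]) auto
  then show ?thesis
    using g by (auto simp: separated_by_def admissible_strategies_def cond_state_feedback)
      (simp add: feedback_strategy_def)
qed

section \<open>Separated strategies with the same feedback before time \<open>l\<close>\<close>

context
  fixes m :: homodyne and f f' :: strategy and g g' :: "nat \<Rightarrow> complex mat \<Rightarrow> real" and l :: nat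
  assumes sep: "separated_by m f g" and sep': "separated_by m f' g'"
    and agree: "\<And>n. n < l \<Longrightarrow> g n = g' n" and l: "l \<le> slots m"
begin

lemma cond_state_agree: "n \<le> l \<Longrightarrow> ys \<in> paths m n \<Longrightarrow> cond_state m f n ys = cond_state m f' n ys"
proof (induction n arbitrary: ys)
  case (Suc n)
  have t: "take n ys \<in> paths m n" using Suc.prems take_paths by auto
  have n: "n < slots m" using Suc.prems l by simp
  have "cond_state m f n ys = cond_state m f' n ys"
    using Suc.IH[OF _ t] Suc.prems cond_state_take[of n n m f ys] cond_state_take[of n n m f' ys] by simp
  moreover have "f (Suc n) (take n ys) = f' (Suc n) (take n ys)"
    using separated_control[OF sep n t] separated_control[OF sep' n t] agree[of n] Suc.IH[OF _ t] Suc.prems by simp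
  ultimately show ?case by simp
qed simp

lemma control_agree: "n < l \<Longrightarrow> ys \<in> paths m n \<Longrightarrow> f (Suc n) ys = f' (Suc n) ys"
  using separated_control[OF sep, of n ys] separated_control[OF sep', of n ys] agree l cond_state_agree[of n ys] by simp

lemma path_weight_agree: "n \<le> l \<Longrightarrow> ys \<in> paths m n \<Longrightarrow> path_weight m f n ys = path_weight m f' n ys"
proof -
  assume n: "n \<le> l" and ys: "ys \<in> paths m n"
  have "tau m f j ys = tau m f' j ys" if "j \<le> n" for j
    using that
  proof (induction j)
    case (Suc j)
    then have "f (Suc j) (take j ys) = f' (Suc j) (take j ys)"
      using n take_paths[OF ys] by (intro control_agree) auto
    then show ?case using Suc by simp
  qed simp
  then show ?thesis by (simp add: path_weight_def)
qed

end

text \<open>Taking the infimum in \<open>ereal\<close> lets it exist without a prior lower bound on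
  the bracket.\<close>

theorem lemma8p3:
  fixes m :: homodyne and f :: strategy and g :: "nat \<Rightarrow> complex mat \<Rightarrow> real"
    and V :: "nat \<Rightarrow> complex mat \<Rightarrow> real"
  assumes model: "homodyne_model m"
    and separated: "separated_by m f g"
    and optimal: "\<forall>f' \<in> separated_strategies m. total_cost m f \<le> total_cost m f'"
    and V_def: "V = cost_to_go m f g"
  shows "(\<forall>l < slots m. \<forall>\<rho>. reachable m f l \<rho> \<longrightarrow>
      ereal (V l \<rho>) = (INF u \<in> controls m.
        ereal (Re (tr (\<rho> * Qcost m u)) * dt m +
          (\<Sum>y \<in> {lam m, - lam m}. pr m y \<rho> u * V (Suc l) (Gam m \<rho> u y)))) \<and>
      g l \<rho> \<in> controls m \<and>
      V l \<rho> = Re (tr (\<rho> * Qcost m (g l \<rho>))) * dt m +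
          (\<Sum>y \<in> {lam m, - lam m}. pr m y \<rho> (g l \<rho>) * V (Suc l) (Gam m \<rho> (g l \<rho>) y))) \<and>
    (\<forall>\<rho>. reachable m f (slots m) \<rho> \<longrightarrow> V (slots m) \<rho> = Re (tr (\<rho> * Kcost m)))"
proof -
  have adm: "f \<in> admissible_strategies m"
    and gC: "\<And>n \<rho>. n < slots m \<Longrightarrow> \<rho> \<in> density_matrices \<Longrightarrow> g n \<rho> \<in> controls m"
    using separated by (auto simp: separated_by_def)
  have V: "V l \<rho> = dp_value m g (slots m - l) \<rho>" if "l \<le> slots m" for l \<rho>
    unfolding V_def by (rule cost_to_go_dp_value[OF model adm separated that])
  define B where "B l \<rho> u = Re (tr (\<rho> * Qcost m u)) * dt m +
      (\<Sum>y \<in> {lam m, - lam m}. pr m y \<rho> u * V (Suc l) (Gam m \<rho> u y))" for l \<rho> u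
  \<comment> \<open>The values at time \<open>Suc l\<close> involve only the maps after
    \<open>l\<close>, so \<open>h\<close> may be chosen freely at \<open>l\<close> itself.\<close>
  have step: "dp_value m h (slots m - l) \<rho> = B l \<rho> (h l \<rho>)"
    if "l < slots m" "\<And>j. l < j \<Longrightarrow> j < slots m \<Longrightarrow> h j = g j" for h l \<rho>
  proof -
    have k: "slots m - l = Suc (slots m - Suc l)" "slots m - Suc (slots m - Suc l) = l" using that(1) by auto
    have "dp_value m h (slots m - Suc l) \<rho>' = V (Suc l) \<rho>'" for \<rho>'
      unfolding V[OF Suc_leI[OF that(1)]] using that by (intro dp_value_cong) auto
    then show ?thesis unfolding k(1) dp_value.simps k(2) B_def outcomes_def by simp
  qed
  have VB: "V l \<rho> = B l \<rho> (g l \<rho>)" if "l < slots m" for l \<rho>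
    using step[OF that, of g] V that by simp
  have le: "V l \<rho> \<le> B l \<rho> u" if l: "l < slots m" and r: "reachable m f l \<rho>" and u: "u \<in> controls m" for l \<rho> u
  proof -
    have lk: "l \<le> slots m" using l by simp
    \<comment> \<open>Only the control at time \<open>l\<close> and state \<rho> is changed. The
      past keeps its law, and the continuation has value V even at states that \<open>f\<close> does
      not reach.\<close>
    define g' where "g' = g(l := (g l)(\<rho> := u))"
    define f' where "f' = feedback_strategy m g'"
    have sep': "separated_by m f' g'" unfolding f'_def
      using gC u by (intro separated_by_feedback[OF model]) (auto simp: g'_def)
    then have adm': "f' \<in> admissible_strategies m" by (simp add: separated_by_def)
    have agree: "g n = g' n" if "n < l" for n using that by (simp add: g'_def)
    note cs = cond_state_agree[OF separated sep' agree lk]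
      and ca = control_agree[OF separated sep' agree lk]
      and pw = path_weight_agree[OF separated sep' agree lk]
    have dp': "dp_value m g' (slots m - l) \<rho>' = (if \<rho>' = \<rho> then B l \<rho> u else V l \<rho>')" for \<rho>'
    proof -
      have "dp_value m g' (slots m - l) \<rho>' = B l \<rho>' (g' l \<rho>')"
        using l by (intro step) (auto simp: g'_def)
      then show ?thesis using VB[OF l] by (simp add: g'_def)
    qed
    let ?w = "path_weight m f l" and ?c = "cond_state m f l"
    have "total_cost m f \<le> total_cost m f'" using optimal sep' by (auto simp: separated_strategies_def)
    also have "total_cost m f' =
      (\<Sum>n<l. \<Sum>ys\<in>paths m n. path_weight m f n ys * (Re (tr (cond_state m f n ys * Qcost m (f (Suc n) ys))) * dt m)) +
      (\<Sum>ys\<in>paths m l. ?w ys * dp_value m g' (slots m - l) (?c ys))"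
      unfolding total_cost_split[OF model adm' sep' lk]
      by (intro arg_cong2[where f = "(+)"] sum.cong refl) (auto simp: cs ca pw)
    \<comment> \<open>The running costs before \<open>l\<close> are the same for both strategies and
      cancel.\<close>
    finally have "(\<Sum>ys\<in>paths m l. ?w ys * V l (?c ys)) \<le> (\<Sum>ys\<in>paths m l. ?w ys * dp_value m g' (slots m - l) (?c ys))"
      unfolding total_cost_split[OF model adm separated lk] V[OF lk] by simp
    then have "0 \<le> (\<Sum>ys\<in>paths m l. ?w ys * (dp_value m g' (slots m - l) (?c ys) - V l (?c ys)))"
      by (simp add: right_diff_distrib sum_subtractf)
    \<comment> \<open>Paths ending in any other state drop out, since both values coincide
      there.\<close>
    also have "\<dots> = (\<Sum>ys\<in>paths m l. if ?c ys = \<rho> then ?w ys * (B l \<rho> u - V l \<rho>) else 0)"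
      by (intro sum.cong refl) (simp add: dp')
    also have "\<dots> = measure (obs_law m f) (state_event m f l \<rho>) * (B l \<rho> u - V l \<rho>)"
      unfolding measure_state_event[OF model adm lk] sum_distrib_right
      by (simp add: sum.inter_filter)
    \<comment> \<open>Reachability makes the measure strictly positive, so the difference is
      nonnegative.\<close>
    finally show ?thesis using r by (simp add: reachable_def zero_le_mult_iff)
  qed
  have main: "ereal (V l \<rho>) = (INF u \<in> controls m. ereal (B l \<rho> u)) \<and> g l \<rho> \<in> controls m \<and> V l \<rho> = B l \<rho> (g l \<rho>)"
    if l: "l < slots m" and r: "reachable m f l \<rho>" for l \<rho>
  proof -
    have gc: "g l \<rho> \<in> controls m"
      using gC[OF l] reachable_density[OF model adm _ r] l by simp
    have "ereal (V l \<rho>) = (INF u \<in> controls m. ereal (B l \<rho> u))"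
    proof (rule antisym)
      show "ereal (V l \<rho>) \<le> (INF u \<in> controls m. ereal (B l \<rho> u))"
        using le[OF l r] by (intro INF_greatest) simp
      show "(INF u \<in> controls m. ereal (B l \<rho> u)) \<le> ereal (V l \<rho>)"
        using gc by (intro INF_lower2[OF gc]) (simp add: VB[OF l])
    qed
    then show ?thesis using gc VB[OF l] by simp
  qed
  have "V (slots m) \<rho> = Re (tr (\<rho> * Kcost m))" for \<rho>
    using V[of "slots m"] by simp
  then show ?thesis using main[unfolded B_def] by blast
qed

end
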